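(* Let $\Sigma(x)$ be an $\boldsymbol{e}$-invariant partial type such that $\boldsymbol{e}\in\operatorname{dcl}(c_0)$ for some small tuple $c_0$ of realizations of $\Sigma$. Let $H\le\operatorname{Aut}_{\boldsymbol{e}}(\mathfrak{C})$. The following are equivalent. (1) $\pi_\Sigma[H]$ is closed in $\operatorname{Gal}_{\mathrm L}(\Sigma,\boldsymbol{e})$ and $H=\pi_\Sigma^{-1}[\pi_\Sigma[H]]$. (2) $H=\operatorname{Aut}_{\boldsymbol{e}'\boldsymbol{e}}(\mathfrak{C})$ for some hyperimaginary $\boldsymbol{e}'$ (not necessarily countable) that is bounded over $\boldsymbol{e}$ and such that one of the representatives of $\boldsymbol{e}'$ is a tuple of realizations of $\Sigma$.
   Context: $T$ is a complete first-order theory with monster model $\mathfrak{C}$; "small" means of size less than the degree of saturation and strong homogeneity of $\mathfrak{C}$. All sets, tuples, ordinals, cardinals and (elementary sub)models considered are small. A hyperimaginary is an equivalence class $a_E$ of an $\emptyset$-type-definable equivalence relation $E$ on $\mathfrak{C}^\alpha$ ($\alpha$ a small ordinal), with representative $a$; it is countable if $a$ is a countable tuple. $\boldsymbol{e}=a_E$ is a fixed arbitrary hyperimaginary and $\operatorname{Aut}_{\boldsymbol{e}}(\mathfrak{C})=\{f\in\operatorname{Aut}(\mathfrak{C}): f(\boldsymbol{e})=\boldsymbol{e}\text{ setwise}\}$; $\operatorname{Aut}_{\boldsymbol{e}'\boldsymbol{e}}(\mathfrak{C})$ is the group of automorphisms fixing both $\boldsymbol{e}'$ and $\boldsymbol{e}$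 (setwise). For a tuple or set $c$, $\boldsymbol{e}\in\operatorname{dcl}(c)$ means every automorphism fixing $c$ pointwise fixes $\boldsymbol{e}$. A hyperimaginary $\boldsymbol{e}'$ is bounded over $\boldsymbol{e}$ if $\{f(\boldsymbol{e}'):f\in\operatorname{Aut}_{\boldsymbol{e}}(\mathfrak{C})\}$ is small. $\operatorname{Autf}_{\mathrm L}(\mathfrak{C},\boldsymbol{e})$ is the (normal) subgroup of $\operatorname{Aut}_{\boldsymbol{e}}(\mathfrak{C})$ generated by those $f\in\operatorname{Aut}_{\boldsymbol{e}}(\mathfrak{C})$ that fix pointwise some model $M\models T$ with $\boldsymbol{e}\in\operatorname{dcl}(M)$. $c\equiv^{\mathrm L}_{\boldsymbol{e}} d$ means there is $f\in\operatorname{Autf}_{\mathrm L}(\mathfrak{C},\boldsymbol{e})$ with $f(c)=d$. $\Sigma(x)$ is a partial type, $x$ a possibly infinite tuple of variables; $\boldsymbol{e}$-invariant means that for $f\in\operatorname{Aut}_{\boldsymbol{e}}(\mathfrak{C})$, $b\models\Sigma$ iff $f(b)\models\Sigma$. $\Sigma(\mathfrak{C})$ is its solution set. A tuple of realizations of $\Sigma$ is a tuple $(b_i)_{i<\lambda}$ with each $b_i\models\Sigma$. $\operatorname{Aut}_{\boldsymbol{e}}(\Sigma)=\{f\upharpoonright\Sigma(\mathfrak{C}): f\in\operatorname{Aut}_{\boldsymbol{e}}(\mathfrak{C})\}$; $\operatorname{Autf}_{\mathrm L}(\Sigma,\boldsymbol{e})$ is the normal subgroup of all $\sigma\in\operatorname{Aut}_{\boldsymbol{e}}(\Sigma)$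 with $b\equiv^{\mathrm L}_{\boldsymbol{e}}\sigma(b)$ for every tuple $b$ (of any length) of realizations of $\Sigma$; $\operatorname{Gal}_{\mathrm L}(\Sigma,\boldsymbol{e})=\operatorname{Aut}_{\boldsymbol{e}}(\Sigma)/\operatorname{Autf}_{\mathrm L}(\Sigma,\boldsymbol{e})$. The surjective homomorphism $\pi_\Sigma:\operatorname{Aut}_{\boldsymbol{e}}(\mathfrak{C})\to\operatorname{Gal}_{\mathrm L}(\Sigma,\boldsymbol{e})$ sends $f$ to the coset of $f\upharpoonright\Sigma(\mathfrak{C})$. A Lascar tuple is a small tuple $b$ of realizations of $\Sigma$ with $\operatorname{Autf}_{\mathrm L}(\Sigma,\boldsymbol{e})=\{\sigma\in\operatorname{Aut}_{\boldsymbol{e}}(\Sigma): b\equiv^{\mathrm L}_{\boldsymbol{e}}\sigma(b)\}$. Under the hypothesis on $c_0$ there is a Lascar tuple $b$ with $\boldsymbol{e}\in\operatorname{dcl}(b)$; $\operatorname{Gal}_{\mathrm L}(\Sigma,\boldsymbol{e})$ carries the quotient topology under the well-defined surjection $\nu_b: S_b(b)=\{\operatorname{tp}(\sigma(b)/b):\sigma\in\operatorname{Aut}_{\boldsymbol{e}}(\Sigma)\}\to\operatorname{Gal}_{\mathrm L}(\Sigma,\boldsymbol{e})$, $\operatorname{tp}(\sigma(b)/b)\mapsto[\sigma]$, where $S_b(b)$ has the logic topology (this topology is independent of $b$ and makes $\operatorname{Gal}_{\mathrm L}(\Sigma,\boldsymbol{e})$ a quasi-compact topological group). *)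

theory Defs
  imports
    "HOL-Analysis.Abstract_Topology"
    "HOL-Algebra.Coset"
    "HOL-Algebra.Bij"
    "HOL-Algebra.Generated_Groups"
begin

unbundle cardinal_syntax

section \<open>First-order logic with parameters\<close>

text \<open>
  \<open>Par a\<close> is the constant naming the element \<open>a\<close>, so that a formula whose parameters lie in \<open>A\<close>
  is an \<open>L(A)\<close>-formula.  Equality is part of the logic.
\<close>

datatype ('f, 'v, tm_params: 'a) tm =
    Var 'v
  | Par 'a
  | App 'f "('f, 'v, 'a) tm list"

datatype ('f, 'r, 'v, params: 'a) fm =
    Eq "('f, 'v, 'a) tm" "('f, 'v, 'a) tm"
  | Rel 'r "('f, 'v, 'a) tm list"
  | Neg "('f, 'r, 'v, 'a) fm"
  | Conj "('f, 'r, 'v, 'a) fm" "('f, 'r, 'v, 'a) fm"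
  | Exists 'v "('f, 'r, 'v, 'a) fm"

text \<open>
  The arity maps are partial: a symbol of arity \<open>None\<close> does not belong to the language, so that
  languages without function symbols or without relation symbols are covered.  A structure has
  the whole type \<open>'a\<close> as its universe; interpretations matter only at the right arity.
\<close>

record ('f, 'r) language =
  fun_arity :: "'f \<rightharpoonup> nat"
  rel_arity :: "'r \<rightharpoonup> nat"

record ('f, 'r, 'a) fo_structure = "('f, 'r) language" +
  fun_int :: "'f \<Rightarrow> 'a list \<Rightarrow> 'a"
  rel_int :: "'r \<Rightarrow> 'a list \<Rightarrow> bool"

text \<open>A structure together with the cardinal that separates small sets from large ones.\<close>

record ('f, 'r, 'a, 'k) big_structure = "('f, 'r, 'a) fo_structure" +
  degree :: "'k rel"

fun tm_vars :: "('f, 'v, 'a) tm \<Rightarrow> 'v set" where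
  "tm_vars (Var v) = {v}"
| "tm_vars (Par a) = {}"
| "tm_vars (App s ts) = (\<Union>t\<in>set ts. tm_vars t)"

primrec fv :: "('f, 'r, 'v, 'a) fm \<Rightarrow> 'v set" where
  "fv (Eq s t) = tm_vars s \<union> tm_vars t"
| "fv (Rel R ts) = (\<Union>t\<in>set ts. tm_vars t)"
| "fv (Neg \<phi>) = fv \<phi>"
| "fv (Conj \<phi> \<psi>) = fv \<phi> \<union> fv \<psi>"
| "fv (Exists v \<phi>) = fv \<phi> - {v}"

fun wf_tm :: "('f, 'r, 'z) language_scheme \<Rightarrow> ('f, 'v, 'a) tm \<Rightarrow> bool" where
  "wf_tm L (Var v) \<longleftrightarrow> True"
| "wf_tm L (Par a) \<longleftrightarrow> True"
| "wf_tm L (App s ts) \<longleftrightarrow> fun_arity L s = Some (length ts) \<and> (\<forall>t\<in>set ts. wf_tm L t)"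

primrec wf_fm :: "('f, 'r, 'z) language_scheme \<Rightarrow> ('f, 'r, 'v, 'a) fm \<Rightarrow> bool" where
  "wf_fm L (Eq s t) \<longleftrightarrow> wf_tm L s \<and> wf_tm L t"
| "wf_fm L (Rel R ts) \<longleftrightarrow> rel_arity L R = Some (length ts) \<and> (\<forall>t\<in>set ts. wf_tm L t)"
| "wf_fm L (Neg \<phi>) \<longleftrightarrow> wf_fm L \<phi>"
| "wf_fm L (Conj \<phi> \<psi>) \<longleftrightarrow> wf_fm L \<phi> \<and> wf_fm L \<psi>"
| "wf_fm L (Exists v \<phi>) \<longleftrightarrow> wf_fm L \<phi>"

fun eval :: "('f, 'r, 'a, 'z) fo_structure_scheme \<Rightarrow> ('v \<Rightarrow> 'a) \<Rightarrow> ('f, 'v, 'a) tm \<Rightarrow> 'a" where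
  "eval C h (Var v) = h v"
| "eval C h (Par a) = a"
| "eval C h (App s ts) = fun_int C s (map (eval C h) ts)"

text \<open>Satisfaction in the substructure with universe \<open>D\<close>.\<close>

primrec sat ::
  "('f, 'r, 'a, 'z) fo_structure_scheme \<Rightarrow> 'a set \<Rightarrow> ('f, 'r, 'v, 'a) fm \<Rightarrow> ('v \<Rightarrow> 'a) \<Rightarrow> bool" where
  "sat C D (Eq s t) h \<longleftrightarrow> eval C h s = eval C h t"
| "sat C D (Rel R ts) h \<longleftrightarrow> rel_int C R (map (eval C h) ts)"
| "sat C D (Neg \<phi>) h \<longleftrightarrow> \<not> sat C D \<phi> h"
| "sat C D (Conj \<phi> \<psi>) h \<longleftrightarrow> sat C D \<phi> h \<and> sat C D \<psi> h"
| "sat C D (Exists v \<phi>) h \<longleftrightarrow> (\<exists>d\<in>D. sat C D \<phi> (h(v := d)))"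

text \<open>
  \<open>formulas C V A\<close> consists of the \<open>L(A)\<close>-formulas in the variables \<open>(x\<^sub>i)\<close>, \<open>i \<in> V\<close>.  The variable
  \<open>x\<^sub>i\<close> is \<open>Inl i\<close>; the variables \<open>Inr n\<close> are a supply for quantification that never occurs free.
\<close>

definition formulas ::
  "('f, 'r, 'z) language_scheme \<Rightarrow> 'v set \<Rightarrow> 'a set \<Rightarrow> ('f, 'r, 'v + nat, 'a) fm set" where
  "formulas L V A = {\<phi>. wf_fm L \<phi> \<and> fv \<phi> \<subseteq> Inl ` V \<and> params \<phi> \<subseteq> A}"

definition holds_in ::
  "('f, 'r, 'a, 'z) fo_structure_scheme \<Rightarrow> 'a set \<Rightarrow> ('f, 'r, 'v + nat, 'a) fm \<Rightarrow> ('v \<Rightarrow> 'a) \<Rightarrow> bool" where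
  "holds_in C D \<phi> a \<longleftrightarrow> sat C D \<phi> (case_sum a (\<lambda>_. undefined))"

abbreviation holds ::
  "('f, 'r, 'a, 'z) fo_structure_scheme \<Rightarrow> ('f, 'r, 'v + nat, 'a) fm \<Rightarrow> ('v \<Rightarrow> 'a) \<Rightarrow> bool" where
  "holds C \<equiv> holds_in C UNIV"

text \<open>
  Tuples are indexed by arbitrary sets and are extensional functions on the index set;
  \<^term>\<open>compose I f a\<close> is the coordinatewise image of the \<open>I\<close>-tuple \<open>a\<close> under \<open>f\<close>.
\<close>

definition tuples :: "'i set \<Rightarrow> ('i \<Rightarrow> 'a) set" where
  "tuples I = (I \<rightarrow>\<^sub>E UNIV)"

definition tp ::
  "('f, 'r, 'a, 'z) fo_structure_scheme \<Rightarrow> 'i set \<Rightarrow> ('i \<Rightarrow> 'a) \<Rightarrow> 'a set \<Rightarrow> ('f, 'r, 'i + nat, 'a) fm set" where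
  "tp C I a A = {\<phi> \<in> formulas C I A. holds C \<phi> a}"

definition Aut :: "('f, 'r, 'a, 'z) fo_structure_scheme \<Rightarrow> ('a \<Rightarrow> 'a) set" where
  "Aut C = {g. bij g \<and>
     (\<forall>s xs. fun_arity C s = Some (length xs) \<longrightarrow> g (fun_int C s xs) = fun_int C s (map g xs)) \<and>
     (\<forall>R xs. rel_arity C R = Some (length xs) \<longrightarrow> rel_int C R (map g xs) = rel_int C R xs)}"

text \<open>Elementarity is tested on \<open>L(M)\<close>-sentences, so the assignment \<open>h\<close> is irrelevant.\<close>

definition elementary_submodel :: "('f, 'r, 'a, 'z) fo_structure_scheme \<Rightarrow> 'a set \<Rightarrow> bool" where
  "elementary_submodel C M \<longleftrightarrow> M \<noteq> {} \<and>
     (\<forall>s xs. fun_arity C s = Some (length xs) \<and> set xs \<subseteq> M \<longrightarrow> fun_int C s xs \<in> M) \<and>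
     (\<forall>\<phi> \<in> formulas C {} M. \<forall>h :: unit \<Rightarrow> 'a. holds_in C M \<phi> h \<longleftrightarrow> holds C \<phi> h)"


section \<open>Monster models\<close>

definition small :: "('f, 'r, 'a, 'k, 'z) big_structure_scheme \<Rightarrow> 'b set \<Rightarrow> bool" where
  "small C A \<longleftrightarrow> |A| <o degree C"

definition strong_limit_cardinal :: "'k rel \<Rightarrow> bool" where
  "strong_limit_cardinal \<kappa> \<longleftrightarrow> Card_order \<kappa> \<and> natLeq \<le>o \<kappa> \<and>
     (\<forall>A \<subseteq> Field \<kappa>. |A| <o \<kappa> \<longrightarrow> |Pow A| <o \<kappa>)"

definition saturated :: "('f, 'r, 'a, 'k, 'z) big_structure_scheme \<Rightarrow> bool" where
  "saturated C \<longleftrightarrow> (\<forall>A. small C A \<longrightarrow> (\<forall>p \<subseteq> formulas C {()} A.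
     (\<forall>q \<subseteq> p. finite q \<longrightarrow> (\<exists>a. \<forall>\<phi>\<in>q. holds C \<phi> a)) \<longrightarrow> (\<exists>a. \<forall>\<phi>\<in>p. holds C \<phi> a)))"

text \<open>
  In the next definition \<open>A\<close> is enumerated by itself, so equality of the two types says that \<open>g\<close>
  is elementary as a partial map with domain \<open>A\<close>.
\<close>

definition strongly_homogeneous :: "('f, 'r, 'a, 'k, 'z) big_structure_scheme \<Rightarrow> bool" where
  "strongly_homogeneous C \<longleftrightarrow> (\<forall>A (g :: 'a \<Rightarrow> 'a). small C A \<and> tp C A id {} = tp C A g {} \<longrightarrow>
     (\<exists>f \<in> Aut C. \<forall>a\<in>A. f a = g a))"

text \<open>
  Complete theories are deductively closed, hence maximal; consistency comes from the monster
  model, so that \<open>T\<close> is the set of all sentences true in it.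
\<close>

definition complete_theory ::
  "('f, 'r, 'z) language_scheme \<Rightarrow> ('f, 'r, unit + nat, 'a) fm set \<Rightarrow> bool" where
  "complete_theory L T \<longleftrightarrow> T \<subseteq> formulas L {} {} \<and> (\<forall>\<phi> \<in> formulas L {} {}. \<phi> \<in> T \<or> Neg \<phi> \<in> T)"

text \<open>
  The degree \<open>\<kappa>\<close> of saturation and strong homogeneity is an uncountable strong limit cardinal
  larger than the language.  This is the usual largeness convention; without it, sets of types over
  small sets need not be small.  Regularity of \<open>\<kappa>\<close> is not required.
\<close>

definition monster_model ::
  "('f, 'r, 'a, 'k, 'z) big_structure_scheme \<Rightarrow> ('f, 'r, unit + nat, 'a) fm set \<Rightarrow> bool" where
  "monster_model C T \<longleftrightarrow>
     strong_limit_cardinal (degree C) \<and> natLeq <o degree C \<and>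
     small C (dom (fun_arity C)) \<and> small C (dom (rel_arity C)) \<and>
     (\<forall>\<phi>\<in>T. \<forall>h. holds C \<phi> h) \<and>
     saturated C \<and> strongly_homogeneous C"


section \<open>Hyperimaginaries\<close>

text \<open>
  A hyperimaginary is a pair \<open>(I, a\<^sub>E)\<close>, where \<open>I\<close> is the index set of its representatives
  and \<open>a\<^sub>E\<close> is the equivalence class, as a set of tuples.
\<close>

type_synonym ('i, 'a) hyp = "'i set \<times> ('i \<Rightarrow> 'a) set"

definition type_definable_equiv ::
  "('f, 'r, 'a, 'z) fo_structure_scheme \<Rightarrow> 'i set \<Rightarrow> ('i \<Rightarrow> 'a) rel \<Rightarrow> bool" where
  "type_definable_equiv C I E \<longleftrightarrow> equiv (tuples I) E \<and>
     (\<exists>\<Phi> \<subseteq> formulas C (I <+> I) {}.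
        E = {(a, b). a \<in> tuples I \<and> b \<in> tuples I \<and> (\<forall>\<phi>\<in>\<Phi>. holds C \<phi> (case_sum a b))})"

definition hyperimaginary :: "('f, 'r, 'a, 'k, 'z) big_structure_scheme \<Rightarrow> ('i, 'a) hyp \<Rightarrow> bool" where
  "hyperimaginary C e \<longleftrightarrow> small C (fst e) \<and>
     (\<exists>E. type_definable_equiv C (fst e) E \<and> snd e \<in> tuples (fst e) // E)"

definition hyp_image :: "('a \<Rightarrow> 'a) \<Rightarrow> ('i, 'a) hyp \<Rightarrow> ('i, 'a) hyp" where
  "hyp_image f e = (fst e, compose (fst e) f ` snd e)"

definition Aut_over :: "('f, 'r, 'a, 'z) fo_structure_scheme \<Rightarrow> ('i, 'a) hyp \<Rightarrow> ('a \<Rightarrow> 'a) set" where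
  "Aut_over C e = {f \<in> Aut C. hyp_image f e = e}"

definition Aut_group :: "('f, 'r, 'a, 'z) fo_structure_scheme \<Rightarrow> ('i, 'a) hyp \<Rightarrow> ('a \<Rightarrow> 'a) monoid" where
  "Aut_group C e = (BijGroup UNIV) \<lparr>carrier := Aut_over C e\<rparr>"

definition in_dcl :: "('f, 'r, 'a, 'z) fo_structure_scheme \<Rightarrow> ('i, 'a) hyp \<Rightarrow> 'a set \<Rightarrow> bool" where
  "in_dcl C e A \<longleftrightarrow> (\<forall>f \<in> Aut C. (\<forall>a\<in>A. f a = a) \<longrightarrow> hyp_image f e = e)"

definition bounded_over ::
  "('f, 'r, 'a, 'k, 'z) big_structure_scheme \<Rightarrow> ('j, 'a) hyp \<Rightarrow> ('i, 'a) hyp \<Rightarrow> bool" where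
  "bounded_over C e' e \<longleftrightarrow> small C ((\<lambda>f. hyp_image f e') ` Aut_over C e)"

definition Autf_L :: "('f, 'r, 'a, 'k, 'z) big_structure_scheme \<Rightarrow> ('i, 'a) hyp \<Rightarrow> ('a \<Rightarrow> 'a) set" where
  "Autf_L C e = generate (Aut_group C e)
     {f \<in> Aut_over C e. \<exists>M. elementary_submodel C M \<and> small C M \<and> in_dcl C e M \<and> (\<forall>m\<in>M. f m = m)}"

definition lascar_equiv ::
  "('f, 'r, 'a, 'k, 'z) big_structure_scheme \<Rightarrow> ('i, 'a) hyp \<Rightarrow> 'j set \<Rightarrow> ('j \<Rightarrow> 'a) \<Rightarrow> ('j \<Rightarrow> 'a) \<Rightarrow> bool" where
  "lascar_equiv C e J c d \<longleftrightarrow> (\<exists>f \<in> Autf_L C e. compose J f c = d)"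


section \<open>The Galois group relativized to a partial type\<close>

definition partial_type ::
  "('f, 'r, 'a, 'k, 'z) big_structure_scheme \<Rightarrow> 'x set \<Rightarrow> ('f, 'r, 'x + nat, 'a) fm set \<Rightarrow> bool" where
  "partial_type C X \<Sigma> \<longleftrightarrow> small C X \<and> (\<exists>A. small C A \<and> \<Sigma> \<subseteq> formulas C X A) \<and>
     (\<forall>q \<subseteq> \<Sigma>. finite q \<longrightarrow> (\<exists>a. \<forall>\<phi>\<in>q. holds C \<phi> a))"

definition sols ::
  "('f, 'r, 'a, 'z) fo_structure_scheme \<Rightarrow> 'x set \<Rightarrow> ('f, 'r, 'x + nat, 'a) fm set \<Rightarrow> ('x \<Rightarrow> 'a) set" where
  "sols C X \<Sigma> = {a \<in> tuples X. \<forall>\<phi>\<in>\<Sigma>. holds C \<phi> a}"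

definition invariant_type ::
  "('f, 'r, 'a, 'z) fo_structure_scheme \<Rightarrow> ('i, 'a) hyp \<Rightarrow> 'x set \<Rightarrow> ('f, 'r, 'x + nat, 'a) fm set \<Rightarrow> bool" where
  "invariant_type C e X \<Sigma> \<longleftrightarrow> (\<forall>f \<in> Aut_over C e. \<forall>b \<in> tuples X.
     b \<in> sols C X \<Sigma> \<longleftrightarrow> compose X f b \<in> sols C X \<Sigma>)"

text \<open>
  Since \<open>degree C\<close> is an infinite cardinal, its elements \<open>l\<close> represent exactly the small ordinals,
  and \<open>ord_below C l\<close> is the set of ordinals below \<open>l\<close>.  A tuple \<open>(b\<^sub>i)\<close>, \<open>i < l\<close>, of realizations
  of \<open>\<Sigma>\<close> is flattened to one tuple of elements, indexed by \<open>seq_index C l X = ord_below C l \<times> X\<close>;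
  the tuple \<open>b\<^sub>i\<close> is \<open>row X b i\<close>.
\<close>

definition ord_below :: "('f, 'r, 'a, 'k, 'z) big_structure_scheme \<Rightarrow> 'k \<Rightarrow> 'k set" where
  "ord_below C l = underS (degree C) l"

definition seq_index :: "('f, 'r, 'a, 'k, 'z) big_structure_scheme \<Rightarrow> 'k \<Rightarrow> 'x set \<Rightarrow> ('k \<times> 'x) set" where
  "seq_index C l X = ord_below C l \<times> X"

definition row :: "'x set \<Rightarrow> ('k \<times> 'x \<Rightarrow> 'a) \<Rightarrow> 'k \<Rightarrow> 'x \<Rightarrow> 'a" where
  "row X b i = (\<lambda>x\<in>X. b (i, x))"

definition realization_tuple ::
  "('f, 'r, 'a, 'k, 'z) big_structure_scheme \<Rightarrow> 'x set \<Rightarrow> ('f, 'r, 'x + nat, 'a) fm set \<Rightarrow>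
   'k \<Rightarrow> ('k \<times> 'x \<Rightarrow> 'a) \<Rightarrow> bool" where
  "realization_tuple C X \<Sigma> l b \<longleftrightarrow> l \<in> Field (degree C) \<and> b \<in> tuples (seq_index C l X) \<and>
     (\<forall>i \<in> ord_below C l. row X b i \<in> sols C X \<Sigma>)"

text \<open>The tuple \<open>\<sigma>(b) = (\<sigma>(b\<^sub>i))\<close>, \<open>i < l\<close>, for a permutation \<open>\<sigma>\<close> of the realizations.\<close>

definition map_rows ::
  "('f, 'r, 'a, 'k, 'z) big_structure_scheme \<Rightarrow> 'x set \<Rightarrow> 'k \<Rightarrow> (('x \<Rightarrow> 'a) \<Rightarrow> 'x \<Rightarrow> 'a) \<Rightarrow>
   ('k \<times> 'x \<Rightarrow> 'a) \<Rightarrow> 'k \<times> 'x \<Rightarrow> 'a" where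
  "map_rows C X l \<sigma> b = (\<lambda>(i, x) \<in> seq_index C l X. \<sigma> (row X b i) x)"

definition restrict_aut ::
  "('f, 'r, 'a, 'z) fo_structure_scheme \<Rightarrow> 'x set \<Rightarrow> ('f, 'r, 'x + nat, 'a) fm set \<Rightarrow>
   ('a \<Rightarrow> 'a) \<Rightarrow> ('x \<Rightarrow> 'a) \<Rightarrow> 'x \<Rightarrow> 'a" where
  "restrict_aut C X \<Sigma> f = restrict (compose X f) (sols C X \<Sigma>)"

definition Aut_type ::
  "('f, 'r, 'a, 'z) fo_structure_scheme \<Rightarrow> ('i, 'a) hyp \<Rightarrow> 'x set \<Rightarrow> ('f, 'r, 'x + nat, 'a) fm set \<Rightarrow>
   (('x \<Rightarrow> 'a) \<Rightarrow> 'x \<Rightarrow> 'a) set" where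
  "Aut_type C e X \<Sigma> = restrict_aut C X \<Sigma> ` Aut_over C e"

definition Aut_type_group ::
  "('f, 'r, 'a, 'z) fo_structure_scheme \<Rightarrow> ('i, 'a) hyp \<Rightarrow> 'x set \<Rightarrow> ('f, 'r, 'x + nat, 'a) fm set \<Rightarrow>
   (('x \<Rightarrow> 'a) \<Rightarrow> 'x \<Rightarrow> 'a) monoid" where
  "Aut_type_group C e X \<Sigma> = (BijGroup (sols C X \<Sigma>)) \<lparr>carrier := Aut_type C e X \<Sigma>\<rparr>"

definition Autf_L_type ::
  "('f, 'r, 'a, 'k, 'z) big_structure_scheme \<Rightarrow> ('i, 'a) hyp \<Rightarrow> 'x set \<Rightarrow> ('f, 'r, 'x + nat, 'a) fm set \<Rightarrow>
   (('x \<Rightarrow> 'a) \<Rightarrow> 'x \<Rightarrow> 'a) set" where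
  "Autf_L_type C e X \<Sigma> = {\<sigma> \<in> Aut_type C e X \<Sigma>. \<forall>l b. realization_tuple C X \<Sigma> l b \<longrightarrow>
     lascar_equiv C e (seq_index C l X) b (map_rows C X l \<sigma> b)}"

definition Gal_L ::
  "('f, 'r, 'a, 'k, 'z) big_structure_scheme \<Rightarrow> ('i, 'a) hyp \<Rightarrow> 'x set \<Rightarrow> ('f, 'r, 'x + nat, 'a) fm set \<Rightarrow>
   (('x \<Rightarrow> 'a) \<Rightarrow> 'x \<Rightarrow> 'a) set monoid" where
  "Gal_L C e X \<Sigma> = Aut_type_group C e X \<Sigma> Mod Autf_L_type C e X \<Sigma>"

definition Gal_class ::
  "('f, 'r, 'a, 'k, 'z) big_structure_scheme \<Rightarrow> ('i, 'a) hyp \<Rightarrow> 'x set \<Rightarrow> ('f, 'r, 'x + nat, 'a) fm set \<Rightarrow>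
   (('x \<Rightarrow> 'a) \<Rightarrow> 'x \<Rightarrow> 'a) \<Rightarrow> (('x \<Rightarrow> 'a) \<Rightarrow> 'x \<Rightarrow> 'a) set" where
  "Gal_class C e X \<Sigma> \<sigma> = Autf_L_type C e X \<Sigma> #>\<^bsub>Aut_type_group C e X \<Sigma>\<^esub> \<sigma>"

definition Gal_proj ::
  "('f, 'r, 'a, 'k, 'z) big_structure_scheme \<Rightarrow> ('i, 'a) hyp \<Rightarrow> 'x set \<Rightarrow> ('f, 'r, 'x + nat, 'a) fm set \<Rightarrow>
   ('a \<Rightarrow> 'a) \<Rightarrow> (('x \<Rightarrow> 'a) \<Rightarrow> 'x \<Rightarrow> 'a) set" where
  "Gal_proj C e X \<Sigma> f = Gal_class C e X \<Sigma> (restrict_aut C X \<Sigma> f)"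


section \<open>The topology of the Galois group\<close>

definition lascar_tuple ::
  "('f, 'r, 'a, 'k, 'z) big_structure_scheme \<Rightarrow> ('i, 'a) hyp \<Rightarrow> 'x set \<Rightarrow> ('f, 'r, 'x + nat, 'a) fm set \<Rightarrow>
   'k \<Rightarrow> ('k \<times> 'x \<Rightarrow> 'a) \<Rightarrow> bool" where
  "lascar_tuple C e X \<Sigma> l b \<longleftrightarrow> realization_tuple C X \<Sigma> l b \<and>
     Autf_L_type C e X \<Sigma> = {\<sigma> \<in> Aut_type C e X \<Sigma>.
       lascar_equiv C e (seq_index C l X) b (map_rows C X l \<sigma> b)}"

text \<open>The type \<open>tp(\<sigma>(b)/b)\<close>.\<close>

definition tp_image ::
  "('f, 'r, 'a, 'k, 'z) big_structure_scheme \<Rightarrow> 'x set \<Rightarrow> 'k \<Rightarrow> ('k \<times> 'x \<Rightarrow> 'a) \<Rightarrow>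
   (('x \<Rightarrow> 'a) \<Rightarrow> 'x \<Rightarrow> 'a) \<Rightarrow> ('f, 'r, ('k \<times> 'x) + nat, 'a) fm set" where
  "tp_image C X l b \<sigma> = tp C (seq_index C l X) (map_rows C X l \<sigma> b) (b ` seq_index C l X)"

text \<open>A set \<open>S\<close> of complete types, with the topology whose basic open sets are the \<open>[\<phi>] \<inter> S\<close>.\<close>

definition logic_topology :: "('f, 'r, 'v, 'a) fm set set \<Rightarrow> ('f, 'r, 'v, 'a) fm set topology" where
  "logic_topology S = topology_generated_by (range (\<lambda>\<phi>. {p \<in> S. \<phi> \<in> p}))"

definition type_space ::
  "('f, 'r, 'a, 'k, 'z) big_structure_scheme \<Rightarrow> ('i, 'a) hyp \<Rightarrow> 'x set \<Rightarrow> ('f, 'r, 'x + nat, 'a) fm set \<Rightarrow>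
   'k \<Rightarrow> ('k \<times> 'x \<Rightarrow> 'a) \<Rightarrow> ('f, 'r, ('k \<times> 'x) + nat, 'a) fm set topology" where
  "type_space C e X \<Sigma> l b = logic_topology (tp_image C X l b ` Aut_type C e X \<Sigma>)"

text \<open>
  The map \<open>\<nu>\<^sub>b\<close> sending \<open>tp(\<sigma>(b)/b)\<close> to the class of \<open>\<sigma>\<close>; the class is uniquely determined when
  \<open>b\<close> is a Lascar tuple and \<open>e \<in> dcl(b)\<close>.
\<close>

definition type_to_Gal ::
  "('f, 'r, 'a, 'k, 'z) big_structure_scheme \<Rightarrow> ('i, 'a) hyp \<Rightarrow> 'x set \<Rightarrow> ('f, 'r, 'x + nat, 'a) fm set \<Rightarrow>
   'k \<Rightarrow> ('k \<times> 'x \<Rightarrow> 'a) \<Rightarrow> ('f, 'r, ('k \<times> 'x) + nat, 'a) fm set \<Rightarrow> (('x \<Rightarrow> 'a) \<Rightarrow> 'x \<Rightarrow> 'a) set" where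
  "type_to_Gal C e X \<Sigma> l b p =
     (THE g. \<exists>\<sigma> \<in> Aut_type C e X \<Sigma>. p = tp_image C X l b \<sigma> \<and> g = Gal_class C e X \<Sigma> \<sigma>)"

definition quotient_topology :: "'p topology \<Rightarrow> ('p \<Rightarrow> 'q) \<Rightarrow> 'q set \<Rightarrow> 'q topology" where
  "quotient_topology P f Q = topology (\<lambda>U. U \<subseteq> Q \<and> openin P {p \<in> topspace P. f p \<in> U})"

lemma openin_quotient_topology:
  "openin (quotient_topology P f Q) U \<longleftrightarrow> U \<subseteq> Q \<and> openin P {p \<in> topspace P. f p \<in> U}"
proof -
  have "openin P {p \<in> topspace P. f p \<in> U \<inter> V}"
    if "openin P {p \<in> topspace P. f p \<in> U}" "openin P {p \<in> topspace P. f p \<in> V}" for U V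
  proof -
    have "{p \<in> topspace P. f p \<in> U \<inter> V} = {p \<in> topspace P. f p \<in> U} \<inter> {p \<in> topspace P. f p \<in> V}"
      by auto
    then show ?thesis using that by (simp only: openin_Int)
  qed
  moreover have "openin P {p \<in> topspace P. f p \<in> \<Union>\<U>}"
    if "\<forall>U\<in>\<U>. openin P {p \<in> topspace P. f p \<in> U}" for \<U>
  proof -
    have "{p \<in> topspace P. f p \<in> \<Union>\<U>} = (\<Union>U\<in>\<U>. {p \<in> topspace P. f p \<in> U})"
      by auto
    then show ?thesis using that by (simp only: openin_Union image_iff) blast
  qed
  ultimately have "istopology (\<lambda>U. U \<subseteq> Q \<and> openin P {p \<in> topspace P. f p \<in> U})"
    unfolding istopology_def by (intro conjI allI impI) blast+
  then show ?thesis
    by (simp add: quotient_topology_def topology_inverse')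
qed

text \<open>
  The quotient topology under \<open>\<nu>\<^sub>b\<close>, for a Lascar tuple \<open>b\<close> with \<open>e \<in> dcl(b)\<close>.  It does not
  depend on \<open>b\<close>, and such a \<open>b\<close> exists as soon as \<open>e \<in> dcl(c)\<close> for some small tuple \<open>c\<close> of
  realizations of \<open>\<Sigma>\<close>.
\<close>

definition Gal_topology ::
  "('f, 'r, 'a, 'k, 'z) big_structure_scheme \<Rightarrow> ('i, 'a) hyp \<Rightarrow> 'x set \<Rightarrow> ('f, 'r, 'x + nat, 'a) fm set \<Rightarrow>
   (('x \<Rightarrow> 'a) \<Rightarrow> 'x \<Rightarrow> 'a) set topology" where
  "Gal_topology C e X \<Sigma> =
     (let (l, b) = (SOME (l, b). lascar_tuple C e X \<Sigma> l b \<and> in_dcl C e (b ` seq_index C l X))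
      in quotient_topology (type_space C e X \<Sigma> l b) (type_to_Gal C e X \<Sigma> l b)
           (carrier (Gal_L C e X \<Sigma>)))"

end

theory Submission
  imports Defs "HOL-Algebra.Free_Abelian_Groups"
begin

text \<open>
  Write \<open>G\<close> for \<open>Aut\<^sub>e(C)\<close> and \<open>Ker\<close> for the kernel of \<open>\<pi>\<^sub>\<Sigma>\<close>, that is, for the set of all
  \<open>f \<in> G\<close> that agree with a Lascar strong automorphism on every small set of elements of
  realizations.  That \<open>H\<close> is the preimage of its image says that \<open>Ker \<subseteq> H\<close>
  (\<open>saturated_subgroup_iff\<close>).  Fix a Lascar tuple \<open>b\<close> with \<open>e \<in> dcl(b)\<close>.  An automorphism fixing \<open>b\<close>
  lies in \<open>Ker\<close>, so \<open>tp(f(b)/b)\<close> determines \<open>f \<in> G\<close> modulo \<open>Ker\<close>.  If \<open>Ker \<subseteq> H\<close>, the image of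
  \<open>H\<close> is therefore closed iff every \<open>f \<in> G\<close> such that each formula of \<open>tp(f(b)/b)\<close> is satisfied by
  some \<open>h(b)\<close>, \<open>h \<in> H\<close>, is itself in \<open>H\<close> (\<open>closedin_Gal_iff\<close>).

  Both directions use that stabilizers of hyperimaginaries are closed in this sense, which is a
  compactness argument (\<open>closed_orbit\<close>).

  Let \<open>H\<close> be the stabilizer of a bounded \<open>e'\<close> in \<open>G\<close>.  Lascar strong automorphisms
  fix every hyperimaginary that is bounded over \<open>e\<close> (\<open>bounded_fixed\<close>).  An element of \<open>Ker\<close> agrees
  with one of them on a representative of \<open>e'\<close> made of realizations, so \<open>Ker \<subseteq> H\<close>, and \<open>H\<close> is
  closed by compactness.

  Conversely, let \<open>H\<close> be closed in this sense and contain \<open>Ker\<close>.  Let \<open>E\<close> relate \<open>g(b)\<close> to \<open>g(f(b))\<close> for every automorphism \<open>g\<close> and every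
  \<open>f \<in> H\<close>, and every other tuple to itself only.  Because \<open>H\<close> is closed and
  \<open>{tp(f(b)/b) | f \<in> G}\<close> is closed by compactness for \<open>e\<close>, the relation \<open>E\<close> is defined by
  the formulas true of it.  The stabilizer of \<open>b\<^sub>E\<close> in \<open>G\<close> is \<open>H\<close>, since \<open>Ker \<subseteq> H\<close>
  (\<open>closed_subgroup_is_stabilizer\<close>); and \<open>b\<^sub>E\<close> is bounded over \<open>e\<close> because it is fixed by the Lascar
  strong automorphisms, whose cosets are determined by types over a small model
  (\<open>bounded_if_Autf_fixed\<close>).

  The topology is defined from a chosen Lascar tuple, so such a tuple has to be found first
  (\<open>small_test_set\<close>, \<open>good_tuple_exists\<close>).  Below, "few" means "a small set of".
\<close>

section \<open>Syntax and semantics\<close>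

lemma eval_cong: "(\<And>v. v \<in> tm_vars t \<Longrightarrow> h v = h' v) \<Longrightarrow> eval C h t = eval C h' t"
proof (induction t)
  case (App s ts)
  then have "map (eval C h) ts = map (eval C h') ts" by auto
  then show ?case by (simp only: eval.simps)
qed auto

lemma sat_cong: "(\<And>v. v \<in> fv \<phi> \<Longrightarrow> h v = h' v) \<Longrightarrow> sat C D \<phi> h = sat C D \<phi> h'"
proof (induction \<phi> arbitrary: h h')
  case (Eq s t)
  then show ?case using eval_cong[of s h h' C] eval_cong[of t h h' C] by simp
next
  case (Rel R ts)
  then have "map (eval C h) ts = map (eval C h') ts" by (auto intro!: eval_cong)
  then show ?case by (simp only: sat.simps)
next
  case (Exists v \<phi>)
  have "sat C D \<phi> (h(v := d)) = sat C D \<phi> (h'(v := d))" for d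
    by (rule Exists.IH) (use Exists.prems in auto)
  then show ?case by simp
next
  case (Neg \<phi>)
  have "sat C D \<phi> h = sat C D \<phi> h'" by (rule Neg.IH) (use Neg.prems in auto)
  then show ?case by simp
next
  case (Conj \<phi> \<psi>)
  have "sat C D \<phi> h = sat C D \<phi> h'" "sat C D \<psi> h = sat C D \<psi> h'"
    by (rule Conj.IH; use Conj.prems in auto)+
  then show ?case unfolding sat.simps by blast
qed

lemma tm_vars_eq: "tm_vars t = set2_tm t"
  by (induction t) auto

lemma fv_subset_vars: "fv \<phi> \<subseteq> set3_fm \<phi>"
  by (induction \<phi>) (auto simp: tm_vars_eq)

lemma finite_tm_params: "finite (tm_params t)" and finite_tm_vars: "finite (set2_tm t)"
  by (induction t) auto

lemma finite_params: "finite (params \<phi>)" and finite_vars: "finite (set3_fm \<phi>)"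
  by (induction \<phi>) (auto simp: finite_tm_params finite_tm_vars)

lemma finite_fv: "finite (fv \<phi>)"
  using finite_vars fv_subset_vars by (rule finite_subset[rotated])

lemma eval_map_var: "eval C h (map_tm (\<lambda>x. x) \<rho> (\<lambda>x. x) t) = eval C (\<lambda>w. h (\<rho> w)) t"
  by (induction t) (auto intro!: arg_cong[of _ _ "fun_int C _"])

lemma wf_tm_map: "wf_tm L (map_tm (\<lambda>x. x) \<rho> f t) = wf_tm L t"
  by (induction t) auto

lemma wf_fm_map: "wf_fm L (map_fm (\<lambda>x. x) (\<lambda>x. x) \<rho> f \<phi>) = wf_fm L \<phi>"
  by (induction \<phi>) (auto simp: wf_tm_map)

lemma fv_map_var: "inj_on \<rho> (set3_fm \<phi>) \<Longrightarrow> fv (map_fm (\<lambda>x. x) (\<lambda>x. x) \<rho> f \<phi>) = \<rho> ` fv \<phi>"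
proof (induction \<phi>)
  case (Exists v \<phi>)
  then have "inj_on \<rho> (insert v (fv \<phi>))"
    by (auto intro: inj_on_subset simp: fv_subset_vars[THEN subsetD])
  moreover have "fv (map_fm (\<lambda>x. x) (\<lambda>x. x) \<rho> f \<phi>) = \<rho> ` fv \<phi>"
    by (rule Exists.IH) (use Exists.prems in auto)
  ultimately show ?case by (auto simp: inj_on_def)
next
  case (Conj \<phi> \<psi>)
  then show ?case by (auto simp: inj_on_Un image_Un)
qed (auto simp: tm_vars_eq tm.set_map image_Un)

text \<open>
  Injectivity on the bound variables is needed as well, as they must not be identified with free
  ones.
\<close>

lemma sat_map_var:
  "inj_on \<rho> (set3_fm \<phi>) \<Longrightarrow> sat C D (map_fm (\<lambda>x. x) (\<lambda>x. x) \<rho> (\<lambda>x. x) \<phi>) h = sat C D \<phi> (\<lambda>w. h (\<rho> w))"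
proof (induction \<phi> arbitrary: h)
  case (Exists v \<phi>)
  have inj: "inj_on \<rho> (insert v (set3_fm \<phi>))" using Exists.prems by (simp add: insert_commute)
  have "sat C D (map_fm (\<lambda>x. x) (\<lambda>x. x) \<rho> (\<lambda>x. x) \<phi>) (h(\<rho> v := d)) = sat C D \<phi> ((\<lambda>w. h (\<rho> w))(v := d))" for d
  proof -
    have "sat C D (map_fm (\<lambda>x. x) (\<lambda>x. x) \<rho> (\<lambda>x. x) \<phi>) (h(\<rho> v := d)) = sat C D \<phi> (\<lambda>w. (h(\<rho> v := d)) (\<rho> w))"
      by (rule Exists.IH) (use inj in auto)
    also have "\<dots> = sat C D \<phi> ((\<lambda>w. h (\<rho> w))(v := d))"
      by (rule sat_cong) (use inj fv_subset_vars[of \<phi>] in \<open>auto simp: inj_on_def\<close>)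
    finally show ?thesis .
  qed
  then show ?case by simp
next
  case (Conj \<phi> \<psi>)
  then show ?case by (auto simp: inj_on_Un)
qed (auto simp: eval_map_var comp_def)

lemma Aut_bij: "f \<in> Aut C \<Longrightarrow> bij f"
  by (simp add: Aut_def)

lemma eval_aut:
  assumes "f \<in> Aut C" shows "wf_tm C t \<Longrightarrow> eval C (\<lambda>v. f (h v)) (map_tm (\<lambda>x. x) (\<lambda>x. x) f t) = f (eval C h t)"
proof (induction t)
  case (App s ts)
  then have "map (eval C (\<lambda>v. f (h v))) (map (map_tm (\<lambda>x. x) (\<lambda>x. x) f) ts) = map f (map (eval C h) ts)"
    by auto
  moreover have "f (fun_int C s (map (eval C h) ts)) = fun_int C s (map f (map (eval C h) ts))"
    using assms App.prems unfolding Aut_def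
    by (metis (mono_tags, lifting) length_map mem_Collect_eq wf_tm.simps(3))
  ultimately show ?case
    by (metis eval.simps(3) tm.map(3))
qed auto

lemma sat_aut:
  assumes f: "f \<in> Aut C"
  shows "wf_fm C \<phi> \<Longrightarrow> sat C (f ` D) (map_fm (\<lambda>x. x) (\<lambda>x. x) (\<lambda>x. x) f \<phi>) (\<lambda>v. f (h v)) = sat C D \<phi> h"
proof (induction \<phi> arbitrary: h)
  case (Eq s t)
  then show ?case using eval_aut[OF f, of s h] eval_aut[OF f, of t h] Aut_bij[OF f] by (simp add: bij_def inj_eq)
next
  case (Rel R ts)
  then have "map (eval C (\<lambda>v. f (h v))) (map (map_tm (\<lambda>x. x) (\<lambda>x. x) f) ts) = map f (map (eval C h) ts)"
    using eval_aut[OF f, of _ h] by auto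
  moreover have "rel_int C R (map f (map (eval C h) ts)) = rel_int C R (map (eval C h) ts)"
    using f Rel.prems unfolding Aut_def
    by (metis (mono_tags, lifting) length_map mem_Collect_eq wf_fm.simps(2))
  ultimately show ?case
    by (metis sat.simps(2) fm.map(2))
next
  case (Exists v \<phi>)
  have "(\<lambda>v. f (h v))(v := f d) = (\<lambda>w. f ((h(v := d)) w))" for d by auto
  then show ?case using Exists by (auto simp del: fun_upd_apply)
qed auto


section \<open>Definable predicates\<close>

text \<open>
  Below, predicates on assignments take the place of formulas, so that renaming variables and
  substituting parameters, also between different index types, is composition of functions.
\<close>

definition definable ::
  "('f, 'r, 'a, 'z) fo_structure_scheme \<Rightarrow> 'v set \<Rightarrow> 'a set \<Rightarrow> (('v \<Rightarrow> 'a) \<Rightarrow> bool) \<Rightarrow> bool" where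
  "definable C V A P \<longleftrightarrow> (\<exists>\<phi> \<in> formulas C V A. \<forall>h. holds C \<phi> h \<longleftrightarrow> P h)"

lemma definable_holds: "\<phi> \<in> formulas C V A \<Longrightarrow> definable C V A (holds C \<phi>)"
  by (auto simp: definable_def)

lemma definableE:
  assumes "definable C V A P"
  obtains \<phi> where "\<phi> \<in> formulas C V A" "P = holds C \<phi>"
  using assms by (auto simp: definable_def fun_eq_iff)

text \<open>
  The variables of \<open>\<phi>\<close>, bound ones included, are first moved to the supply \<open>Inr n\<close>, where nothing
  can be captured; each free one is then bound by \<open>\<exists>y. y = t \<and> \<dots>\<close>, with \<open>t\<close> the term to be
  substituted.
\<close>

lemma sat_subst:
  fixes \<phi> :: "('f, 'r, 'v, 'a) fm" and s :: "'v \<Rightarrow> 'w + 'a"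
  assumes wf: "wf_fm C \<phi>" and par: "params \<phi> \<subseteq> A" and s: "s ` fv \<phi> \<subseteq> W <+> A"
  shows "definable C W A (\<lambda>h. sat C UNIV \<phi> (\<lambda>v. case_sum h id (s v)))"
proof -
  obtain \<tau> :: "'v \<Rightarrow> nat" where \<tau>: "inj_on \<tau> (set3_fm \<phi>)"
    using finite_imp_inj_to_nat_seg[OF finite_vars[of \<phi>]] by auto
  define \<rho> where "\<rho> v = (Inr (\<tau> v) :: 'w + nat)" for v
  have \<rho>: "inj_on \<rho> (set3_fm \<phi>)" using \<tau> by (auto simp: \<rho>_def inj_on_def)
  have \<rho>eq: "\<rho> v = \<rho> w \<longleftrightarrow> v = w" if "v \<in> fv \<phi>" "w \<in> fv \<phi>" for v w
    using \<rho> that fv_subset_vars[of \<phi>] by (auto simp: inj_on_def)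
  have "\<exists>\<psi>. wf_fm C \<psi> \<and> fv \<psi> \<subseteq> \<rho> ` (fv \<phi> - F) \<union> Inl ` W \<and> params \<psi> \<subseteq> A \<and>
      (\<forall>g. sat C UNIV \<psi> g \<longleftrightarrow> sat C UNIV \<phi> (\<lambda>v. if v \<in> F then case_sum (\<lambda>w. g (Inl w)) id (s v) else g (\<rho> v)))"
    if "finite F" "F \<subseteq> fv \<phi>" for F
    using that
  proof (induction F)
    case empty
    let ?\<psi> = "map_fm (\<lambda>x. x) (\<lambda>x. x) \<rho> (\<lambda>x. x) \<phi>"
    have "wf_fm C ?\<psi>" "fv ?\<psi> \<subseteq> \<rho> ` fv \<phi>" "params ?\<psi> \<subseteq> A"
      using wf par by (auto simp: wf_fm_map fv_map_var[OF \<rho>] fm.set_map)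
    moreover have "\<forall>g. sat C UNIV ?\<psi> g = sat C UNIV \<phi> (\<lambda>v. g (\<rho> v))"
      by (simp add: sat_map_var[OF \<rho>] comp_def)
    ultimately show ?case by (intro exI[of _ ?\<psi>]) auto
  next
    case (insert v F)
    then obtain \<psi> where \<psi>: "wf_fm C \<psi>" "fv \<psi> \<subseteq> \<rho> ` (fv \<phi> - F) \<union> Inl ` W" "params \<psi> \<subseteq> A"
      "\<And>g. sat C UNIV \<psi> g \<longleftrightarrow> sat C UNIV \<phi> (\<lambda>v. if v \<in> F then case_sum (\<lambda>w. g (Inl w)) id (s v) else g (\<rho> v))"
      by auto
    let ?t = "case_sum (\<lambda>w. Var (Inl w)) Par (s v)"
    let ?\<psi> = "Exists (\<rho> v) (Conj (Eq (Var (\<rho> v)) ?t) \<psi>)"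
    have sv: "s v \<in> W <+> A" using s insert.prems by auto
    have "wf_fm C ?\<psi>" using \<psi>(1) by (auto split: sum.split)
    moreover have "fv ?\<psi> \<subseteq> \<rho> ` (fv \<phi> - insert v F) \<union> Inl ` W"
      using \<psi>(2) sv by (auto split: sum.splits)
    moreover have "params ?\<psi> \<subseteq> A" using \<psi>(3) sv by (auto split: sum.splits)
    moreover have "sat C UNIV ?\<psi> g \<longleftrightarrow>
        sat C UNIV \<phi> (\<lambda>w. if w \<in> insert v F then case_sum (\<lambda>w. g (Inl w)) id (s w) else g (\<rho> w))" for g
    proof -
      have Inl: "(\<lambda>w. (g(\<rho> v := d)) (Inl w)) = (\<lambda>w. g (Inl w))" for d by (auto simp: \<rho>_def)
      have "eval C (g(\<rho> v := d)) ?t = case_sum (\<lambda>w. g (Inl w)) id (s v)" for d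
        by (auto simp: \<rho>_def split: sum.split)
      then have "sat C UNIV ?\<psi> g \<longleftrightarrow> sat C UNIV \<psi> (g(\<rho> v := case_sum (\<lambda>w. g (Inl w)) id (s v)))"
        by simp
      also have "\<dots> \<longleftrightarrow> sat C UNIV \<phi> (\<lambda>w. if w \<in> F then case_sum (\<lambda>w. g (Inl w)) id (s w)
          else (g(\<rho> v := case_sum (\<lambda>w. g (Inl w)) id (s v))) (\<rho> w))"
        unfolding \<psi>(4) Inl ..
      also have "\<dots> \<longleftrightarrow> sat C UNIV \<phi> (\<lambda>w. if w \<in> insert v F then case_sum (\<lambda>w. g (Inl w)) id (s w) else g (\<rho> w))"
        by (rule sat_cong) (use \<rho>eq insert.prems insert.hyps in auto)
      finally show ?thesis .
    qed
    ultimately show ?case by blast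
  qed
  from this[of "fv \<phi>"] obtain \<psi> where \<psi>: "wf_fm C \<psi>" "fv \<psi> \<subseteq> Inl ` W" "params \<psi> \<subseteq> A"
    "\<And>g. sat C UNIV \<psi> g \<longleftrightarrow> sat C UNIV \<phi> (\<lambda>v. if v \<in> fv \<phi> then case_sum (\<lambda>w. g (Inl w)) id (s v) else g (\<rho> v))"
    by (auto simp: finite_fv)
  have "holds C \<psi> h \<longleftrightarrow> sat C UNIV \<phi> (\<lambda>v. case_sum h id (s v))" for h
    unfolding holds_in_def \<psi>(4) by (rule sat_cong) (auto split: sum.splits)
  moreover have "\<psi> \<in> formulas C W A" using \<psi> by (simp add: formulas_def)
  ultimately show ?thesis unfolding definable_def by blast
qed

lemma definable_subst:
  assumes P: "definable C V A P" and s: "s ` V \<subseteq> W <+> B" and AB: "A \<subseteq> B"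
  shows "definable C W B (\<lambda>h. P (\<lambda>v. case_sum h id (s v)))"
proof -
  from P obtain \<phi> where \<phi>: "\<phi> \<in> formulas C V A" "P = holds C \<phi>" by (rule definableE)
  let ?s = "case_sum s (\<lambda>_. Inr undefined)"
  have "definable C W B (\<lambda>h. sat C UNIV \<phi> (\<lambda>v. case_sum h id (?s v)))"
    by (rule sat_subst) (use \<phi> s AB in \<open>fastforce simp: formulas_def split: sum.splits\<close>)+
  moreover have "sat C UNIV \<phi> (\<lambda>v. case_sum h id (?s v)) = P (\<lambda>v. case_sum h id (s v))" for h
    unfolding \<phi>(2) holds_in_def by (rule sat_cong) (use \<phi>(1) in \<open>auto simp: formulas_def\<close>)
  ultimately show ?thesis by simp
qed

lemma definable_rename:
  assumes "definable C V A P" and "\<rho> ` V \<subseteq> W"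
  shows "definable C W A (\<lambda>h. P (\<lambda>v. h (\<rho> v)))"
  using definable_subst[OF assms(1), of "\<lambda>v. Inl (\<rho> v)" W A] assms(2) by auto

lemma definable_mono: "definable C V A P \<Longrightarrow> V \<subseteq> V' \<Longrightarrow> A \<subseteq> A' \<Longrightarrow> definable C V' A' P"
  unfolding definable_def formulas_def by blast

lemma definable_cong: "definable C V A P \<Longrightarrow> (\<And>v. v \<in> V \<Longrightarrow> h v = h' v) \<Longrightarrow> P h = P h'"
  by (erule definableE) (auto simp: holds_in_def formulas_def intro!: sat_cong)

lemma definable_finite_support:
  assumes "definable C V A P"
  obtains V0 A0 where "finite V0" "V0 \<subseteq> V" "finite A0" "A0 \<subseteq> A" "definable C V0 A0 P"
proof -
  from assms obtain \<phi> where \<phi>: "\<phi> \<in> formulas C V A" "P = holds C \<phi>" by (rule definableE)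
  have "finite (Inl -` fv \<phi>)" by (intro finite_vimageI finite_fv) simp
  moreover have "Inl -` fv \<phi> \<subseteq> V" "params \<phi> \<subseteq> A" "\<phi> \<in> formulas C (Inl -` fv \<phi>) (params \<phi>)"
    using \<phi> by (auto simp: formulas_def)
  ultimately show ?thesis
    using that[of "Inl -` fv \<phi>" "params \<phi>"] finite_params[of \<phi>] \<phi>(2) definable_holds by blast
qed

lemma definable_Not: "definable C V A P \<Longrightarrow> definable C V A (\<lambda>h. \<not> P h)"
proof (erule definableE)
  fix \<phi> assume "\<phi> \<in> formulas C V A" "P = holds C \<phi>"
  then show ?thesis
    by (intro definable_def[THEN iffD2] bexI[of _ "Neg \<phi>"]) (auto simp: holds_in_def formulas_def)
qed

lemma definable_conj:
  "definable C V A P \<Longrightarrow> definable C V A Q \<Longrightarrow> definable C V A (\<lambda>h. P h \<and> Q h)"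
proof (elim definableE)
  fix \<phi> \<psi> assume "\<phi> \<in> formulas C V A" "P = holds C \<phi>" "\<psi> \<in> formulas C V A" "Q = holds C \<psi>"
  then show ?thesis
    by (intro definable_def[THEN iffD2] bexI[of _ "Conj \<phi> \<psi>"]) (auto simp: holds_in_def formulas_def)
qed

lemma definable_imp:
  "definable C V A P \<Longrightarrow> definable C V A Q \<Longrightarrow> definable C V A (\<lambda>h. P h \<longrightarrow> Q h)"
  using definable_Not[OF definable_conj[OF _ definable_Not[of _ _ _ Q]]] by simp

lemma definable_True: "definable C V A (\<lambda>h. True)"
  by (intro definable_def[THEN iffD2]
      bexI[of _ "Exists (Inr 0) (Eq (Var (Inr 0)) (Var (Inr 0)))"]) (auto simp: holds_in_def formulas_def)

lemma definable_ball:
  "finite I \<Longrightarrow> (\<And>i. i \<in> I \<Longrightarrow> definable C V A (P i)) \<Longrightarrow> definable C V A (\<lambda>h. \<forall>i\<in>I. P i h)"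
  by (induction I rule: finite_induct) (auto intro: definable_True definable_conj)

lemma definable_eq: "v \<in> V \<Longrightarrow> w \<in> V \<Longrightarrow> definable C V A (\<lambda>h. h v = h w)"
  by (intro definable_def[THEN iffD2] bexI[of _ "Eq (Var (Inl v)) (Var (Inl w))"])
    (auto simp: holds_in_def formulas_def)

lemma definable_eq_par: "v \<in> V \<Longrightarrow> a \<in> A \<Longrightarrow> definable C V A (\<lambda>h. h v = a)"
  by (intro definable_def[THEN iffD2] bexI[of _ "Eq (Var (Inl v)) (Par a)"])
    (auto simp: holds_in_def formulas_def)

lemma case_sum_upd_Inl: "(case_sum h k)(Inl v := d) = case_sum (h(v := d)) k"
  by (auto split: sum.splits)

lemma definable_ex1:
  assumes "definable C (insert v V) A P"
  shows "definable C V A (\<lambda>h. \<exists>d. P (h(v := d)))"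
proof -
  from assms obtain \<phi> where \<phi>: "\<phi> \<in> formulas C (insert v V) A" "P = holds C \<phi>" by (rule definableE)
  from \<phi> show ?thesis
    by (intro definable_def[THEN iffD2] bexI[of _ "Exists (Inl v) \<phi>"])
      (auto simp: holds_in_def formulas_def case_sum_upd_Inl)
qed

lemma definable_ex:
  assumes "finite F" "definable C (V \<union> F) A P"
  shows "definable C V A (\<lambda>h. \<exists>h'. (\<forall>v\<in>V. h' v = h v) \<and> P h')"
  using assms
proof (induction F arbitrary: P)
  case empty
  have "(\<exists>h'. (\<forall>v\<in>V. h' v = h v) \<and> P h') = P h" for h
  proof
    assume "\<exists>h'. (\<forall>v\<in>V. h' v = h v) \<and> P h'"
    then obtain h' where h': "\<forall>v\<in>V. h' v = h v" "P h'" by blast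
    have "P h' = P h" by (rule definable_cong[OF empty]) (use h' in simp)
    with h' show "P h" by simp
  qed blast
  then show ?case using empty by simp
next
  case (insert w F)
  have "definable C (V \<union> F) A (\<lambda>h. \<exists>d. P (h(w := d)))"
    using insert.prems by (intro definable_ex1) simp
  from insert.IH[OF this]
  have *: "definable C V A (\<lambda>h. \<exists>h'. (\<forall>v\<in>V. h' v = h v) \<and> (\<exists>d. P (h'(w := d))))" .
  show ?case
  proof (cases "w \<in> V")
    case True
    then show ?thesis using insert.IH insert.prems by (simp add: insert_absorb)
  next
    case False
    have "(\<exists>h'. (\<forall>v\<in>V. h' v = h v) \<and> (\<exists>d. P (h'(w := d)))) = (\<exists>h'. (\<forall>v\<in>V. h' v = h v) \<and> P h')" for h
    proof
      assume "\<exists>h'. (\<forall>v\<in>V. h' v = h v) \<and> (\<exists>d. P (h'(w := d)))"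
      then obtain h' d where "\<forall>v\<in>V. h' v = h v" "P (h'(w := d))" by blast
      then show "\<exists>h'. (\<forall>v\<in>V. h' v = h v) \<and> P h'"
        using False by (intro exI[of _ "h'(w := d)"]) auto
    next
      assume "\<exists>h'. (\<forall>v\<in>V. h' v = h v) \<and> P h'"
      then obtain h' where "\<forall>v\<in>V. h' v = h v" "P h'" by blast
      then show "\<exists>h'. (\<forall>v\<in>V. h' v = h v) \<and> (\<exists>d. P (h'(w := d)))"
        by (intro exI[of _ h'] conjI exI[of _ "h' w"]) auto
    qed
    then show ?thesis using * by simp
  qed
qed

lemma definable_aut:
  assumes f: "f \<in> Aut C" and P: "definable C V A P"
  shows "definable C V (f ` A) (\<lambda>h. P (\<lambda>v. inv_into UNIV f (h v)))"
proof -
  from P obtain \<phi> where \<phi>: "\<phi> \<in> formulas C V A" "P = holds C \<phi>" by (rule definableE)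
  let ?\<psi> = "map_fm (\<lambda>x. x) (\<lambda>x. x) (\<lambda>x. x) f \<phi>"
  have fi: "(\<lambda>v. f (inv_into UNIV f (h v))) = h" for h
    using Aut_bij[OF f] by (auto simp: bij_def surj_f_inv_f)
  have fv: "fv ?\<psi> = fv \<phi>" by (subst fv_map_var) auto
  have "holds C ?\<psi> h = P (\<lambda>v. inv_into UNIV f (h v))" for h
  proof -
    have "holds C ?\<psi> h = sat C (f ` UNIV) ?\<psi> (\<lambda>v. f (inv_into UNIV f (case_sum h (\<lambda>_. undefined) v)))"
      using Aut_bij[OF f] by (simp add: holds_in_def fi bij_def)
    also have "\<dots> = sat C UNIV \<phi> (\<lambda>v. inv_into UNIV f (case_sum h (\<lambda>_. undefined) v))"
      using \<phi>(1) by (intro sat_aut[OF f]) (simp add: formulas_def)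
    also have "\<dots> = P (\<lambda>v. inv_into UNIV f (h v))"
      unfolding \<phi>(2) holds_in_def by (rule sat_cong) (use \<phi>(1) in \<open>auto simp: formulas_def\<close>)
    finally show ?thesis .
  qed
  moreover have "?\<psi> \<in> formulas C V (f ` A)"
    using \<phi>(1) fv by (auto simp: formulas_def wf_fm_map fm.set_map)
  ultimately show ?thesis unfolding definable_def by blast
qed

lemma definable_fix:
  assumes f: "f \<in> Aut C" and P: "definable C V A P" and fixed: "\<And>a. a \<in> A \<Longrightarrow> f a = a"
  shows "P (\<lambda>v. f (h v)) = P h"
proof -
  from P obtain \<phi> where \<phi>: "\<phi> \<in> formulas C V A" "P = holds C \<phi>" by (rule definableE)
  have "map_fm (\<lambda>x. x) (\<lambda>x. x) (\<lambda>x. x) f \<phi> = map_fm (\<lambda>x. x) (\<lambda>x. x) (\<lambda>x. x) (\<lambda>x. x) \<phi>"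
    by (rule fm.map_cong) (use \<phi>(1) fixed in \<open>auto simp: formulas_def\<close>)
  then have eq: "map_fm (\<lambda>x. x) (\<lambda>x. x) (\<lambda>x. x) f \<phi> = \<phi>" by (simp add: fm.map_ident)
  have "P (\<lambda>v. f (h v)) = sat C UNIV \<phi> (\<lambda>v. f (case_sum h (\<lambda>_. undefined) v))"
    unfolding \<phi>(2) holds_in_def by (rule sat_cong) (use \<phi>(1) in \<open>auto simp: formulas_def\<close>)
  also have "\<dots> = sat C (f ` UNIV) (map_fm (\<lambda>x. x) (\<lambda>x. x) (\<lambda>x. x) f \<phi>) (\<lambda>v. f (case_sum h (\<lambda>_. undefined) v))"
    using Aut_bij[OF f] by (simp add: eq bij_def)
  also have "\<dots> = P h"
    unfolding \<phi>(2) holds_in_def using \<phi>(1) by (intro sat_aut[OF f]) (simp add: formulas_def)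
  finally show ?thesis .
qed

lemma tp_eq_iff: "tp C V c A = tp C V d A \<longleftrightarrow> (\<forall>P. definable C V A P \<longrightarrow> P c = P d)"
proof
  assume "tp C V c A = tp C V d A"
  then show "\<forall>P. definable C V A P \<longrightarrow> P c = P d"
    unfolding tp_def by (auto elim!: definableE)
next
  assume "\<forall>P. definable C V A P \<longrightarrow> P c = P d"
  then show "tp C V c A = tp C V d A"
    unfolding tp_def by (auto dest: definable_holds)
qed

section \<open>Cardinality\<close>

inductive_set closure_under :: "'b set \<Rightarrow> 'o set \<Rightarrow> ('o \<Rightarrow> 'b list \<Rightarrow> 'b) \<Rightarrow> 'b set"
  for X :: "'b set" and Q :: "'o set" and g :: "'o \<Rightarrow> 'b list \<Rightarrow> 'b" where
  base: "x \<in> X \<Longrightarrow> x \<in> closure_under X Q g"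
| step: "q \<in> Q \<Longrightarrow> xs \<in> lists (closure_under X Q g) \<Longrightarrow> g q xs \<in> closure_under X Q g"

lemma card_of_image_ordLeq: "|A| \<le>o |S| \<Longrightarrow> |f ` A| \<le>o |S|"
  using card_of_image ordLeq_transitive by blast

lemma card_of_lists_ordLeq:
  "infinite S \<Longrightarrow> |A| \<le>o |S| \<Longrightarrow> |lists A| \<le>o |S|"
  by (rule ordLeq_ordIso_trans[OF card_of_lists_mono card_of_lists_infinite])

lemma card_of_countable_ordLeq: "infinite S \<Longrightarrow> countable A \<Longrightarrow> |A| \<le>o |S|"
proof -
  assume S: "infinite S" and "countable A"
  then obtain f :: "_ \<Rightarrow> nat" where "inj_on f A" unfolding countable_def by blast
  then have "|A| \<le>o |UNIV :: nat set|" by (rule card_of_ordLeqI) simp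
  then show ?thesis using S by (metis infinite_iff_card_of_nat ordLeq_transitive)
qed

text \<open>
  A single bound survives all the countably many stages; a bound on each stage would not be enough,
  because the degree of the monster model may have countable cofinality.
\<close>

lemma card_of_closure_under:
  assumes S: "infinite S" and X: "|X| \<le>o |S|" and Q: "|Q| \<le>o |S|"
  shows "|closure_under X Q g| \<le>o |S|"
proof -
  define Y where "Y = rec_nat X (\<lambda>_ Z. Z \<union> (\<lambda>(q, xs). g q xs) ` (Q \<times> lists Z))"
  have Y_simps: "Y 0 = X" "Y (Suc n) = Y n \<union> (\<lambda>(q, xs). g q xs) ` (Q \<times> lists (Y n))" for n
    by (auto simp: Y_def)
  have "|Y n| \<le>o |S|" for n
    by (induction n) (use S X Q in \<open>auto simp: Y_simps intro!: card_of_Un_ordLeq_infinite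
      card_of_image_ordLeq card_of_Times_ordLeq_infinite card_of_lists_ordLeq\<close>)
  then have *: "|\<Union>n. Y n| \<le>o |S|"
    using S by (intro card_of_UNION_ordLeq_infinite[OF S card_of_countable_ordLeq[OF S]]) auto
  have mono: "Y m \<subseteq> Y n" if "m \<le> n" for m n
    using that by (induction n rule: dec_induct) (auto simp: Y_simps)
  have lists: "\<exists>n. xs \<in> lists (Y n)" if "xs \<in> lists (\<Union>n. Y n)" for xs
    using that
  proof (induction xs)
    case (Cons x xs)
    then obtain m n where "x \<in> Y m" "xs \<in> lists (Y n)" by auto
    then have "x # xs \<in> lists (Y (max m n))"
      using mono[of m "max m n"] mono[of n "max m n"] by auto
    then show ?case ..
  qed auto
  have "x \<in> (\<Union>n. Y n)" if "x \<in> closure_under X Q g" for x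
    using that
  proof induction
    case (base x)
    then have "x \<in> Y 0" by (simp add: Y_simps)
    then show ?case by blast
  next
    case (step q xs)
    then have "xs \<in> lists (\<Union>n. Y n)" by auto
    then obtain n where "xs \<in> lists (Y n)" using lists by blast
    then have "g q xs \<in> Y (Suc n)" using step(1) by (auto simp: Y_simps)
    then show ?case by blast
  qed
  then have "closure_under X Q g \<subseteq> (\<Union>n. Y n)" by blast
  from card_of_mono1[OF this] * show ?thesis by (rule ordLeq_transitive)
qed

text \<open>
  Variables are natural numbers here, which makes the number of these formulas depend on the
  language alone.
\<close>

definition pure_fms :: "('f, 'r, 'z) language_scheme \<Rightarrow> ('f, 'r, nat, 'a) fm set" where
  "pure_fms L = {\<phi>. wf_fm L \<phi> \<and> params \<phi> = {}}"

text \<open>The copy of the natural numbers makes this set infinite.\<close>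

definition symbols :: "('f, 'r, 'z) language_scheme \<Rightarrow> ('f + 'r + nat) set" where
  "symbols L = dom (fun_arity L) <+> dom (rel_arity L) <+> UNIV"

lemma infinite_symbols: "infinite (symbols L)"
  unfolding symbols_def by (simp add: finite_Plus_iff)

lemma card_dom_symbols: "|dom (fun_arity L)| \<le>o |symbols L|" "|dom (rel_arity L)| \<le>o |symbols L|"
  unfolding symbols_def
  by (auto intro: card_of_Plus1 card_of_Plus2 ordLeq_transitive)

lemma card_pure_fms: "|pure_fms L :: ('f, 'r, nat, 'a) fm set| \<le>o |symbols L|"
proof -
  note S = infinite_symbols[of L] and D = card_dom_symbols[of L]
  let ?T = "closure_under (range Var) (dom (fun_arity L)) App :: ('f, nat, 'a) tm set"
  have T: "|?T| \<le>o |symbols L|"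
    by (rule card_of_closure_under[OF S _ D(1)]) (rule card_of_countable_ordLeq[OF S], simp)
  have tm: "t \<in> ?T" if "wf_tm L t" "tm_params t = {}" for t
    using that
  proof (induction t)
    case (App s ts)
    then have "ts \<in> lists ?T" by (auto simp: in_lists_conv_set)
    moreover have "s \<in> dom (fun_arity L)" using App by auto
    ultimately show ?case by (intro closure_under.step)
  qed (auto intro: closure_under.base)
  let ?X = "(\<lambda>(s, t). Eq s t) ` (?T \<times> ?T) \<union> (\<lambda>(R, ts). Rel R ts) ` (dom (rel_arity L) \<times> lists ?T)"
  let ?g = "\<lambda>q xs. case q of None \<Rightarrow> Neg (hd xs) | Some None \<Rightarrow> Conj (hd xs) (hd (tl xs))
    | Some (Some n) \<Rightarrow> Exists n (hd xs)"
  let ?F = "closure_under ?X (UNIV :: nat option option set) ?g"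
  have "|?X| \<le>o |symbols L|"
    using S T D by (intro card_of_Un_ordLeq_infinite card_of_image_ordLeq card_of_Times_ordLeq_infinite card_of_lists_ordLeq)
  then have "|?F| \<le>o |symbols L|"
    by (rule card_of_closure_under[OF S _ card_of_countable_ordLeq[OF S]]) auto
  moreover have "\<phi> \<in> ?F" if "wf_fm L \<phi>" "params \<phi> = {}" for \<phi>
    using that
  proof (induction \<phi>)
    case (Eq s t)
    then have "s \<in> ?T" "t \<in> ?T" using tm by auto
    then show ?case by (intro closure_under.base) auto
  next
    case (Rel R ts)
    then have "ts \<in> lists ?T" using tm by (auto simp: in_lists_conv_set)
    then show ?case using Rel by (intro closure_under.base) auto
  next
    case (Neg \<phi>)
    then have "?g None [\<phi>] \<in> ?F" by (intro closure_under.step) auto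
    then show ?case by simp
  next
    case (Conj \<phi> \<psi>)
    then have "?g (Some None) [\<phi>, \<psi>] \<in> ?F" by (intro closure_under.step) auto
    then show ?case by simp
  next
    case (Exists n \<phi>)
    then have "?g (Some (Some n)) [\<phi>] \<in> ?F" by (intro closure_under.step) auto
    then show ?case by simp
  qed
  then have "pure_fms L \<subseteq> ?F" by (auto simp: pure_fms_def)
  from card_of_mono1[OF this] show ?thesis using calculation by (rule ordLeq_transitive)
qed

text \<open>
  Substitution of the parameters \<open>a\<close> for the variables \<open>k a\<close>, read backwards.  It preserves
  satisfaction under assignments taking each \<open>k a\<close> to \<open>a\<close>, as long as no \<open>k a\<close> is a
  variable of the formula.
\<close>

fun par_to_var_tm :: "('a \<Rightarrow> 'v) \<Rightarrow> ('f, 'v, 'a) tm \<Rightarrow> ('f, 'v, 'a) tm" where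
  "par_to_var_tm k (Var v) = Var v"
| "par_to_var_tm k (Par a) = Var (k a)"
| "par_to_var_tm k (App s ts) = App s (map (par_to_var_tm k) ts)"

primrec par_to_var :: "('a \<Rightarrow> 'v) \<Rightarrow> ('f, 'r, 'v, 'a) fm \<Rightarrow> ('f, 'r, 'v, 'a) fm" where
  "par_to_var k (Eq s t) = Eq (par_to_var_tm k s) (par_to_var_tm k t)"
| "par_to_var k (Rel R ts) = Rel R (map (par_to_var_tm k) ts)"
| "par_to_var k (Neg \<phi>) = Neg (par_to_var k \<phi>)"
| "par_to_var k (Conj \<phi> \<psi>) = Conj (par_to_var k \<phi>) (par_to_var k \<psi>)"
| "par_to_var k (Exists v \<phi>) = Exists v (par_to_var k \<phi>)"

lemma par_to_var_tm:
  "tm_params (par_to_var_tm k t) = {}" "wf_tm L (par_to_var_tm k t) = wf_tm L t"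
  by (induction t) auto

lemma eval_par_to_var_tm:
  "(\<And>a. a \<in> tm_params t \<Longrightarrow> h (k a) = a) \<Longrightarrow> eval C h (par_to_var_tm k t) = eval C h t"
proof (induction t)
  case (App s ts)
  have "eval C h (par_to_var_tm k t) = eval C h t" if "t \<in> set ts" for t
    by (rule App.IH[OF that]) (use that App.prems in auto)
  then have "map (eval C h) (map (par_to_var_tm k) ts) = map (eval C h) ts" by auto
  then show ?case by (simp only: par_to_var_tm.simps eval.simps)
qed auto

lemma pure_par_to_var: "wf_fm L \<phi> \<Longrightarrow> par_to_var k \<phi> \<in> pure_fms L"
  unfolding pure_fms_def by (induction \<phi>) (auto simp: par_to_var_tm)

lemma fv_par_to_var: "fv (par_to_var k \<phi>) \<subseteq> fv \<phi> \<union> k ` params \<phi>"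
proof -
  have tm: "tm_vars (par_to_var_tm k t) \<subseteq> tm_vars t \<union> k ` tm_params t" for t
  proof (induction t)
    case (App s ts)
    have "tm_vars (par_to_var_tm k t) \<subseteq> tm_vars (App s ts) \<union> k ` tm_params (App s ts)"
      if "t \<in> set ts" for t
      using App.IH[OF that] that by (simp add: subset_iff) blast
    then show ?case by (simp add: UN_subset_iff)
  qed auto
  show ?thesis
  proof (induction \<phi>)
    case (Eq s t)
    then show ?case using tm[of s] tm[of t] by auto
  next
    case (Rel R ts)
    have "tm_vars (par_to_var_tm k t) \<subseteq> fv (Rel R ts) \<union> k ` params (Rel R ts)"
      if "t \<in> set ts" for t
      using tm[of t] that by (simp add: subset_iff) blast
    then show ?case by (simp add: UN_subset_iff)
  qed auto
qed

lemma sat_par_to_var: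
  "(\<And>a. a \<in> params \<phi> \<Longrightarrow> h (k a) = a) \<Longrightarrow> k ` params \<phi> \<inter> set3_fm \<phi> = {} \<Longrightarrow>
    sat C D (par_to_var k \<phi>) h = sat C D \<phi> h"
proof (induction \<phi> arbitrary: h)
  case (Eq s t)
  then show ?case using eval_par_to_var_tm[of s h k C] eval_par_to_var_tm[of t h k C] by auto
next
  case (Rel R ts)
  then have "map (eval C h) (map (par_to_var_tm k) ts) = map (eval C h) ts"
    by (auto intro!: eval_par_to_var_tm)
  then show ?case by (simp only: par_to_var.simps sat.simps)
next
  case (Exists v \<phi>)
  have "sat C D (par_to_var k \<phi>) (h(v := d)) = sat C D \<phi> (h(v := d))" for d
    by (rule Exists.IH) (use Exists.prems in auto)
  then show ?case by simp
next
  case (Conj \<phi> \<psi>)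
  have "sat C D (par_to_var k \<phi>) h = sat C D \<phi> h" "sat C D (par_to_var k \<psi>) h = sat C D \<psi> h"
    by (rule Conj.IH; use Conj.prems in auto)+
  then show ?case by simp
next
  case (Neg \<phi>)
  have "sat C D (par_to_var k \<phi>) h = sat C D \<phi> h" by (rule Neg.IH) (use Neg.prems in auto)
  then show ?case by simp
qed

text \<open>
  A formula may bind any of the variables, so there can be many more formulas over \<open>V\<close> and \<open>A\<close>
  than there are definable predicates.  The latter are coded by a parameter-free formula in
  variables indexed by natural numbers and a finite list of entries, each a variable or a parameter.
  The entries for bound variables have the default value \<open>undefined\<close>.
\<close>

definition read_list :: "('v \<Rightarrow> 'a) \<Rightarrow> ('v + 'a) list \<Rightarrow> nat \<Rightarrow> 'a" where
  "read_list h xs n = case_sum h id (xs ! n)"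

lemma definable_coded:
  fixes C :: "('f, 'r, 'a, 'z) fo_structure_scheme" and V :: "'v set"
  assumes "definable C V A P"
  obtains \<chi> xs where "\<chi> \<in> pure_fms C" "xs \<in> lists (V <+> insert undefined A)"
    "\<forall>n\<in>fv \<chi>. n < length xs \<and> xs ! n \<in> V <+> A" "P = (\<lambda>h. sat C UNIV \<chi> (read_list h xs))"
proof -
  from assms obtain \<phi> where \<phi>: "\<phi> \<in> formulas C V A" "P = holds C \<phi>" by (rule definableE)
  obtain ys where ys: "set ys = Inl ` set3_fm \<phi> \<union> Inr ` params \<phi>" "distinct ys"
    using finite_distinct_list[of "Inl ` set3_fm \<phi> \<union> Inr ` params \<phi>"] finite_vars[of \<phi>] finite_params[of \<phi>]
    by (metis finite_Un finite_imageI)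
  have "\<exists>n < length ys. ys ! n = y" if "y \<in> set ys" for y
    using that by (simp add: in_set_conv_nth)
  then obtain pos where pos: "\<And>y. y \<in> set ys \<Longrightarrow> pos y < length ys \<and> ys ! pos y = y" by metis
  define c where "c y = (case y of Inl (Inl v) \<Rightarrow> if v \<in> V then Inl v else Inr undefined
    | Inl (Inr m) \<Rightarrow> Inr undefined | Inr a \<Rightarrow> Inr a)" for y :: "('v + nat) + 'a"
  define xs where "xs = map c ys"
  let ?\<tau> = "\<lambda>v. pos (Inl v)" and ?k = "\<lambda>a. pos (Inr a)"
  let ?\<phi> = "map_fm (\<lambda>x. x) (\<lambda>x. x) ?\<tau> (\<lambda>x. x) \<phi>"
  have inj: "inj_on pos (set ys)" using pos by (metis inj_onI)
  have \<tau>: "inj_on ?\<tau> (set3_fm \<phi>)"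
    using inj ys(1) by (auto simp: inj_on_def)
  have disj: "?k ` params ?\<phi> \<inter> set3_fm ?\<phi> = {}"
    using inj ys(1) by (auto simp: inj_on_def fm.set_map)
  have xs_nth: "read_list h xs (pos y) = case_sum h id (c y)" if "y \<in> set ys" for h y
    using pos[OF that] by (simp add: read_list_def xs_def)
  have "P h = sat C UNIV (par_to_var ?k ?\<phi>) (read_list h xs)" for h
  proof -
    have "sat C UNIV (par_to_var ?k ?\<phi>) (read_list h xs) = sat C UNIV ?\<phi> (read_list h xs)"
      by (rule sat_par_to_var[OF _ disj]) (auto simp: fm.set_map xs_nth ys c_def)
    also have "\<dots> = sat C UNIV \<phi> (\<lambda>v. read_list h xs (?\<tau> v))"
      by (rule sat_map_var[OF \<tau>])
    also have "\<dots> = P h"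
      unfolding \<phi>(2) holds_in_def
    proof (rule sat_cong)
      fix v assume v: "v \<in> fv \<phi>"
      then have "v \<in> Inl ` V" "Inl v \<in> set ys"
        using \<phi>(1) fv_subset_vars[of \<phi>] ys(1) by (auto simp: formulas_def)
      then show "read_list h xs (?\<tau> v) = (case v of Inl a \<Rightarrow> h a | Inr a \<Rightarrow> undefined)"
        by (auto simp: xs_nth c_def)
    qed
    finally show ?thesis ..
  qed
  moreover have "xs \<in> lists (V <+> insert undefined A)"
  proof -
    have "c y \<in> V <+> insert undefined A" if "y \<in> set ys" for y
      using that ys(1) \<phi>(1) by (cases y) (auto simp: c_def formulas_def split: sum.splits)
    then show ?thesis by (auto simp: xs_def in_lists_conv_set)
  qed
  moreover have "par_to_var ?k ?\<phi> \<in> pure_fms C"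
    using \<phi>(1) by (intro pure_par_to_var) (simp add: wf_fm_map formulas_def)
  moreover have "\<forall>n\<in>fv (par_to_var ?k ?\<phi>). n < length xs \<and> xs ! n \<in> V <+> A"
  proof
    fix n assume "n \<in> fv (par_to_var ?k ?\<phi>)"
    then have "n \<in> ?\<tau> ` fv \<phi> \<union> ?k ` params \<phi>"
      using fv_par_to_var[of ?k ?\<phi>] by (auto simp: fm.set_map fv_map_var[OF \<tau>])
    then obtain y where y: "n = pos y" "y \<in> Inl ` fv \<phi> \<union> Inr ` params \<phi>" by blast
    then have "y \<in> set ys" using fv_subset_vars[of \<phi>] unfolding ys(1) by blast
    moreover have "c y \<in> V <+> A" using y(2) \<phi>(1) by (auto simp: c_def formulas_def)
    ultimately show "n < length xs \<and> xs ! n \<in> V <+> A" using pos[of y] y(1) by (simp add: xs_def)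
  qed
  ultimately show ?thesis by (intro that) auto
qed

text \<open>
  A predicate of \<open>y\<close> over the entries of \<open>b\<close> is a predicate over \<open>\<emptyset>\<close> of the pair \<open>(b, y)\<close>.  An
  entry that occurs several times in \<open>b\<close> is read at one place, whichever \<open>inv_into\<close> picks.
\<close>

lemma definable_abstract_params:
  fixes b :: "'j \<Rightarrow> 'a" and V :: "'v set"
  assumes P: "definable C V (b ` J) P"
  obtains Q where "definable C (J <+> V) {} Q" "\<And>h. P h = Q (case_sum b h)"
proof -
  from P obtain \<chi> xs where \<chi>: "\<chi> \<in> pure_fms C"
    and xs: "\<forall>n\<in>fv \<chi>. n < length xs \<and> xs ! n \<in> V <+> b ` J"
    and eq: "P = (\<lambda>h. sat C UNIV \<chi> (read_list h xs))"
    by (rule definable_coded)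
  let ?s = "\<lambda>n. case_sum Inr (\<lambda>x. Inl (inv_into J b x)) (xs ! n)"
  let ?Q = "\<lambda>h. sat C UNIV \<chi> (\<lambda>n. h (?s n))"
  have "definable C (J <+> V) {} (\<lambda>h. sat C UNIV \<chi> (\<lambda>n. case_sum h id (Inl (?s n))))"
  proof (rule sat_subst)
    show "wf_fm C \<chi>" "params \<chi> \<subseteq> {}" using \<chi> by (auto simp: pure_fms_def)
    show "(\<lambda>n. Inl (?s n)) ` fv \<chi> \<subseteq> (J <+> V) <+> {}"
    proof
      fix y assume "y \<in> (\<lambda>n. Inl (?s n)) ` fv \<chi>"
      then obtain n where "n \<in> fv \<chi>" "y = Inl (?s n)" by blast
      moreover have "xs ! n \<in> V <+> b ` J" using xs \<open>n \<in> fv \<chi>\<close> by blast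
      ultimately show "y \<in> (J <+> V) <+> {}" by (auto simp: inv_into_into)
    qed
  qed
  then have "definable C (J <+> V) {} ?Q" by simp
  moreover have "P h = ?Q (case_sum b h)" for h
    unfolding eq
  proof (rule sat_cong)
    fix n assume "n \<in> fv \<chi>"
    with xs have "xs ! n \<in> V <+> b ` J" by blast
    then show "read_list h xs n = case_sum b h (?s n)" by (auto simp: read_list_def f_inv_into_f)
  qed
  ultimately show ?thesis by (rule that)
qed

section \<open>Elementary submodels\<close>

text \<open>
  The Tarski-Vaught test.  Elementarity speaks of sentences only, so to see that an \<open>m \<in> M\<close>
  satisfying \<open>\<phi>\<close> in \<open>M\<close> does so in the monster model, it is put into the sentence
  \<open>\<exists>x. x = m \<and> \<phi>\<close>.
\<close>

lemma elementary_submodel_iff: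
  fixes C :: "('f, 'r, 'a, 'z) fo_structure_scheme"
  shows "elementary_submodel C M \<longleftrightarrow>
    (\<forall>P. definable C {()} M P \<longrightarrow> (\<exists>h. P h) \<longrightarrow> (\<exists>m\<in>M. P (\<lambda>_. m)))"
proof
  assume M: "elementary_submodel C M"
  show "\<forall>P. definable C {()} M P \<longrightarrow> (\<exists>h. P h) \<longrightarrow> (\<exists>m\<in>M. P (\<lambda>_. m))"
  proof (intro allI impI)
    fix P assume "definable C {()} M P" and "\<exists>h. P h"
    then obtain \<phi> h where \<phi>: "\<phi> \<in> formulas C {()} M" "P = holds C \<phi>" and h: "P h"
      by (auto elim: definableE)
    have hM: "holds_in C M \<psi> k = holds C \<psi> k" if "\<psi> \<in> formulas C {} M" for \<psi> and k :: "unit \<Rightarrow> 'a"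
      using M that unfolding elementary_submodel_def by blast
    let ?v = "Inl () :: unit + nat"
    let ?a = "case_sum h (\<lambda>_. undefined) :: unit + nat \<Rightarrow> 'a"
    have "Exists ?v \<phi> \<in> formulas C {} M" using \<phi>(1) by (auto simp: formulas_def)
    from hM[OF this, of h] obtain m where m: "m \<in> M" "sat C M \<phi> (?a(?v := m))"
      using h \<phi>(2) by (auto simp: holds_in_def case_sum_upd_Inl)
        (metis (full_types) UNIV_I fun_upd_triv)
    have "Exists ?v (Conj (Eq (Var ?v) (Par m)) \<phi>) \<in> formulas C {} M"
      using \<phi>(1) m(1) by (auto simp: formulas_def)
    from hM[OF this, of h] have "sat C UNIV \<phi> (?a(?v := m))"
      using m by (auto simp: holds_in_def)
    moreover have "h(() := m) = (\<lambda>_. m)" by auto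
    ultimately show "\<exists>m\<in>M. P (\<lambda>_. m)"
      using m(1) \<phi>(2) by (auto simp: holds_in_def case_sum_upd_Inl)
  qed
next
  assume M: "\<forall>P. definable C {()} M P \<longrightarrow> (\<exists>h. P h) \<longrightarrow> (\<exists>m\<in>M. P (\<lambda>_. m))"
  have ne: "M \<noteq> {}" using M[rule_format, OF definable_True] by auto
  have "fun_int C s xs \<in> M" if "fun_arity C s = Some (length xs)" "set xs \<subseteq> M" for s xs
  proof -
    let ?\<phi> = "Eq (Var (Inl ())) (App s (map Par xs)) :: ('f, 'r, unit + nat, 'a) fm"
    have "?\<phi> \<in> formulas C {()} M" using that by (auto simp: formulas_def)
    moreover have "map (eval C k \<circ> Par) xs = xs" for k :: "unit + nat \<Rightarrow> 'a" by (simp add: map_idI)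
    ultimately have "definable C {()} M (\<lambda>h. h () = fun_int C s xs)"
      unfolding definable_def by (intro bexI[of _ ?\<phi>]) (auto simp: holds_in_def)
    moreover have "\<exists>h. h () = fun_int C s xs" by (rule exI[of _ "\<lambda>_. fun_int C s xs"]) simp
    ultimately show ?thesis using M[rule_format, of "\<lambda>h. h () = fun_int C s xs"] by auto
  qed
  moreover have "sat C M \<phi> h = sat C UNIV \<phi> h"
    if "wf_fm C \<phi>" "params \<phi> \<subseteq> M" "h ` fv \<phi> \<subseteq> M" for \<phi> :: "('f, 'r, unit + nat, 'a) fm" and h
    using that
  proof (induction \<phi> arbitrary: h)
    case (Exists v \<phi>)
    have IH: "sat C M \<phi> (h(v := d)) = sat C UNIV \<phi> (h(v := d))" if "d \<in> M" for d
      by (rule Exists.IH) (use that Exists.prems in auto)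
    have "definable C {()} M (\<lambda>k. sat C UNIV \<phi> (\<lambda>w. case_sum k id (if w = v then Inl () else Inr (h w))))"
      by (rule sat_subst) (use Exists.prems in auto)
    moreover have "(\<lambda>w. case_sum k id (if w = v then Inl () else Inr (h w))) = h(v := k ())" for k
      by auto
    ultimately have "definable C {()} M (\<lambda>k. sat C UNIV \<phi> (h(v := k ())))" by simp
    note M' = M[rule_format, OF this]
    have "\<exists>m\<in>M. sat C UNIV \<phi> (h(v := m))" if "sat C UNIV \<phi> (h(v := d))" for d
      by (rule M', rule exI[of _ "\<lambda>_. d"]) (rule that)
    then show ?case using IH by auto
  qed auto
  then have "holds_in C M \<phi> h = holds C \<phi> h" if "\<phi> \<in> formulas C {} M" for \<phi> and h :: "unit \<Rightarrow> 'a"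
    using that by (auto simp: formulas_def holds_in_def)
  ultimately show "elementary_submodel C M"
    unfolding elementary_submodel_def using ne by blast
qed

lemma elementary_submodelD:
  assumes "elementary_submodel C M" "definable C {()} M P" "P h"
  shows "\<exists>m\<in>M. P (\<lambda>_. m)"
proof -
  from assms(3) have "\<exists>h. P h" by (rule exI[of P h])
  with assms(1,2) show ?thesis unfolding elementary_submodel_iff by blast
qed

lemma elementary_submodel_witness:
  assumes M: "elementary_submodel C M" and "finite V" "definable C V M P" "P h"
  obtains h' where "h' ` V \<subseteq> M" "P h'"
proof -
  have "\<exists>h'. h' ` V \<subseteq> M \<and> P h'"
    using assms(2-4)
  proof (induction V arbitrary: P h)
    case empty
    then show ?case by auto
  next
    case (insert v V)
    have "definable C V M (\<lambda>h. \<exists>d. P (h(v := d)))" by (rule definable_ex1) (rule insert.prems)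
    moreover have "\<exists>d. P (h(v := d))" using insert.prems(2) by (metis fun_upd_triv)
    ultimately obtain h1 where h1: "h1 ` V \<subseteq> M" "\<exists>d. P (h1(v := d))"
      using insert.IH[of "\<lambda>h. \<exists>d. P (h(v := d))" h] by auto
    have "definable C {()} M (\<lambda>k. P (\<lambda>w. case_sum k id (if w = v then Inl () else Inr (h1 w))))"
      by (rule definable_subst[OF insert.prems(1)]) (use h1 in auto)
    moreover have "(\<lambda>w. case_sum k id (if w = v then Inl () else Inr (h1 w))) = h1(v := k ())" for k
      by auto
    ultimately have "definable C {()} M (\<lambda>k. P (h1(v := k ())))" by simp
    moreover from h1(2) obtain d where "P (h1(v := (\<lambda>_. d) ()))" by auto
    ultimately have "\<exists>m\<in>M. P (h1(v := m))" by (rule elementary_submodelD[OF M])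
    then obtain m where "m \<in> M" "P (h1(v := m))" by blast
    moreover have "(h1(v := m)) ` insert v V \<subseteq> M" using h1(1) \<open>m \<in> M\<close> by auto
    ultimately show ?case by blast
  qed
  then show ?thesis using that by blast
qed

lemma Aut_comp: "f \<in> Aut C \<Longrightarrow> g \<in> Aut C \<Longrightarrow> (\<lambda>x. f (g x)) \<in> Aut C"
proof -
  assume f: "f \<in> Aut C" and g: "g \<in> Aut C"
  have "map (\<lambda>x. f (g x)) xs = map f (map g xs)" for xs by simp
  moreover have "bij (\<lambda>x. f (g x))"
    using bij_comp[OF Aut_bij[OF g] Aut_bij[OF f]] by (simp add: comp_def)
  ultimately show ?thesis
    using f g unfolding Aut_def by (simp del: map_map)
qed

lemma Aut_inv: assumes f: "f \<in> Aut C" shows "inv_into UNIV f \<in> Aut C"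
proof -
  let ?g = "inv_into UNIV f"
  have b: "bij f" by (rule Aut_bij[OF f])
  have fg: "f (?g x) = x" "?g (f x) = x" for x
    using b by (auto simp: bij_def surj_f_inv_f)
  have m: "map f (map ?g xs) = xs" for xs by (simp add: fg comp_def)
  have "?g (fun_int C s xs) = fun_int C s (map ?g xs)" if "fun_arity C s = Some (length xs)" for s xs
  proof -
    have "f (fun_int C s (map ?g xs)) = fun_int C s (map f (map ?g xs))"
      using f that unfolding Aut_def by simp
    then show ?thesis unfolding m by (metis fg(2))
  qed
  moreover have "rel_int C R (map ?g xs) = rel_int C R xs" if "rel_arity C R = Some (length xs)" for R xs
  proof -
    have "rel_int C R (map f (map ?g xs)) = rel_int C R (map ?g xs)"
      using f that unfolding Aut_def by (simp del: map_map)
    then show ?thesis unfolding m by simp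
  qed
  ultimately show ?thesis
    unfolding Aut_def using bij_imp_bij_inv[OF b] by simp
qed

lemma Aut_id: "(\<lambda>x. x) \<in> Aut C"
  by (simp add: Aut_def bij_def inj_def surj_def)

lemma Aut_inv_simps:
  assumes "f \<in> Aut C"
  shows "f (inv_into UNIV f x) = x" "inv_into UNIV f (f x) = x" "inv_into UNIV (inv_into UNIV f) = f"
  using Aut_bij[OF assms] by (auto simp: bij_def surj_f_inv_f inv_inv_eq)

lemma elementary_submodel_aut:
  assumes f: "f \<in> Aut C" and M: "elementary_submodel C M"
  shows "elementary_submodel C (f ` M)"
  unfolding elementary_submodel_iff
proof (intro allI impI)
  fix P assume P: "definable C {()} (f ` M) P" and "\<exists>h. P h"
  then obtain h where h: "P h" by blast
  let ?g = "inv_into UNIV f"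
  have "?g ` f ` M = M" by (auto simp: Aut_inv_simps[OF f] image_iff)
  with definable_aut[OF Aut_inv[OF f] P] have "definable C {()} M (\<lambda>h. P (\<lambda>v. f (h v)))"
    by (simp add: Aut_inv_simps[OF f])
  moreover have "P (\<lambda>v. f (?g (h v)))" using h by (simp add: Aut_inv_simps[OF f])
  ultimately have "\<exists>m\<in>M. P (\<lambda>_. f m)" by (rule elementary_submodelD[OF M])
  then show "\<exists>m\<in>f ` M. P (\<lambda>_. m)" by blast
qed


section \<open>Small sets in a monster model\<close>

locale monster =
  fixes C :: "('f, 'r, 'a, 'k) big_structure"
  assumes strong_limit: "strong_limit_cardinal (degree C)"
    and uncountable_degree: "natLeq <o degree C"
    and small_funs: "small C (dom (fun_arity C))" and small_rels: "small C (dom (rel_arity C))"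
    and saturated: "saturated C" and homogeneous: "strongly_homogeneous C"
begin

lemma degree: "Card_order (degree C)" "infinite (Field (degree C))"
proof -
  show c: "Card_order (degree C)" using strong_limit by (simp add: strong_limit_cardinal_def)
  have "natLeq \<le>o |Field (degree C)|"
    using strong_limit ordIso_symmetric[OF card_of_Field_ordIso[OF c]]
    unfolding strong_limit_cardinal_def by (metis ordLeq_ordIso_trans)
  then show "infinite (Field (degree C))" using infinite_iff_natLeq_ordLeq by blast
qed

lemma small_le: "|A| \<le>o |B| \<Longrightarrow> small C B \<Longrightarrow> small C A"
  unfolding small_def by (rule ordLeq_ordLess_trans)

lemma small_subset: "A \<subseteq> B \<Longrightarrow> small C B \<Longrightarrow> small C A"
  by (rule small_le[OF card_of_mono1])

lemma small_image: "small C A \<Longrightarrow> small C (f ` A)"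
  by (rule small_le[OF card_of_image])

lemma small_nat: "small C (UNIV :: nat set)"
  unfolding small_def by (rule ordIso_ordLess_trans[OF card_of_nat uncountable_degree])

lemma small_finite: "finite A \<Longrightarrow> small C A"
  using ordLess_imp_ordLeq[of "|A|" natLeq] small_nat
  by (metis card_of_nat finite_iff_ordLess_natLeq ordIso_symmetric ordLeq_ordIso_trans small_le)

lemma small_Plus: "small C A \<Longrightarrow> small C B \<Longrightarrow> small C (A <+> B)"
  unfolding small_def using degree by (intro card_of_Plus_ordLess_infinite_Field)

lemma small_Times: "small C A \<Longrightarrow> small C B \<Longrightarrow> small C (A \<times> B)"
  unfolding small_def using degree by (intro card_of_Times_ordLess_infinite_Field)

lemma small_Un: "small C A \<Longrightarrow> small C B \<Longrightarrow> small C (A \<union> B)"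
  using small_le[OF card_of_Un_Plus_ordLeq small_Plus] .

lemma small_insert: "small C A \<Longrightarrow> small C (insert a A)"
  using small_Un[OF small_finite[of "{a}"]] by simp

lemma small_UN_finite:
  assumes "small C I" "\<And>i. i \<in> I \<Longrightarrow> finite (B i)" shows "small C (\<Union>i\<in>I. B i)"
proof -
  from finite_list[OF assms(2)] have "\<forall>i\<in>I. \<exists>xs. set xs = B i" by blast
  then obtain f where f: "\<And>i. i \<in> I \<Longrightarrow> set (f i) = B i" by metis
  have "(\<Union>i\<in>I. B i) \<subseteq> (\<lambda>(i, n). f i ! n) ` (I \<times> UNIV)"
  proof
    fix y assume "y \<in> (\<Union>i\<in>I. B i)"
    then obtain i where i: "i \<in> I" "y \<in> set (f i)" using f by blast
    then obtain n where "y = f i ! n" by (metis in_set_conv_nth)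
    with i show "y \<in> (\<lambda>(i, n). f i ! n) ` (I \<times> UNIV)" by auto
  qed
  then show ?thesis
    by (rule small_subset) (intro small_image small_Times assms small_nat)
qed

lemma small_Pow: assumes "small C A" shows "small C (Pow A)"
proof -
  have "|A| \<le>o |Field (degree C)|"
    using assms ordIso_symmetric[OF card_of_Field_ordIso[OF degree(1)]]
    unfolding small_def by (metis ordLess_imp_ordLeq ordLess_ordIso_trans)
  then obtain f where f: "inj_on f A" "f ` A \<subseteq> Field (degree C)"
    unfolding card_of_ordLeq[symmetric] by auto
  have "small C (f ` A)" by (rule small_image[OF assms])
  then have "small C (Pow (f ` A))"
    using strong_limit f(2) unfolding strong_limit_cardinal_def small_def by blast
  moreover have "|Pow A| \<le>o |Pow (f ` A)|"
    by (rule card_of_ordLeqI[of "image f"]) (use f(1) in \<open>auto simp: inj_on_image_Pow\<close>)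
  ultimately show ?thesis by (rule small_le[rotated])
qed

lemma small_enumeration:
  assumes "small C R"
  obtains l r where "l \<in> Field (degree C)" "bij_betw r (ord_below C l) R"
proof -
  have wo: "Well_order (degree C)" using degree(1) card_order_on_well_order_on by blast
  obtain l where l: "l \<in> Field (degree C)" "|R| =o Restr (degree C) (underS (degree C) l)"
    using ordLess_iff_ordIso_Restr[OF wo card_of_Well_order] assms unfolding small_def by blast
  from l(2) obtain f where "bij_betw f (Field |R| ) (Field (Restr (degree C) (underS (degree C) l)))"
    unfolding ordIso_def BNF_Wellorder_Embedding.iso_def by blast
  moreover have "Field (Restr (degree C) (underS (degree C) l)) = ord_below C l"
    using wo unfolding ord_below_def
    by (subst Refl_Field_Restr) (auto simp: order_on_defs dest: underS_Field)
  ultimately have "bij_betw f R (ord_below C l)" by (simp add: Field_card_of)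
  from that[OF l(1) bij_betw_inv_into[OF this]] show ?thesis .
qed

lemma small_ord_below: "l \<in> Field (degree C) \<Longrightarrow> small C (ord_below C l)"
  unfolding small_def ord_below_def by (rule card_of_underS[OF degree(1)])

lemma small_symbols: "small C (symbols C)"
  unfolding symbols_def by (intro small_Plus small_funs small_rels small_nat)

lemma small_definable:
  assumes "small C V" "small C A"
  shows "small C {P. definable C V A P}"
proof -
  let ?L = "V <+> insert undefined A" and ?Pf = "pure_fms C :: ('f, 'r, nat, 'a) fm set"
  let ?S = "symbols C <+> ?L"
  have S: "infinite ?S" by (simp add: finite_Plus_iff infinite_symbols)
  have sm: "small C ?S"
    by (intro small_Plus small_symbols small_insert assms)
  have "{P. definable C V A P} \<subseteq> (\<lambda>(\<chi>, xs). \<lambda>h. sat C UNIV \<chi> (read_list h xs)) ` (?Pf \<times> lists ?L)"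
  proof
    fix P assume "P \<in> {P. definable C V A P}"
    then have "definable C V A P" by simp
    then obtain \<chi> xs where "\<chi> \<in> ?Pf" "xs \<in> lists ?L" "P = (\<lambda>h. sat C UNIV \<chi> (read_list h xs))"
      by (rule definable_coded)
    then show "P \<in> (\<lambda>(\<chi>, xs). \<lambda>h. sat C UNIV \<chi> (read_list h xs)) ` (?Pf \<times> lists ?L)" by auto
  qed
  moreover have "|?Pf \<times> lists ?L| \<le>o |?S|"
  proof (rule card_of_Times_ordLeq_infinite[OF S])
    show "|?Pf| \<le>o |?S|" using card_pure_fms card_of_Plus1 by (rule ordLeq_transitive)
    show "|lists ?L| \<le>o |?S|" by (rule card_of_lists_ordLeq[OF S card_of_Plus2])
  qed
  ultimately show ?thesis
    using small_subset small_image small_le[OF _ sm] by blast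
qed

text \<open>
  The Skolem functions are the choices of a solution for a parameter-free formula in finitely many
  variables, some of which (those marked in \<open>bs\<close>) stand for the unknown.
\<close>

theorem Loewenheim_Skolem:
  assumes "small C A"
  obtains M where "A \<subseteq> M" "small C M" "elementary_submodel C M"
proof -
  let ?Pf = "pure_fms C :: ('f, 'r, nat, 'a) fm set"
  let ?as = "\<lambda>d bs zs n. if bs ! n then d else zs ! n :: 'a"
  let ?g = "\<lambda>(\<chi> :: ('f, 'r, nat, 'a) fm, bs) zs. SOME d. sat C UNIV \<chi> (?as d bs zs)"
  \<comment> \<open>With \<open>undefined\<close> in the model, so are the default entries of the codes.\<close>
  let ?M = "closure_under (insert undefined A) (?Pf \<times> lists (UNIV :: bool set)) ?g"
  let ?S = "symbols C <+> insert undefined A"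
  have S: "infinite ?S" by (simp add: finite_Plus_iff infinite_symbols)
  have sm: "small C ?S"
    by (intro small_Plus small_symbols small_insert assms)
  have "|?Pf| \<le>o |?S|" using card_pure_fms card_of_Plus1 by (rule ordLeq_transitive)
  then have "|?Pf \<times> lists (UNIV :: bool set)| \<le>o |?S|"
    by (rule card_of_Times_ordLeq_infinite[OF S _ card_of_countable_ordLeq[OF S]]) auto
  then have "|?M| \<le>o |?S|"
    by (rule card_of_closure_under[OF S card_of_Plus2])
  then have "small C ?M" using sm by (rule small_le)
  moreover have "A \<subseteq> ?M" by (auto intro: closure_under.base)
  moreover have "elementary_submodel C ?M"
    unfolding elementary_submodel_iff
  proof (intro allI impI)
    fix P assume P: "definable C {()} ?M P" and "\<exists>h. P h"
    then obtain h where h: "P h" by blast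
    from P obtain \<chi> :: "('f, 'r, nat, 'a) fm" and xs where \<chi>: "\<chi> \<in> ?Pf"
      "xs \<in> lists ({()} <+> insert undefined ?M)" "\<forall>n\<in>fv \<chi>. n < length xs \<and> xs ! n \<in> {()} <+> ?M"
      "P = (\<lambda>h. sat C UNIV \<chi> (read_list h xs))"
      by (rule definable_coded)
    have und: "insert undefined ?M = ?M" by (auto intro: closure_under.base)
    define bs where "bs = map isl xs"
    define zs where "zs = map (case_sum (\<lambda>_. undefined) id) xs"
    have P_eq: "P k = sat C UNIV \<chi> (?as (k ()) bs zs)" for k
      unfolding \<chi>(4)
    proof (rule sat_cong)
      fix n assume "n \<in> fv \<chi>"
      then have "n < length xs" using \<chi>(3) by blast
      then show "read_list k xs n = ?as (k ()) bs zs n"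
        by (auto simp: read_list_def bs_def zs_def split: sum.splits)
    qed
    let ?m = "?g (\<chi>, bs) zs"
    have zs: "zs \<in> lists ?M"
      using \<chi>(2) unfolding und zs_def
      by (auto simp: in_lists_conv_set intro: closure_under.base split: sum.splits)
    have "?m \<in> ?M"
      by (rule closure_under.step) (use \<chi>(1) zs in auto)
    moreover have "sat C UNIV \<chi> (?as ?m bs zs)"
      using h unfolding P_eq prod.case by (rule someI)
    ultimately show "\<exists>m\<in>?M. P (\<lambda>_. m)"
      unfolding P_eq by blast
  qed
  ultimately show ?thesis by (intro that)
qed

end

context monster begin

section \<open>Saturation and homogeneity for small tuples\<close>

lemma saturation1:
  assumes A: "small C A" and def: "\<And>P. P \<in> \<P> \<Longrightarrow> definable C {()} A P"
    and fin: "\<And>\<Q>. finite \<Q> \<Longrightarrow> \<Q> \<subseteq> \<P> \<Longrightarrow> \<exists>h. \<forall>P\<in>\<Q>. P h"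
  shows "\<exists>a. \<forall>P\<in>\<P>. P (\<lambda>_. a)"
proof -
  let ?p = "{\<phi> \<in> formulas C {()} A. holds C \<phi> \<in> \<P>}"
  have "\<exists>a. \<forall>\<phi>\<in>q. holds C \<phi> a" if "q \<subseteq> ?p" "finite q" for q
  proof -
    have "\<exists>h. \<forall>P\<in>holds C ` q. P h" by (rule fin) (use that in auto)
    then show ?thesis by simp
  qed
  then have "\<exists>a. \<forall>\<phi>\<in>?p. holds C \<phi> a"
    by (intro saturated[unfolded saturated_def, THEN spec[of _ A], THEN mp[OF _ A], THEN spec[of _ ?p],
          THEN mp, THEN mp] allI impI) auto
  then obtain h where h: "\<And>\<phi>. \<phi> \<in> ?p \<Longrightarrow> holds C \<phi> h" by auto
  have "P (\<lambda>_. h ())" if "P \<in> \<P>" for P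
  proof -
    obtain \<phi> where "\<phi> \<in> formulas C {()} A" "P = holds C \<phi>"
      using def[OF \<open>P \<in> \<P>\<close>] by (rule definableE)
    moreover have "(\<lambda>_. h ()) = h" by auto
    ultimately show ?thesis using h that by simp
  qed
  then show ?thesis by blast
qed

text \<open>
  A maximal finitely consistent partial assignment is total: a value for one more variable
  realizes a finitely satisfiable type in that variable, got by quantifying out the others.
\<close>

theorem saturation:
  fixes \<P> :: "(('j \<Rightarrow> 'a) \<Rightarrow> bool) set"
  assumes J: "small C J" and A: "small C A" and def: "\<And>P. P \<in> \<P> \<Longrightarrow> definable C J A P"
    and fin: "\<And>\<Q>. finite \<Q> \<Longrightarrow> \<Q> \<subseteq> \<P> \<Longrightarrow> \<exists>h. \<forall>P\<in>\<Q>. P h"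
  shows "\<exists>h. \<forall>P\<in>\<P>. P h"
proof -
  define sol where "sol g1 \<Q> h \<longleftrightarrow> (\<forall>(j, a)\<in>g1. h j = a) \<and> (\<forall>P\<in>\<Q>. P h)"
    for g1 :: "('j \<times> 'a) set" and \<Q> :: "(('j \<Rightarrow> 'a) \<Rightarrow> bool) set" and h
  define good where "good = {g :: ('j \<times> 'a) set. fst ` g \<subseteq> J \<and>
    (\<forall>\<Q> g1. finite \<Q> \<longrightarrow> \<Q> \<subseteq> \<P> \<longrightarrow> finite g1 \<longrightarrow> g1 \<subseteq> g \<longrightarrow> (\<exists>h. sol g1 \<Q> h))}"
  have sol_mono: "sol g2 \<Q>2 h" if "sol g1 \<Q>1 h" "g2 \<subseteq> g1" "\<Q>2 \<subseteq> \<Q>1" for g1 g2 \<Q>1 \<Q>2 h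
    using that unfolding sol_def by (metis subsetD)
  have goodD: "\<exists>h. sol g1 \<Q> h"
    if "g \<in> good" "finite \<Q>" "\<Q> \<subseteq> \<P>" "finite g1" "g1 \<subseteq> g" for g \<Q> g1
    using that unfolding good_def by simp
  have goodD1: "fst ` g \<subseteq> J" if "g \<in> good" for g
    using that unfolding good_def by simp
  have goodI: "g \<in> good" if "fst ` g \<subseteq> J"
    "\<And>\<Q> g1. finite \<Q> \<Longrightarrow> \<Q> \<subseteq> \<P> \<Longrightarrow> finite g1 \<Longrightarrow> g1 \<subseteq> g \<Longrightarrow> \<exists>h. sol g1 \<Q> h" for g
    using that unfolding good_def by simp
  have "\<exists>g\<in>good. \<forall>g'\<in>good. g \<subseteq> g' \<longrightarrow> g' = g"
  proof (rule subset_Zorn')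
    fix ch assume ch: "subset.chain good ch"
    show "\<Union>ch \<in> good"
    proof (cases "ch = {}")
      case True
      then show ?thesis using fin by (auto simp: good_def sol_def)
    next
      case False
      have "\<exists>h. sol g1 \<Q> h" if 1: "finite \<Q>" "\<Q> \<subseteq> \<P>" "finite g1" "g1 \<subseteq> \<Union>ch" for \<Q> g1
      proof -
        obtain g where "g \<in> ch" "g1 \<subseteq> g"
          using finite_subset_Union_chain[OF 1(3,4) False ch] by blast
        moreover have "g \<in> good" using ch \<open>g \<in> ch\<close> unfolding subset.chain_def by blast
        ultimately show ?thesis using goodD 1 by simp
      qed
      moreover have "fst ` \<Union>ch \<subseteq> J"
        using ch goodD1 unfolding subset.chain_def by fastforce
      ultimately show ?thesis by (intro goodI)
    qed
  qed
  then obtain g where g: "g \<in> good" and max: "\<And>g'. g' \<in> good \<Longrightarrow> g \<subseteq> g' \<Longrightarrow> g' = g" by blast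
  have "\<exists>a. (j, a) \<in> g" if j: "j \<in> J" for j
  proof (rule ccontr)
    assume no: "\<nexists>a. (j, a) \<in> g"
    let ?A = "A \<union> snd ` g"
    let ?R = "\<lambda>(\<Q>, g1) k. \<exists>h. h j = k () \<and> sol g1 \<Q> h"
    let ?X = "{(\<Q>, g1). finite \<Q> \<and> \<Q> \<subseteq> \<P> \<and> finite g1 \<and> g1 \<subseteq> g}"
    have "inj_on fst g"
    proof (rule inj_onI)
      fix x y assume xy: "x \<in> g" "y \<in> g" "fst x = fst y"
      then obtain h where "sol {x, y} {} h" using goodD[OF g, of "{}" "{x, y}"] by auto
      then show "x = y" using xy(3) by (cases x; cases y) (auto simp: sol_def)
    qed
    then have "|g| \<le>o |J|" using goodD1[OF g] by (intro card_of_ordLeqI[of fst]) auto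
    then have sA: "small C ?A" by (intro small_Un A small_image small_le[OF _ J])
    have "\<exists>a. \<forall>P\<in>?R ` ?X. P (\<lambda>_. a)"
    proof (rule saturation1[OF sA])
      fix P assume "P \<in> ?R ` ?X"
      then obtain \<Q> g1 where Q: "finite \<Q>" "\<Q> \<subseteq> \<P>" "finite g1" "g1 \<subseteq> g" and P: "P = ?R (\<Q>, g1)" by auto
      have "definable C J ?A (\<lambda>h. \<forall>(i, a)\<in>g1. h i = a)"
        by (rule definable_ball[OF Q(3)])
          (use Q(4) goodD1[OF g] in \<open>force intro!: definable_eq_par\<close>)
      moreover have "definable C J ?A (\<lambda>h. \<forall>P\<in>\<Q>. P h)"
        by (rule definable_ball[OF Q(1)]) (use Q(2) def in \<open>auto intro: definable_mono\<close>)
      ultimately have "definable C J ?A (sol g1 \<Q>)"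
        unfolding sol_def by (rule definable_conj)
      then obtain V0 A0 where V0: "finite V0" "V0 \<subseteq> J" "A0 \<subseteq> ?A" "definable C V0 A0 (sol g1 \<Q>)"
        by (rule definable_finite_support)
      have "definable C {j} ?A (\<lambda>k. \<exists>h. (\<forall>v\<in>{j}. h v = k v) \<and> sol g1 \<Q> h)"
        by (rule definable_ex[OF V0(1)]) (rule definable_mono[OF V0(4)], use V0 in auto)
      from definable_rename[OF this, of "\<lambda>_. ()" "{()}"]
      show "definable C {()} ?A P" unfolding P by simp
    next
      fix \<R> assume R: "finite \<R>" "\<R> \<subseteq> ?R ` ?X"
      obtain Y where Y: "Y \<subseteq> ?X" "finite Y" "\<R> = ?R ` Y"
        using finite_subset_image[OF R] by auto
      let ?Q = "\<Union>(fst ` Y)" and ?g = "\<Union>(snd ` Y)"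
      have "\<exists>h. sol ?g ?Q h"
      proof -
        have "finite ?Q" "finite ?g" using Y(1,2) by auto
        moreover have "?Q \<subseteq> \<P>" "?g \<subseteq> g" using Y(1) by fastforce+
        ultimately show ?thesis using goodD[OF g] by simp
      qed
      then obtain h where h: "sol ?g ?Q h" by blast
      have "?R y (\<lambda>_. h j)" if y: "y \<in> Y" for y
      proof -
        have "fst y \<subseteq> ?Q" "snd y \<subseteq> ?g" using y by auto
        then have "sol (snd y) (fst y) h" by (rule sol_mono[OF h, rotated])
        then show ?thesis by (cases y) auto
      qed
      then have "\<forall>P\<in>\<R>. P (\<lambda>_. h j)" unfolding Y(3) by simp
      then show "\<exists>k. \<forall>P\<in>\<R>. P k" by (rule exI[of _ "\<lambda>_. h j"])
    qed
    then obtain a where a0: "\<forall>P\<in>?R ` ?X. P (\<lambda>_. a)" by auto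
    have a: "\<exists>h. h j = a \<and> sol g1 \<Q> h"
      if "finite \<Q>" "\<Q> \<subseteq> \<P>" "finite g1" "g1 \<subseteq> g" for \<Q> g1
    proof -
      have "?R (\<Q>, g1) \<in> ?R ` ?X" by (rule imageI) (use that in simp)
      from bspec[OF a0 this] show ?thesis by simp
    qed
    have "insert (j, a) g \<in> good"
    proof (rule goodI)
      show "fst ` insert (j, a) g \<subseteq> J" using goodD1[OF g] j by auto
      fix \<Q> g1 assume 1: "finite \<Q>" "\<Q> \<subseteq> \<P>" "finite g1" "g1 \<subseteq> insert (j, a) g"
      then have "finite (g1 - {(j, a)})" "g1 - {(j, a)} \<subseteq> g" by auto
      from a[OF 1(1,2) this] obtain h where h: "h j = a" "sol (g1 - {(j, a)}) \<Q> h" by blast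
      have "sol (insert (j, a) (g1 - {(j, a)})) \<Q> h" using h unfolding sol_def by (simp only: ball_simps prod.case simp_thms)
      then have "sol g1 \<Q> h" by (rule sol_mono) auto
      then show "\<exists>h. sol g1 \<Q> h" by (rule exI[of "sol g1 \<Q>"])
    qed
    from max[OF this] have "(j, a) \<in> g" by auto
    with no show False by simp
  qed
  then obtain h where h: "\<And>j. j \<in> J \<Longrightarrow> (j, h j) \<in> g" by metis
  have "P h" if P: "P \<in> \<P>" for P
  proof -
    obtain V0 A0 where V0: "finite V0" "V0 \<subseteq> J" "definable C V0 A0 P"
      using def[OF P] by (rule definable_finite_support)
    have "(\<lambda>j. (j, h j)) ` V0 \<subseteq> g" "finite ((\<lambda>j. (j, h j)) ` V0)" using h V0 by auto
    moreover have "finite {P}" "{P} \<subseteq> \<P>" using P by auto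
    ultimately have "\<exists>h'. sol ((\<lambda>j. (j, h j)) ` V0) {P} h'"
      using goodD[OF g] by blast
    then obtain h' where h': "\<forall>j\<in>V0. h' j = h j" "P h'" by (auto simp: sol_def)
    have "P h' = P h" by (rule definable_cong[OF V0(3)]) (use h' in simp)
    then show ?thesis using h' by simp
  qed
  then show ?thesis by blast
qed

text \<open>
  The tuple \<open>c\<close> together with \<open>A\<close> is enumerated by itself, as strong homogeneity requires; a
  predicate in these variables becomes one in the variables \<open>J\<close> with parameters in \<open>A\<close>.
\<close>

theorem homogeneity:
  assumes J: "small C J" and A: "small C A"
    and eq: "\<And>P. definable C J A P \<Longrightarrow> P c = P d"
  obtains f where "f \<in> Aut C" "\<And>a. a \<in> A \<Longrightarrow> f a = a" "\<And>j. j \<in> J \<Longrightarrow> f (c j) = d j"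
proof -
  let ?D = "A \<union> c ` J"
  define g where "g x = (if x \<in> c ` J then d (inv_into J c x) else x)" for x
  define s where "s x = (if x \<in> c ` J then Inl (inv_into J c x) else Inr x)" for x
  have inv: "c (inv_into J c x) = x" "inv_into J c x \<in> J" if "x \<in> c ` J" for x
    using that by (auto simp: f_inv_into_f inv_into_into)
  have gc: "g (c j) = d j" if "j \<in> J" for j
  proof -
    have "definable C J A (\<lambda>h. h (inv_into J c (c j)) = h j)"
      using that inv[of "c j"] by (intro definable_eq) auto
    from eq[OF this] show ?thesis using that inv[of "c j"] by (simp add: g_def)
  qed
  have ga: "g a = a" if "a \<in> A" for a
  proof (cases "a \<in> c ` J")
    case True
    have "definable C J A (\<lambda>h. h (inv_into J c a) = a)"
      using that inv[OF True] by (intro definable_eq_par) auto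
    from eq[OF this] show ?thesis using that inv[OF True] True by (simp add: g_def)
  qed (simp add: g_def)
  have "tp C ?D id {} = tp C ?D g {}"
    unfolding tp_eq_iff
  proof (intro allI impI)
    fix P assume P: "definable C ?D {} P"
    have "definable C J A (\<lambda>h. P (\<lambda>x. case_sum h id (s x)))"
      by (rule definable_subst[OF P]) (use inv in \<open>auto simp: s_def\<close>)
    from eq[OF this] have "P (\<lambda>x. case_sum c id (s x)) = P (\<lambda>x. case_sum d id (s x))" .
    moreover have "(\<lambda>x. case_sum c id (s x)) = id" using inv by (auto simp: s_def)
    moreover have "(\<lambda>x. case_sum d id (s x)) = g" by (auto simp: s_def g_def)
    ultimately show "P id = P g" by simp
  qed
  moreover have "small C ?D" by (intro small_Un A small_image J)
  ultimately have "\<exists>f\<in>Aut C. \<forall>a\<in>?D. f a = g a"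
    by (intro homogeneous[unfolded strongly_homogeneous_def, THEN spec[of _ ?D], THEN spec[of _ g],
          THEN mp]) simp
  then obtain f where "f \<in> Aut C" "\<And>a. a \<in> ?D \<Longrightarrow> f a = g a" by auto
  then show ?thesis using gc ga by (intro that[of f]) auto
qed

end

section \<open>Hyperimaginaries and their stabilizers\<close>

lemma type_definable_equivE:
  assumes "type_definable_equiv C I E"
  obtains \<P> where "\<And>P. P \<in> \<P> \<Longrightarrow> definable C (I <+> I) {} P"
    "\<And>x y. (x, y) \<in> E \<longleftrightarrow> x \<in> tuples I \<and> y \<in> tuples I \<and> (\<forall>P\<in>\<P>. P (case_sum x y))"
proof -
  obtain \<Phi> where \<Phi>: "\<Phi> \<subseteq> formulas C (I <+> I) {}"
    "E = {(a, b). a \<in> tuples I \<and> b \<in> tuples I \<and> (\<forall>\<phi>\<in>\<Phi>. holds C \<phi> (case_sum a b))}"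
    using assms unfolding type_definable_equiv_def by blast
  show ?thesis
  proof (rule that[of "holds C ` \<Phi>"])
    fix P assume "P \<in> holds C ` \<Phi>"
    with \<Phi>(1) show "definable C (I <+> I) {} P" by (elim imageE) (auto intro!: definable_holds)
  qed (simp add: \<Phi>(2))
qed

lemma compose_in_tuples: "compose J f c \<in> tuples J"
  by (auto simp: tuples_def compose_def)

lemma compose_apply: "j \<in> J \<Longrightarrow> compose J f c j = f (c j)"
  by (simp add: compose_def)

lemma compose_compose: "compose J f (compose J g c) = compose J (\<lambda>x. f (g x)) c"
  by (auto simp: compose_def)

lemma compose_cong: "(\<And>j. j \<in> J \<Longrightarrow> f (c j) = g (d j)) \<Longrightarrow> compose J f c = compose J g d"
  by (auto simp: compose_def restrict_def)

lemma compose_id: "c \<in> tuples J \<Longrightarrow> compose J (\<lambda>x. x) c = c"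
  by (auto simp: compose_def restrict_def tuples_def PiE_def extensional_def)

lemma tuples_eqI: "c \<in> tuples J \<Longrightarrow> d \<in> tuples J \<Longrightarrow> (\<And>j. j \<in> J \<Longrightarrow> c j = d j) \<Longrightarrow> c = d"
  unfolding tuples_def by (rule PiE_ext)

lemma compose_fixed: "c \<in> tuples J \<Longrightarrow> (\<And>j. j \<in> J \<Longrightarrow> f (c j) = c j) \<Longrightarrow> compose J f c = c"
  using compose_cong[of J f c "\<lambda>x. x" c] compose_id by metis

lemma hyp_image_comp: "hyp_image f (hyp_image g e) = hyp_image (\<lambda>x. f (g x)) e"
  by (simp add: hyp_image_def image_image compose_compose)

text \<open>
  A hyperimaginary in the form in which it is used: an automorphism-invariant equivalence
  relation given by definable predicates, and one chosen representative.
\<close>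

locale hyper = monster C for C :: "('f, 'r, 'a, 'k) big_structure" +
  fixes e :: "('i, 'a) hyp" and E :: "('i \<Rightarrow> 'a) rel" and \<P> and a :: "'i \<Rightarrow> 'a"
  assumes small_index: "small C (fst e)"
    and eqv: "equiv (tuples (fst e)) E"
    and def: "P \<in> \<P> \<Longrightarrow> definable C (fst e <+> fst e) {} P"
    and E_iff: "(x, y) \<in> E \<longleftrightarrow> x \<in> tuples (fst e) \<and> y \<in> tuples (fst e) \<and> (\<forall>P\<in>\<P>. P (case_sum x y))"
    and rep: "a \<in> tuples (fst e)" "snd e = E `` {a}"

lemma (in monster) hyperE:
  fixes e :: "('i, 'a) hyp"
  assumes "hyperimaginary C e" "a \<in> snd e"
  obtains E \<P> where "hyper C e E \<P> a"
proof -
  obtain E where E: "small C (fst e)" "type_definable_equiv C (fst e) E" "snd e \<in> tuples (fst e) // E"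
    using assms unfolding hyperimaginary_def by blast
  have eqv: "equiv (tuples (fst e)) E" using E(2) by (simp add: type_definable_equiv_def)
  obtain \<P> where P: "\<And>P. P \<in> \<P> \<Longrightarrow> definable C (fst e <+> fst e) {} P"
    "\<And>x y. (x, y) \<in> E \<longleftrightarrow> x \<in> tuples (fst e) \<and> y \<in> tuples (fst e) \<and> (\<forall>P\<in>\<P>. P (case_sum x y))"
    using E(2) by (rule type_definable_equivE) blast
  have a: "a \<in> tuples (fst e)"
    using E(3) assms(2) by (rule in_quotient_imp_subset[OF eqv, THEN subsetD])
  obtain b where b: "snd e = E `` {b}" using E(3) by (auto simp: quotient_def)
  then have "(b, a) \<in> E" using assms(2) by auto
  then have "snd e = E `` {a}" using b equiv_class_eq[OF eqv] by metis
  then have "hyper C e E \<P> a"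
    using E(1) eqv P a by unfold_locales auto
  then show ?thesis by (rule that)
qed

lemma (in monster) hyperimaginary_ne: "hyperimaginary C e \<Longrightarrow> \<exists>a. a \<in> snd e"
  unfolding hyperimaginary_def type_definable_equiv_def using in_quotient_imp_non_empty by blast

context hyper begin

lemma E_D: "(x, y) \<in> E \<Longrightarrow> P \<in> \<P> \<Longrightarrow> P (case_sum x y)"
  unfolding E_iff by blast

lemma E_aut: "f \<in> Aut C \<Longrightarrow> (x, y) \<in> E \<Longrightarrow> (compose (fst e) f x, compose (fst e) f y) \<in> E"
  unfolding E_iff
proof (intro conjI ballI compose_in_tuples)
  fix P assume f: "f \<in> Aut C" and P: "P \<in> \<P>"
    and *: "x \<in> tuples (fst e) \<and> y \<in> tuples (fst e) \<and> (\<forall>P\<in>\<P>. P (case_sum x y))"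
  have "P (case_sum (compose (fst e) f x) (compose (fst e) f y)) = P (\<lambda>v. f (case_sum x y v))"
    by (rule definable_cong[OF def[OF P]]) (auto simp: compose_apply)
  also have "\<dots> = P (case_sum x y)" by (rule definable_fix[OF f def[OF P]]) simp
  finally show "P (case_sum (compose (fst e) f x) (compose (fst e) f y))"
    using bspec[OF conjunct2[OF conjunct2[OF *]] P] by simp
qed

lemma hyp_image_rep: assumes f: "f \<in> Aut C" shows "hyp_image f e = (fst e, E `` {compose (fst e) f a})"
proof -
  have "compose (fst e) f ` (E `` {a}) = E `` {compose (fst e) f a}"
  proof
    show "compose (fst e) f ` (E `` {a}) \<subseteq> E `` {compose (fst e) f a}" using E_aut[OF f] by auto
    show "E `` {compose (fst e) f a} \<subseteq> compose (fst e) f ` (E `` {a})"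
    proof
      fix y assume y: "y \<in> E `` {compose (fst e) f a}"
      let ?g = "inv_into UNIV f"
      have yt: "y \<in> tuples (fst e)" using y E_iff by auto
      have "(compose (fst e) ?g (compose (fst e) f a), compose (fst e) ?g y) \<in> E"
        using E_aut[OF Aut_inv[OF f]] y by blast
      then have "(a, compose (fst e) ?g y) \<in> E"
        by (simp add: compose_compose Aut_inv_simps[OF f] compose_id rep)
      moreover have "y = compose (fst e) f (compose (fst e) ?g y)"
        by (simp add: compose_compose Aut_inv_simps[OF f] compose_id yt)
      ultimately show "y \<in> compose (fst e) f ` (E `` {a})" by blast
    qed
  qed
  then show ?thesis by (simp add: hyp_image_def rep)
qed

lemma hyp_image_eq_iff:
  assumes "f \<in> Aut C" "g \<in> Aut C"
  shows "hyp_image f e = hyp_image g e \<longleftrightarrow> (compose (fst e) f a, compose (fst e) g a) \<in> E"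
  unfolding hyp_image_rep[OF assms(1)] hyp_image_rep[OF assms(2)]
  using eq_equiv_class_iff[OF eqv compose_in_tuples compose_in_tuples] by simp

lemma hyp_image_id: "hyp_image (\<lambda>x. x) e = e"
  using rep by (simp add: hyp_image_rep[OF Aut_id] compose_id prod_eq_iff)

lemma hyp_image_fixes_iff:
  "f \<in> Aut C \<Longrightarrow> hyp_image f e = e \<longleftrightarrow> (a, compose (fst e) f a) \<in> E"
  using hyp_image_eq_iff[OF Aut_id, of f] rep(1) by (auto simp: hyp_image_id compose_id)

lemma hyp_image_fixed_rep:
  assumes "f \<in> Aut C" "\<And>i. i \<in> fst e \<Longrightarrow> f (a i) = a i" shows "hyp_image f e = e"
proof -
  have "compose (fst e) f a = a" using assms(2) by (intro compose_fixed rep)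
  then show ?thesis
    using rep equiv_class_self[OF eqv] by (auto simp: hyp_image_fixes_iff[OF assms(1)])
qed

lemma in_dcl_rep: "a ` fst e \<subseteq> M \<Longrightarrow> in_dcl C e M"
  unfolding in_dcl_def by (blast intro: hyp_image_fixed_rep)

lemma Aut_over_id: "(\<lambda>x. x) \<in> Aut_over C e"
  by (simp add: Aut_over_def Aut_id hyp_image_id)

lemma Aut_over_comp: "f \<in> Aut_over C e \<Longrightarrow> g \<in> Aut_over C e \<Longrightarrow> (\<lambda>x. f (g x)) \<in> Aut_over C e"
  unfolding Aut_over_def by (auto simp: Aut_comp hyp_image_comp[symmetric])

lemma Aut_over_inv: "f \<in> Aut_over C e \<Longrightarrow> inv_into UNIV f \<in> Aut_over C e"
proof -
  assume "f \<in> Aut_over C e"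
  then have f: "f \<in> Aut C" "hyp_image f e = e" by (auto simp: Aut_over_def)
  have "hyp_image (inv_into UNIV f) (hyp_image f e) = e"
    unfolding hyp_image_comp Aut_inv_simps[OF f(1)] by (rule hyp_image_id)
  with f show ?thesis by (auto simp: Aut_over_def Aut_inv)
qed

lemma Aut_over_Aut: "f \<in> Aut_over C e \<Longrightarrow> f \<in> Aut C"
  by (simp add: Aut_over_def)

text \<open>
  If every formula of \<open>tp(d/b)\<close> is satisfied by some \<open>f(b)\<close> with \<open>E(a, f(a))\<close>, then by
  compactness there are \<open>z, y\<close> with \<open>y \<equiv>\<^sub>b d\<close>, \<open>zy \<equiv> ab\<close> and \<open>E(a, z)\<close>.  By homogeneity
  \<open>y = u(d)\<close> and \<open>zy = g(ab)\<close>.  So the types over \<open>b\<close> of the tuples \<open>f(b)\<close>, where \<open>f\<close> fixes the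
  hyperimaginary, form a closed set.
\<close>

lemma closed_orbit:
  fixes b d :: "'j \<Rightarrow> 'a"
  assumes J: "small C J"
    and H: "\<And>P. definable C J (b ` J) P \<Longrightarrow> P d \<Longrightarrow>
      \<exists>f\<in>Aut C. hyp_image f e = e \<and> P (\<lambda>j. f (b j))"
  obtains u g where "u \<in> Aut C" "\<And>j. j \<in> J \<Longrightarrow> u (b j) = b j"
    "g \<in> Aut C" "hyp_image g e = e" "\<And>j. j \<in> J \<Longrightarrow> u (d j) = g (b j)"
proof -
  let ?I = "fst e"
  let ?A = "a ` ?I \<union> b ` J"
  let ?R = "\<lambda>(P :: ('j \<Rightarrow> 'a) \<Rightarrow> bool) (h :: 'i + 'j \<Rightarrow> 'a). P (\<lambda>j. h (Inr j))"
  let ?S = "\<lambda>(P :: ('i + 'i \<Rightarrow> 'a) \<Rightarrow> bool) (h :: 'i + 'j \<Rightarrow> 'a). P (case_sum a (\<lambda>i. h (Inl i)))"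
  let ?P1 = "?R ` {P. definable C J (b ` J) P \<and> P d}"
  let ?P2 = "{P. definable C (?I <+> J) {} P \<and> P (case_sum a b)}"
  let ?P3 = "?S ` \<P>"
  have sA: "small C ?A" by (intro small_Un small_image small_index J)
  have sI: "small C (?I <+> J)" by (intro small_Plus small_index J)
  have "\<exists>h. \<forall>P\<in>?P1 \<union> ?P2 \<union> ?P3. P h"
  proof (rule saturation[OF sI sA])
    fix P assume "P \<in> ?P1 \<union> ?P2 \<union> ?P3"
    then consider Q where "definable C J (b ` J) Q" "P = ?R Q" | "definable C (?I <+> J) {} P"
      | Q where "Q \<in> \<P>" "P = ?S Q" by blast
    then show "definable C (?I <+> J) ?A P"
    proof cases
      case 1
      have "definable C (?I <+> J) (b ` J) P"
        unfolding 1(2) by (rule definable_rename[OF 1(1)]) auto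
      then show ?thesis by (rule definable_mono) auto
    next
      case 2
      then show ?thesis by (rule definable_mono) auto
    next
      case 3
      have "definable C (?I <+> J) ?A (\<lambda>h. Q (\<lambda>v. case_sum h id (case_sum (\<lambda>i. Inr (a i)) (\<lambda>i. Inl (Inl i)) v)))"
        by (rule definable_subst[OF def[OF 3(1)]]) auto
      moreover have "(\<lambda>v. case_sum h id (case_sum (\<lambda>i. Inr (a i)) (\<lambda>i. Inl (Inl i)) v)) = case_sum a (\<lambda>i. h (Inl i))"
        for h :: "'i + 'j \<Rightarrow> 'a" by (auto split: sum.split)
      ultimately show ?thesis unfolding 3(2) by simp
    qed
  next
    fix \<Q> assume Q: "finite \<Q>" "\<Q> \<subseteq> ?P1 \<union> ?P2 \<union> ?P3"
    have "\<exists>Y \<subseteq> {P. definable C J (b ` J) P \<and> P d}. finite Y \<and> \<Q> \<inter> ?P1 = ?R ` Y"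
      by (rule finite_subset_image) (use Q in auto)
    then obtain Y where Y: "Y \<subseteq> {P. definable C J (b ` J) P \<and> P d}" "finite Y" "\<Q> \<inter> ?P1 = ?R ` Y"
      by blast
    have "definable C J (b ` J) (\<lambda>h. \<forall>P\<in>Y. P h)"
      by (rule definable_ball[OF Y(2)]) (use Y(1) in auto)
    from H[OF this] Y(1) obtain f where f: "f \<in> Aut C" "hyp_image f e = e" "\<forall>P\<in>Y. P (\<lambda>j. f (b j))"
      by blast
    let ?h = "\<lambda>v. f (case_sum a b v)"
    have Ph: "P ?h" if "P \<in> \<Q>" for P
    proof -
      have "P \<in> ?R ` Y \<or> P \<in> ?P2 \<or> P \<in> ?P3"
        unfolding Y(3)[symmetric] using subsetD[OF Q(2) that] that by auto
      then consider "P \<in> ?R ` Y" | "P \<in> ?P2" | "P \<in> ?P3" by auto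
      then show ?thesis
      proof cases
        case 1
        then show ?thesis using f(3) by auto
      next
        case 2
        then show ?thesis using definable_fix[OF f(1), of "?I <+> J" "{}" P "case_sum a b"] by simp
      next
        case 3
        then obtain Q where 3: "Q \<in> \<P>" "P = ?S Q" by (elim imageE)
        have "Q (case_sum a (compose ?I f a))"
          using E_D[of a "compose ?I f a", OF _ 3(1)] f by (simp add: hyp_image_fixes_iff)
        moreover have "Q (case_sum a (compose ?I f a)) = Q (case_sum a (\<lambda>i. f (a i)))"
          by (rule definable_cong[OF def[OF 3(1)]]) (auto simp: compose_apply)
        ultimately show ?thesis using 3(2) by simp
      qed
    qed
    have "\<forall>P\<in>\<Q>. P ?h" by (rule ballI) (rule Ph)
    then show "\<exists>h. \<forall>P\<in>\<Q>. P h" by (rule exI[of "\<lambda>h. \<forall>P\<in>\<Q>. P h"])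
  qed
  then obtain h where h0: "\<forall>P\<in>?P1 \<union> ?P2 \<union> ?P3. P h" by (elim exE)
  have h1: "P (\<lambda>j. h (Inr j))" if "definable C J (b ` J) P" "P d" for P
  proof -
    have "?R P \<in> ?P1 \<union> ?P2 \<union> ?P3" using that by simp
    from bspec[OF h0 this] show ?thesis .
  qed
  have h2: "P h" if "definable C (?I <+> J) {} P" "P (case_sum a b)" for P
    by (rule bspec[OF h0]) (use that in simp)
  have h3: "P (case_sum a (\<lambda>i. h (Inl i)))" if "P \<in> \<P>" for P
  proof -
    have "?S P \<in> ?P1 \<union> ?P2 \<union> ?P3" using that by simp
    from bspec[OF h0 this] show ?thesis .
  qed
  have "P (case_sum a b) = P h" if P: "definable C (?I <+> J) {} P" for P
    using h2[OF P] h2[OF definable_Not[OF P]] by auto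
  then obtain g where g: "g \<in> Aut C" "\<And>v. v \<in> ?I <+> J \<Longrightarrow> g (case_sum a b v) = h v"
    using homogeneity[OF sI small_finite[OF finite.emptyI], of "case_sum a b" h] by blast
  have g1: "g (a i) = h (Inl i)" if "i \<in> ?I" for i using g(2)[of "Inl i"] that by auto
  have g2: "g (b j) = h (Inr j)" if "j \<in> J" for j using g(2)[of "Inr j"] that by auto
  have "(a, compose ?I g a) \<in> E"
    unfolding E_iff
  proof (intro conjI rep compose_in_tuples ballI)
    fix P assume P: "P \<in> \<P>"
    have "P (case_sum a (compose ?I g a)) = P (case_sum a (\<lambda>i. h (Inl i)))"
      by (rule definable_cong[OF def[OF P]]) (auto simp: compose_apply g1)
    then show "P (case_sum a (compose ?I g a))" using h3[OF P] by simp
  qed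
  then have ge: "hyp_image g e = e" using hyp_image_fixes_iff[OF g(1)] by simp
  have "P d = P (\<lambda>j. h (Inr j))" if P: "definable C J (b ` J) P" for P
    using h1[OF P] h1[OF definable_Not[OF P]] by auto
  then obtain u where u: "u \<in> Aut C" "\<And>x. x \<in> b ` J \<Longrightarrow> u x = x" "\<And>j. j \<in> J \<Longrightarrow> u (d j) = h (Inr j)"
    using homogeneity[OF J small_image[OF J, of b], of d "\<lambda>j. h (Inr j)"] by blast
  show ?thesis by (rule that[OF u(1) _ g(1) ge]) (use u g2 in auto)
qed

end

section \<open>The group of Lascar strong automorphisms\<close>

text \<open>
  The type of a tuple as a set of predicates.  The sets \<open>tp\<close> consist of formulas, which may bind
  any variable; there are only few sets \<open>dtype\<close>.
\<close>

definition dtype :: "('f, 'r, 'a, 'z) fo_structure_scheme \<Rightarrow> 'v set \<Rightarrow> 'a set \<Rightarrow> ('v \<Rightarrow> 'a) \<Rightarrow> (('v \<Rightarrow> 'a) \<Rightarrow> bool) set" where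
  "dtype C V A c = {P. definable C V A P \<and> P c}"

lemma dtypeD: "dtype C V A c = dtype C V A d \<Longrightarrow> definable C V A P \<Longrightarrow> P c = P d"
  unfolding dtype_def by blast

lemma (in monster) small_dtypes: "small C V \<Longrightarrow> small C A \<Longrightarrow> small C (dtype C V A ` X)"
  by (rule small_subset[OF _ small_Pow[OF small_definable]]) (auto simp: dtype_def)

text \<open>
  Homogeneity over \<open>M\<close> gives \<open>u\<close> with \<open>u(g(m)) = f(m)\<close> for \<open>m \<in> M\<close>; the rest of \<open>f\<close> is \<open>v\<close>.
\<close>

lemma (in monster) same_dtype_conj:
  assumes M: "small C M" and f: "f \<in> Aut C" and g: "g \<in> Aut C"
    and eq: "dtype C M M f = dtype C M M g"
  obtains u v where "u \<in> Aut C" "\<And>m. m \<in> M \<Longrightarrow> u m = m" "v \<in> Aut C" "\<And>m. m \<in> M \<Longrightarrow> v m = m"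
    "f = (\<lambda>x. u (g (v x)))"
proof -
  have "P g = P f" if "definable C M M P" for P
    using dtypeD[OF eq that] by simp
  then obtain u where u: "u \<in> Aut C" "\<And>m. m \<in> M \<Longrightarrow> u m = m" "\<And>m. m \<in> M \<Longrightarrow> u (g m) = f m"
    using homogeneity[OF M M, of g f] by blast
  let ?v = "\<lambda>x. inv_into UNIV g (inv_into UNIV u (f x))"
  have "?v \<in> Aut C" by (rule Aut_comp[OF Aut_inv[OF g] Aut_comp[OF Aut_inv[OF u(1)] f]])
  moreover have "?v m = m" if "m \<in> M" for m
    using u(3)[OF that] by (metis Aut_inv_simps(2) g u(1))
  moreover have "f = (\<lambda>x. u (g (?v x)))" using Aut_inv_simps(1)[OF g] Aut_inv_simps(1)[OF u(1)] by simp
  ultimately show ?thesis using that u by blast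
qed

context hyper begin

lemma Aut_over_Bij: "f \<in> Aut_over C e \<Longrightarrow> f \<in> Bij UNIV"
  using Aut_bij[of f C] by (simp add: Aut_over_def Bij_def extensional_def)

lemma Aut_group_simps:
  "carrier (Aut_group C e) = Aut_over C e" "\<one>\<^bsub>Aut_group C e\<^esub> = (\<lambda>x. x)"
  "f \<in> Aut_over C e \<Longrightarrow> g \<in> Aut_over C e \<Longrightarrow> f \<otimes>\<^bsub>Aut_group C e\<^esub> g = (\<lambda>x. f (g x))"
  using Aut_over_Bij by (auto simp: Aut_group_def BijGroup_def compose_def restrict_def)

lemma group_Aut_group: "group (Aut_group C e)"
proof (rule groupI)
  fix f assume "f \<in> carrier (Aut_group C e)"
  then have f: "f \<in> Aut_over C e" by (simp add: Aut_group_simps)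
  have "inv_into UNIV f \<otimes>\<^bsub>Aut_group C e\<^esub> f = \<one>\<^bsub>Aut_group C e\<^esub>"
    using f Aut_over_inv[OF f] by (simp add: Aut_group_simps Aut_inv_simps[OF Aut_over_Aut])
  then show "\<exists>g\<in>carrier (Aut_group C e). g \<otimes>\<^bsub>Aut_group C e\<^esub> f = \<one>\<^bsub>Aut_group C e\<^esub>"
    using Aut_over_inv[OF f] Aut_group_simps(1) by blast
qed (auto simp: Aut_group_simps Aut_over_id Aut_over_comp)

lemma Aut_group_inv: "f \<in> Aut_over C e \<Longrightarrow> inv\<^bsub>Aut_group C e\<^esub> f = inv_into UNIV f"
  by (rule group.inv_equality[OF group_Aut_group])
    (simp_all add: Aut_group_simps Aut_over_inv Aut_inv_simps[OF Aut_over_Aut])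

definition fixes_model :: "('a \<Rightarrow> 'a) \<Rightarrow> bool" where
  "fixes_model f \<longleftrightarrow> f \<in> Aut C \<and>
    (\<exists>M. elementary_submodel C M \<and> small C M \<and> in_dcl C e M \<and> (\<forall>m\<in>M. f m = m))"

lemma fixes_modelI:
  "f \<in> Aut C \<Longrightarrow> elementary_submodel C M \<Longrightarrow> small C M \<Longrightarrow> in_dcl C e M \<Longrightarrow> (\<And>m. m \<in> M \<Longrightarrow> f m = m)
    \<Longrightarrow> fixes_model f"
  unfolding fixes_model_def by blast

lemma fixes_model_Aut_over: "fixes_model f \<Longrightarrow> f \<in> Aut_over C e"
  unfolding fixes_model_def in_dcl_def Aut_over_def by blast

lemma Autf_L_eq: "Autf_L C e = generate (Aut_group C e) {f. fixes_model f}"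
proof -
  have "{f \<in> Aut_over C e. \<exists>M. elementary_submodel C M \<and> small C M \<and> in_dcl C e M \<and> (\<forall>m\<in>M. f m = m)}
    = {f. fixes_model f}"
    using fixes_model_Aut_over Aut_over_Aut unfolding fixes_model_def by blast
  then show ?thesis by (simp add: Autf_L_def)
qed

lemma fixes_model_Autf: "fixes_model f \<Longrightarrow> f \<in> Autf_L C e"
  unfolding Autf_L_eq by (rule generate.incl) simp

lemma fixes_model_inv: "fixes_model f \<Longrightarrow> fixes_model (inv_into UNIV f)"
  unfolding fixes_model_def using Aut_inv by (metis Aut_inv_simps(2))

lemma fixes_models_subset: "{f. fixes_model f} \<subseteq> carrier (Aut_group C e)"
  using fixes_model_Aut_over by (auto simp: Aut_group_simps)

lemma Autf_Aut_over: "f \<in> Autf_L C e \<Longrightarrow> f \<in> Aut_over C e"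
  using group.generate_in_carrier[OF group_Aut_group fixes_models_subset, of f]
  by (simp add: Aut_group_simps Autf_L_eq)

lemma Autf_comp: "f \<in> Autf_L C e \<Longrightarrow> g \<in> Autf_L C e \<Longrightarrow> (\<lambda>x. f (g x)) \<in> Autf_L C e"
  using generate.eng[of f "Aut_group C e" "{f. fixes_model f}" g] Autf_Aut_over[of f] Autf_Aut_over[of g]
  by (simp add: Autf_L_eq Aut_group_simps)

lemma Autf_inv: "f \<in> Autf_L C e \<Longrightarrow> inv_into UNIV f \<in> Autf_L C e"
  using group.generate_m_inv_closed[OF group_Aut_group fixes_models_subset, of f] Autf_Aut_over[of f]
  by (simp add: Autf_L_eq Aut_group_inv)

lemma Autf_id: "(\<lambda>x. x) \<in> Autf_L C e"
  using generate.one[of "Aut_group C e" "{f. fixes_model f}"] by (simp add: Autf_L_eq Aut_group_simps)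

lemma Autf_induct [consumes 1, case_names id gen comp]:
  assumes "f \<in> Autf_L C e" "P (\<lambda>x. x)" "\<And>f. fixes_model f \<Longrightarrow> P f"
    "\<And>f g. f \<in> Autf_L C e \<Longrightarrow> g \<in> Autf_L C e \<Longrightarrow> P f \<Longrightarrow> P g \<Longrightarrow> P (\<lambda>x. f (g x))"
  shows "P f"
  using assms(1) unfolding Autf_L_eq
proof (induction rule: generate.induct)
  case one
  then show ?case using assms(2) by (simp add: Aut_group_simps)
next
  case (incl h)
  then show ?case using assms(3) by simp
next
  case (inv h)
  then show ?case using assms(3) fixes_model_inv by (simp add: Aut_group_inv fixes_model_Aut_over)
next
  case (eng h1 h2)
  then have "h1 \<in> Autf_L C e" "h2 \<in> Autf_L C e" by (simp_all add: Autf_L_eq)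
  then show ?case using assms(4) eng.IH by (simp add: Aut_group_simps Autf_Aut_over)
qed

text \<open>A conjugate of an automorphism fixing a model \<open>M\<close> fixes the image of \<open>M\<close>.\<close>

lemma Autf_conj:
  assumes f: "f \<in> Autf_L C e" and g: "g \<in> Aut_over C e"
  shows "(\<lambda>x. g (f (inv_into UNIV g x))) \<in> Autf_L C e"
  using f
proof (induction rule: Autf_induct)
  case id
  then show ?case using Autf_id by (simp add: Aut_inv_simps[OF Aut_over_Aut[OF g]])
next
  case (gen f)
  note gA = Aut_over_Aut[OF g]
  let ?gi = "inv_into UNIV g"
  obtain M where M: "f \<in> Aut C" "elementary_submodel C M" "small C M" "in_dcl C e M" "\<And>m. m \<in> M \<Longrightarrow> f m = m"
    using gen unfolding fixes_model_def by blast
  have "in_dcl C e (g ` M)"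
    unfolding in_dcl_def
  proof (intro ballI impI)
    fix h assume h: "h \<in> Aut C" "\<forall>x\<in>g ` M. h x = x"
    have "(\<lambda>x. ?gi (h (g x))) \<in> Aut C"
      by (rule Aut_comp[OF Aut_inv[OF gA] Aut_comp[OF h(1) gA]])
    moreover have "\<forall>m\<in>M. ?gi (h (g m)) = m" using h(2) by (simp add: Aut_inv_simps[OF gA])
    ultimately have 1: "(\<lambda>x. ?gi (h (g x))) \<in> Aut_over C e"
      using M(4)[unfolded in_dcl_def, rule_format, of "\<lambda>x. ?gi (h (g x))"] by (simp add: Aut_over_def)
    have "(\<lambda>x. g (?gi (h (g (?gi x))))) \<in> Aut_over C e"
      using Aut_over_comp[OF Aut_over_comp[OF g 1] Aut_over_inv[OF g]] .
    then show "hyp_image h e = e" by (simp add: Aut_inv_simps[OF gA] Aut_over_def)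
  qed
  moreover have "(\<lambda>x. g (f (?gi x))) \<in> Aut C"
    by (rule Aut_comp[OF gA Aut_comp[OF M(1) Aut_inv[OF gA]]])
  ultimately have "fixes_model (\<lambda>x. g (f (?gi x)))"
    using elementary_submodel_aut[OF gA M(2)] small_image[OF M(3), of g] M(5)
    by (intro fixes_modelI[of _ "g ` M"]) (auto simp: Aut_inv_simps[OF gA])
  then show ?case by (rule fixes_model_Autf)
next
  case (comp f h)
  have "(\<lambda>x. g (f (inv_into UNIV g (g (h (inv_into UNIV g x)))))) \<in> Autf_L C e"
    by (rule Autf_comp[OF comp.IH])
  then show ?case by (simp only: Aut_inv_simps(2)[OF Aut_over_Aut[OF g]])
qed

lemma model_exists:
  obtains M where "elementary_submodel C M" "small C M" "in_dcl C e M"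
proof -
  obtain M where M: "a ` fst e \<subseteq> M" "small C M" "elementary_submodel C M"
    by (rule Loewenheim_Skolem[OF small_image[OF small_index, of a]])
  show ?thesis by (rule that[OF M(3,2) in_dcl_rep[OF M(1)]])
qed

text \<open>
  If \<open>e'\<close> is fixed by \<open>Autf\<^sub>L(C, e)\<close>, then the image of \<open>e'\<close> under \<open>f\<close> depends only on the type
  of \<open>f(M)\<close> over a model \<open>M\<close> with \<open>e \<in> dcl(M)\<close>, and there are few such types.
\<close>

lemma bounded_if_Autf_fixed:
  assumes fixed: "\<And>f. f \<in> Autf_L C e \<Longrightarrow> hyp_image f e' = e'"
  shows "bounded_over C e' e"
proof -
  obtain M where M: "elementary_submodel C M" "small C M" "in_dcl C e M" by (rule model_exists)
  let ?t = "dtype C M M" and ?G = "Aut_over C e"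
  have eq: "hyp_image f e' = hyp_image g e'" if f: "f \<in> ?G" and g: "g \<in> ?G" and eq: "?t f = ?t g" for f g
  proof -
    obtain u v where uv: "u \<in> Aut C" "\<And>m. m \<in> M \<Longrightarrow> u m = m" "v \<in> Aut C" "\<And>m. m \<in> M \<Longrightarrow> v m = m"
      "f = (\<lambda>x. u (g (v x)))"
      using same_dtype_conj[OF M(2) Aut_over_Aut[OF f] Aut_over_Aut[OF g] eq] by blast
    have u: "u \<in> Autf_L C e" and v: "v \<in> Autf_L C e"
      using uv M by (auto intro!: fixes_model_Autf fixes_modelI)
    let ?gi = "inv_into UNIV g"
    have gi: "(\<lambda>x. ?gi (u (g x))) \<in> Autf_L C e"
      using Autf_conj[OF u Aut_over_inv[OF g]] by (simp add: Aut_inv_simps[OF Aut_over_Aut[OF g]])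
    have "hyp_image f e' = hyp_image u (hyp_image g (hyp_image v e'))"
      by (simp add: uv(5) hyp_image_comp)
    also have "\<dots> = hyp_image g (hyp_image (\<lambda>x. ?gi (u (g x))) e')"
      by (simp add: fixed[OF v] hyp_image_comp Aut_inv_simps[OF Aut_over_Aut[OF g]])
    finally show ?thesis by (simp add: fixed[OF gi])
  qed
  let ?s = "\<lambda>p. hyp_image (SOME g. g \<in> ?G \<and> ?t g = p) e'"
  have "(\<lambda>f. hyp_image f e') ` ?G \<subseteq> ?s ` ?t ` ?G"
  proof
    fix y assume "y \<in> (\<lambda>f. hyp_image f e') ` ?G"
    then obtain f where f: "f \<in> ?G" "y = hyp_image f e'" by blast
    have "(SOME g. g \<in> ?G \<and> ?t g = ?t f) \<in> ?G \<and> ?t (SOME g. g \<in> ?G \<and> ?t g = ?t f) = ?t f"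
      by (rule someI[of "\<lambda>g. g \<in> ?G \<and> ?t g = ?t f" f]) (use f in simp)
    then have "?s (?t f) = y" using eq[of "SOME g. g \<in> ?G \<and> ?t g = ?t f" f] f by simp
    then show "y \<in> ?s ` ?t ` ?G" using f(1) by blast
  qed
  then show ?thesis
    unfolding bounded_over_def
    by (rule small_subset) (intro small_image small_dtypes M(2))
qed

end

section \<open>Bounded hyperimaginaries\<close>

text \<open>Transitivity of \<open>E\<close> survives, by compactness, in a symmetric finite part of its definition.\<close>

lemma (in hyper) weak_transitivity:
  assumes \<psi>: "\<psi> \<in> \<P>"
  obtains \<theta> V where "definable C (fst e <+> fst e) {} (\<lambda>h. \<theta> (\<lambda>i. h (Inl i)) (\<lambda>i. h (Inr i)))"
    "finite V" "V \<subseteq> fst e"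
    "\<forall>x y x' y'. (\<forall>i\<in>V. x i = x' i \<and> y i = y' i) \<longrightarrow> \<theta> x y = \<theta> x' y'"
    "\<forall>x y. \<theta> x y = \<theta> y x" "\<forall>x y. (x, y) \<in> E \<longrightarrow> \<theta> x y"
    "\<forall>x y z. \<theta> x y \<longrightarrow> \<theta> x z \<longrightarrow> \<psi> (case_sum y z)"
proof -
  let ?I = "fst e"
  let ?at = "\<lambda>P m n (h :: 'i \<times> nat \<Rightarrow> 'a). P (case_sum (\<lambda>i. h (i, m)) (\<lambda>i. h (i, n)))"
  have at: "definable C (?I \<times> UNIV) {} (?at P m n)" if "P \<in> \<P>" for P m n
  proof -
    have "definable C (?I \<times> UNIV) {} (\<lambda>h. P (\<lambda>v. h (case_sum (\<lambda>i. (i, m)) (\<lambda>i. (i, n)) v)))"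
      by (rule definable_rename[OF def[OF that]]) auto
    moreover have "(\<lambda>v. h (case_sum (\<lambda>i. (i, m)) (\<lambda>i. (i, n)) v)) = case_sum (\<lambda>i. h (i, m)) (\<lambda>i. h (i, n))"
      for h :: "'i \<times> nat \<Rightarrow> 'a" by (auto split: sum.split)
    ultimately show ?thesis by simp
  qed
  define \<theta>0 where "\<theta>0 F x y \<longleftrightarrow> (\<forall>P\<in>F. P (case_sum x y) \<and> P (case_sum y x))"
    for F :: "(('i + 'i \<Rightarrow> 'a) \<Rightarrow> bool) set" and x y
  have "\<exists>F. finite F \<and> F \<subseteq> \<P> \<and> (\<forall>x y z. \<theta>0 F x y \<longrightarrow> \<theta>0 F x z \<longrightarrow> \<psi> (case_sum y z))"
  proof (rule ccontr)
    assume no: "\<not> ?thesis"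
    define R where "R P h \<longleftrightarrow> (?at P 0 1 h \<and> ?at P 1 0 h) \<and> (?at P 0 2 h \<and> ?at P 2 0 h)"
      for P and h :: "'i \<times> nat \<Rightarrow> 'a"
    define N where "N h \<longleftrightarrow> \<not> ?at \<psi> 1 2 h" for h
    have "\<exists>h. \<forall>P\<in>insert N (R ` \<P>). P h"
    proof (rule saturation)
      show "small C (?I \<times> (UNIV :: nat set))" by (rule small_Times[OF small_index small_nat])
      show "small C ({} :: 'a set)" by (rule small_finite) simp
      fix P assume "P \<in> insert N (R ` \<P>)"
      then consider "P = N" | Q where "Q \<in> \<P>" "P = R Q" by auto
      then show "definable C (?I \<times> UNIV) {} P"
      proof cases
        case 1
        then show ?thesis unfolding N_def[abs_def] by (simp only:) (rule definable_Not[OF at[OF \<psi>]])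
      next
        case 2
        show ?thesis unfolding 2(2) R_def[abs_def] by (intro definable_conj at[OF 2(1)])
      qed
    next
      fix \<Q> assume Q: "finite \<Q>" "\<Q> \<subseteq> insert N (R ` \<P>)"
      have "\<exists>F\<subseteq>\<P>. finite F \<and> \<Q> - {N} = R ` F"
        by (rule finite_subset_image) (use Q in auto)
      then obtain F where F: "F \<subseteq> \<P>" "finite F" "\<Q> - {N} = R ` F" by blast
      then obtain x y z where xyz: "\<theta>0 F x y" "\<theta>0 F x z" "\<not> \<psi> (case_sum y z)" using no by blast
      let ?h = "\<lambda>(i, n :: nat). if n = 0 then x i else if n = 1 then y i else z i"
      have "R P ?h" if "P \<in> F" for P
        using bspec[OF xyz(1)[unfolded \<theta>0_def] that] bspec[OF xyz(2)[unfolded \<theta>0_def] that]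
        by (simp add: R_def)
      moreover have "N ?h" using xyz(3) by (simp add: N_def)
      ultimately have "P ?h" if "P \<in> \<Q>" for P
      proof (cases "P = N")
        case False
        then have "P \<in> R ` F" unfolding F(3)[symmetric] using that by simp
        then obtain P' where "P' \<in> F" "P = R P'" by (elim imageE)
        then show ?thesis using \<open>\<And>P. P \<in> F \<Longrightarrow> R P ?h\<close> by simp
      qed simp
      then have "\<forall>P\<in>\<Q>. P ?h" by (intro ballI)
      then show "\<exists>h. \<forall>P\<in>\<Q>. P h" by (rule exI[of "\<lambda>h. \<forall>P\<in>\<Q>. P h"])
    qed
    then obtain h where h: "\<forall>P\<in>insert N (R ` \<P>). P h" by (elim exE)
    let ?x = "\<lambda>n. \<lambda>i\<in>?I. h (i, n)"
    have xh: "P (case_sum (?x m) (?x n)) = ?at P m n h" if "P \<in> \<P>" for P m n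
      by (rule definable_cong[OF def[OF that]]) auto
    have Rh: "R P h" if "P \<in> \<P>" for P
      using bspec[OF h, of "R P"] that by simp
    have "N h" using bspec[OF h, of N] by simp
    have "(?x 0, ?x 1) \<in> E" "(?x 0, ?x 2) \<in> E"
      unfolding E_iff using Rh by (auto simp: tuples_def xh R_def)
    then have "(?x 1, ?x 2) \<in> E" using eqv by (meson equivE symD transD)
    from E_D[OF this \<psi>] \<open>N h\<close> show False by (simp add: xh[OF \<psi>] N_def)
  qed
  then obtain F where F: "finite F" "F \<subseteq> \<P>"
    and \<psi>F: "\<And>x y z. \<theta>0 F x y \<Longrightarrow> \<theta>0 F x z \<Longrightarrow> \<psi> (case_sum y z)" by blast
  let ?T = "\<lambda>h. \<theta>0 F (\<lambda>i. h (Inl i)) (\<lambda>i. h (Inr i))"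
  have def1: "definable C (?I <+> ?I) {} (\<lambda>h. P (case_sum (\<lambda>i. h (Inl i)) (\<lambda>i. h (Inr i)))
      \<and> P (case_sum (\<lambda>i. h (Inr i)) (\<lambda>i. h (Inl i))))" if "P \<in> \<P>" for P
  proof (rule definable_conj)
    have *: "case_sum (\<lambda>i. h (Inl i)) (\<lambda>i. h (Inr i)) = h" for h :: "'i + 'i \<Rightarrow> 'a"
      by (auto split: sum.split)
    show "definable C (?I <+> ?I) {} (\<lambda>h. P (case_sum (\<lambda>i. h (Inl i)) (\<lambda>i. h (Inr i))))"
      unfolding * by (rule def[OF that])
    have "definable C (?I <+> ?I) {} (\<lambda>h. P (\<lambda>v. h (case_sum Inr Inl v)))"
      by (rule definable_rename[OF def[OF that]]) auto
    moreover have "(\<lambda>v. h (case_sum Inr Inl v)) = case_sum (\<lambda>i. h (Inr i)) (\<lambda>i. h (Inl i))"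
      for h :: "'i + 'i \<Rightarrow> 'a" by (auto split: sum.split)
    ultimately show "definable C (?I <+> ?I) {} (\<lambda>h. P (case_sum (\<lambda>i. h (Inr i)) (\<lambda>i. h (Inl i))))"
      by simp
  qed
  have def: "definable C (?I <+> ?I) {} ?T"
    unfolding \<theta>0_def by (rule definable_ball[OF F(1) def1]) (use F(2) in blast)
  then obtain V0 A0 where V0: "finite V0" "V0 \<subseteq> ?I <+> ?I" "definable C V0 A0 ?T"
    by (rule definable_finite_support)
  let ?V = "Inl -` V0 \<union> Inr -` V0"
  show ?thesis
  proof (rule that[OF def])
    show "finite ?V" using V0(1) by (simp add: finite_vimageI)
    show "?V \<subseteq> ?I" using V0(2) by auto
    show "\<forall>x y x' y'. (\<forall>i\<in>?V. x i = x' i \<and> y i = y' i) \<longrightarrow> \<theta>0 F x y = \<theta>0 F x' y'"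
    proof (intro allI impI)
      fix x y x' y' :: "'i \<Rightarrow> 'a" assume xy: "\<forall>i\<in>?V. x i = x' i \<and> y i = y' i"
      have "?T (case_sum x y) = ?T (case_sum x' y')"
        by (rule definable_cong[OF V0(3)]) (use xy in \<open>auto split: sum.split\<close>)
      then show "\<theta>0 F x y = \<theta>0 F x' y'" by simp
    qed
    show "\<forall>x y. \<theta>0 F x y = \<theta>0 F y x" unfolding \<theta>0_def by blast
    show "\<forall>x y. (x, y) \<in> E \<longrightarrow> \<theta>0 F x y"
    proof (intro allI impI)
      fix x y assume xy: "(x, y) \<in> E"
      have yx: "(y, x) \<in> E" using xy eqv by (meson equivE symD)
      show "\<theta>0 F x y"
        unfolding \<theta>0_def
      proof
        fix P assume "P \<in> F"
        then have "P \<in> \<P>" using F(2) by blast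
        then show "P (case_sum x y) \<and> P (case_sum y x)" using E_D[OF xy, of P] E_D[OF yx, of P] by simp
      qed
    qed
    show "\<forall>x y z. \<theta>0 F x y \<longrightarrow> \<theta>0 F x z \<longrightarrow> \<psi> (case_sum y z)" using \<psi>F by simp
  qed
qed

text \<open>
  Let \<open>f\<close> fix the model \<open>M\<close>, and let \<open>\<theta>\<close> be a weakly transitive consequence of \<open>E'\<close>.  If there
  were arbitrarily long sequences of pairwise \<open>\<not>\<theta>\<close> tuples in every formula of \<open>tp(a'/M)\<close>, there
  would by compactness be one that is longer than there are conjugates of \<open>e'\<close>, and consists of
  conjugates of \<open>a'\<close> over \<open>M\<close>.  So some formula of \<open>tp(a'/M)\<close> has a maximal such sequence, which is finite
  and may be taken in \<open>M\<close>.  One of its members is \<open>\<theta>\<close>-related to \<open>a'\<close>, hence also to \<open>f(a')\<close>.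
\<close>

lemma (in hyper) bounded_fixed_by_model_fixing:
  fixes e' :: "('j, 'a) hyp"
  assumes e': "hyper C e' E' \<P>' a'" and bd: "bounded_over C e' e" and f: "fixes_model f"
  shows "hyp_image f e' = e'"
proof -
  interpret e': hyper C e' E' \<P>' a' by (rule e')
  let ?I = "fst e'"
  obtain M where fA: "f \<in> Aut C" and M: "elementary_submodel C M" "small C M" "in_dcl C e M"
    and fM: "\<And>m. m \<in> M \<Longrightarrow> f m = m"
    using f unfolding fixes_model_def by blast
  have "\<psi> (case_sum a' (compose ?I f a'))" if \<psi>: "\<psi> \<in> \<P>'" for \<psi>
  proof -
    obtain \<theta> V where def: "definable C (?I <+> ?I) {} (\<lambda>h. \<theta> (\<lambda>i. h (Inl i)) (\<lambda>i. h (Inr i)))"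
      and V: "finite V" "V \<subseteq> ?I"
      and loc0: "\<forall>x y x' y'. (\<forall>i\<in>V. x i = x' i \<and> y i = y' i) \<longrightarrow> \<theta> x y = \<theta> x' y'"
      and sym0: "\<forall>x y. \<theta> x y = \<theta> y x" and E\<theta>0: "\<forall>x y. (x, y) \<in> E' \<longrightarrow> \<theta> x y"
      and \<theta>\<psi>0: "\<forall>x y z. \<theta> x y \<longrightarrow> \<theta> x z \<longrightarrow> \<psi> (case_sum y z)"
      by (rule e'.weak_transitivity[OF \<psi>])
    have loc: "\<theta> x y = \<theta> x' y'" if "\<And>i. i \<in> V \<Longrightarrow> x i = x' i \<and> y i = y' i" for x y x' y'
      using loc0[rule_format, of x x' y y'] that by simp
    have sym: "\<theta> x y = \<theta> y x" for x y by (rule sym0[rule_format])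
    have E\<theta>: "\<theta> x y" if "(x, y) \<in> E'" for x y using E\<theta>0[rule_format, OF that] .
    have \<theta>\<psi>: "\<psi> (case_sum y z)" if "\<theta> x y" "\<theta> x z" for x y z
      using \<theta>\<psi>0[rule_format, OF that] .
    have def\<theta>: "definable C (?I \<times> S) {} (\<lambda>h. \<theta> (\<lambda>i. h (i, s)) (\<lambda>i. h (i, t)))"
      if "s \<in> S" "t \<in> S" for s t and S :: "'s set"
    proof -
      have "definable C (?I \<times> S) {} (\<lambda>h. \<theta> (\<lambda>i. h (case_sum (\<lambda>i. (i, s)) (\<lambda>i. (i, t)) (Inl i)))
          (\<lambda>i. h (case_sum (\<lambda>i. (i, s)) (\<lambda>i. (i, t)) (Inr i))))"
        by (rule definable_rename[OF def]) (use that in auto)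
      then show ?thesis by simp
    qed
    have defD: "definable C (?I \<times> S) M (\<lambda>h. D (\<lambda>i. h (i, s)))"
      if "definable C ?I M D" "s \<in> S" for D s and S :: "'s set"
      by (rule definable_rename[OF that(1)]) (use that in auto)
    define seq where "seq n D h \<longleftrightarrow> (\<forall>k\<in>{..<n}. D (\<lambda>i. h (i, k))) \<and>
        (\<forall>(k, l)\<in>{(k, l). k < n \<and> l < n \<and> k \<noteq> l}. \<not> \<theta> (\<lambda>i. h (i, k)) (\<lambda>i. h (i, l)))"
      for n :: nat and D and h :: "'j \<times> nat \<Rightarrow> 'a"
    let ?D = "{D. definable C ?I M D \<and> D a'}"
    have "\<exists>n D. definable C ?I M D \<and> D a' \<and> \<not> (\<exists>h. seq n D h)"
    proof (rule ccontr)
      assume "\<not> ?thesis"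
      then have long: "\<exists>h. seq n D h" if "definable C ?I M D" "D a'" for n D
        using that by blast
      \<comment> \<open>The index set is small but larger than the set of conjugates of \<open>e'\<close>.\<close>
      let ?O = "(\<lambda>f. hyp_image f e') ` Aut_over C e"
      let ?S = "Pow ?O"
      have O: "small C ?O" using bd by (simp add: bounded_over_def)
      let ?Q1 = "\<lambda>(s, D) h. D (\<lambda>i. h (i, s))"
      let ?Q2 = "\<lambda>(s, t) h. \<not> \<theta> (\<lambda>i. h (i, s)) (\<lambda>i. h (i, t))"
      let ?X1 = "?S \<times> ?D" and ?X2 = "{(s, t). s \<in> ?S \<and> t \<in> ?S \<and> s \<noteq> t}"
      have "\<exists>h. \<forall>P\<in>?Q1 ` ?X1 \<union> ?Q2 ` ?X2. P h"
      proof (rule saturation)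
        show "small C (?I \<times> ?S)" by (intro small_Times small_Pow O e'.small_index)
        show "small C M" by (rule M(2))
        fix P assume "P \<in> ?Q1 ` ?X1 \<union> ?Q2 ` ?X2"
        then have "P \<in> ?Q1 ` ?X1 \<or> P \<in> ?Q2 ` ?X2" by simp
        then show "definable C (?I \<times> ?S) M P"
        proof
          assume "P \<in> ?Q1 ` ?X1"
          then obtain s D where "s \<in> ?S" "definable C ?I M D" "P = ?Q1 (s, D)" by auto
          then show ?thesis using defD[of D s ?S] by simp
        next
          assume "P \<in> ?Q2 ` ?X2"
          then obtain s t where st: "s \<in> ?S" "t \<in> ?S" "P = ?Q2 (s, t)" by auto
          have "definable C (?I \<times> ?S) {} P"
            using definable_Not[OF def\<theta>[OF st(1,2)]] st(3) by simp
          then show ?thesis by (rule definable_mono) auto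
        qed
      next
        fix \<Q> assume Q: "finite \<Q>" "\<Q> \<subseteq> ?Q1 ` ?X1 \<union> ?Q2 ` ?X2"
        have "\<exists>Y\<subseteq>?X1. finite Y \<and> \<Q> \<inter> ?Q1 ` ?X1 = ?Q1 ` Y"
          by (rule finite_subset_image) (use Q in auto)
        then obtain Y1 where Y1: "Y1 \<subseteq> ?X1" "finite Y1" "\<Q> \<inter> ?Q1 ` ?X1 = ?Q1 ` Y1" by (elim exE conjE)
        have "\<exists>Y\<subseteq>?X2. finite Y \<and> \<Q> \<inter> ?Q2 ` ?X2 = ?Q2 ` Y"
          by (rule finite_subset_image) (use Q in auto)
        then obtain Y2 where Y2: "Y2 \<subseteq> ?X2" "finite Y2" "\<Q> \<inter> ?Q2 ` ?X2 = ?Q2 ` Y2" by (elim exE conjE)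
        let ?T = "fst ` Y1 \<union> fst ` Y2 \<union> snd ` Y2"
        have "finite ?T" using Y1(2) Y2(2) by simp
        from finite_imp_inj_to_nat_seg[OF this]
        obtain num :: "_ \<Rightarrow> nat" and n where num: "num ` ?T = {i. i < n}" "inj_on num ?T"
          by (elim exE conjE)
        have numlt: "num s < n" if "s \<in> ?T" for s
          using imageI[OF that, of num] unfolding num(1) by simp
        have "definable C ?I M (\<lambda>x. \<forall>D\<in>snd ` Y1. D x)"
          by (rule definable_ball) (use Y1 in auto)
        moreover have "\<forall>D\<in>snd ` Y1. D a'" using Y1(1) by auto
        ultimately obtain h where h: "seq n (\<lambda>x. \<forall>D\<in>snd ` Y1. D x) h" using long by blast
        let ?h = "\<lambda>(i, s). h (i, num s)"
        have 1: "?Q1 y ?h" if y: "y \<in> Y1" for y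
        proof -
          have "\<forall>D\<in>snd ` Y1. D (\<lambda>i. h (i, num (fst y)))"
            using h numlt[of "fst y"] y unfolding seq_def by auto
          then have "(snd y) (\<lambda>i. h (i, num (fst y)))" by (rule bspec) (use y in simp)
          then show ?thesis by (simp add: case_prod_beta)
        qed
        have 2: "?Q2 y ?h" if y: "y \<in> Y2" for y
        proof -
          have "fst y \<noteq> snd y" using Y2(1) y by auto
          then have "num (fst y) \<noteq> num (snd y)"
            using inj_onD[OF num(2), of "fst y" "snd y"] y by auto
          moreover have "num (fst y) < n" "num (snd y) < n" using numlt y by auto
          ultimately have "\<not> \<theta> (\<lambda>i. h (i, num (fst y))) (\<lambda>i. h (i, num (snd y)))"
            using h unfolding seq_def by simp
          then show ?thesis by (simp add: case_prod_beta)
        qed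
        have "P ?h" if "P \<in> \<Q>" for P
        proof -
          have "P \<in> ?Q1 ` Y1 \<or> P \<in> ?Q2 ` Y2"
            unfolding Y1(3)[symmetric] Y2(3)[symmetric] using subsetD[OF Q(2) that] that by simp
          then show ?thesis using 1 2 by (elim disjE imageE) simp_all
        qed
        then have "\<forall>P\<in>\<Q>. P ?h" by (intro ballI)
        then show "\<exists>h. \<forall>P\<in>\<Q>. P h" by (rule exI[of "\<lambda>h. \<forall>P\<in>\<Q>. P h"])
      qed
      then obtain h where h: "\<forall>P\<in>?Q1 ` ?X1 \<union> ?Q2 ` ?X2. P h" by (elim exE)
      have hD: "D (\<lambda>i. h (i, s))" if "s \<in> ?S" "definable C ?I M D" "D a'" for s D
      proof -
        have "?Q1 (s, D) \<in> ?Q1 ` ?X1" by (rule imageI) (use that in simp)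
        then have "?Q1 (s, D) \<in> ?Q1 ` ?X1 \<union> ?Q2 ` ?X2" by (rule UnI1)
        from bspec[OF h this] show ?thesis by simp
      qed
      have h\<theta>: "\<not> \<theta> (\<lambda>i. h (i, s)) (\<lambda>i. h (i, t))" if "s \<in> ?S" "t \<in> ?S" "s \<noteq> t" for s t
      proof -
        have "?Q2 (s, t) \<in> ?Q2 ` ?X2" by (rule imageI) (use that in simp)
        then have "?Q2 (s, t) \<in> ?Q1 ` ?X1 \<union> ?Q2 ` ?X2" by (rule UnI2)
        from bspec[OF h this] show ?thesis by simp
      qed
      have "\<exists>g\<in>Aut_over C e. \<forall>i\<in>?I. g (a' i) = h (i, s)" if s: "s \<in> ?S" for s
      proof -
        have "D a' = D (\<lambda>i. h (i, s))" if D: "definable C ?I M D" for D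
          using hD[OF s D] hD[OF s definable_Not[OF D]] by blast
        then obtain g where g: "g \<in> Aut C" "\<And>m. m \<in> M \<Longrightarrow> g m = m" "\<And>i. i \<in> ?I \<Longrightarrow> g (a' i) = h (i, s)"
          using homogeneity[OF e'.small_index M(2), of a' "\<lambda>i. h (i, s)"] by blast
        moreover have "g \<in> Aut_over C e"
          using g M(3) unfolding in_dcl_def Aut_over_def by blast
        ultimately show ?thesis by blast
      qed
      then have "\<forall>s\<in>?S. \<exists>g. g \<in> Aut_over C e \<and> (\<forall>i\<in>?I. g (a' i) = h (i, s))" by blast
      then obtain g where g: "\<And>s. s \<in> ?S \<Longrightarrow> g s \<in> Aut_over C e"
        "\<And>s i. s \<in> ?S \<Longrightarrow> i \<in> ?I \<Longrightarrow> g s (a' i) = h (i, s)" by metis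
      have "inj_on (\<lambda>s. hyp_image (g s) e') ?S"
      proof (rule inj_onI, rule ccontr)
        fix s t assume st: "s \<in> ?S" "t \<in> ?S" "hyp_image (g s) e' = hyp_image (g t) e'" "s \<noteq> t"
        have "(compose ?I (g s) a', compose ?I (g t) a') \<in> E'"
          using st(3) e'.hyp_image_eq_iff[OF Aut_over_Aut[OF g(1)[OF st(1)]] Aut_over_Aut[OF g(1)[OF st(2)]]]
          by simp
        then have "\<theta> (compose ?I (g s) a') (compose ?I (g t) a')" by (rule E\<theta>)
        moreover have "\<theta> (compose ?I (g s) a') (compose ?I (g t) a') = \<theta> (\<lambda>i. h (i, s)) (\<lambda>i. h (i, t))"
          by (rule loc) (use V(2) g(2) st in \<open>auto simp: compose_apply subset_iff\<close>)
        ultimately show False using h\<theta>[OF st(1,2,4)] by simp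
      qed
      then have "|?S| \<le>o |?O|" by (rule card_of_ordLeqI) (use g(1) in blast)
      then show False using card_of_Pow[of ?O] not_ordLess_ordLeq by blast
    qed
    then obtain n D where nD: "definable C ?I M D" "D a'" "\<not> (\<exists>h. seq n D h)" by blast
    \<comment> \<open>\<open>N = m - 1\<close> is the maximal length of such a sequence.\<close>
    define m where "m = (LEAST n. \<not> (\<exists>h. seq n D h))"
    have m: "\<not> (\<exists>h. seq m D h)" unfolding m_def by (rule LeastI[of "\<lambda>n. \<not> (\<exists>h. seq n D h)"]) (rule nD(3))
    have "\<exists>h. seq 0 D h" by (rule exI[of "seq 0 D" undefined]) (simp add: seq_def)
    then have "m \<noteq> 0" using m by (cases "m = 0") simp_all
    then obtain N where N: "m = Suc N" by (cases m) auto
    then have "\<exists>h. seq N D h" using not_less_Least[of N "\<lambda>n. \<not> (\<exists>h. seq n D h)"] unfolding m_def[symmetric] by simp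
    then obtain h0 where h0: "seq N D h0" by (elim exE)
    have fin2: "finite {(k, l). k < N \<and> l < N \<and> k \<noteq> l}"
      by (rule finite_subset[of _ "{..<N} \<times> {..<N}"]) auto
    have 1: "definable C (?I \<times> {..<N}) M (\<lambda>h. \<forall>k\<in>{..<N}. D (\<lambda>i. h (i, k)))"
      by (rule definable_ball) (auto intro: defD[OF nD(1)])
    have "definable C (?I \<times> {..<N}) M (\<lambda>h. \<forall>y\<in>{(k, l). k < N \<and> l < N \<and> k \<noteq> l}. \<not> \<theta> (\<lambda>i. h (i, fst y)) (\<lambda>i. h (i, snd y)))"
    proof (rule definable_ball[OF fin2])
      fix y assume "y \<in> {(k, l). k < N \<and> l < N \<and> k \<noteq> l}"
      then have "fst y \<in> {..<N}" "snd y \<in> {..<N}" by auto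
      from definable_Not[OF def\<theta>[OF this]]
      show "definable C (?I \<times> {..<N}) M (\<lambda>h. \<not> \<theta> (\<lambda>i. h (i, fst y)) (\<lambda>i. h (i, snd y)))"
        by (rule definable_mono) auto
    qed
    then have "definable C (?I \<times> {..<N}) M (seq N D)"
      unfolding seq_def[abs_def] using 1 by (simp add: case_prod_beta definable_conj)
    then obtain V1 A1 where V1: "finite V1" "A1 \<subseteq> M" "definable C V1 A1 (seq N D)"
      by (rule definable_finite_support)
    have d1: "definable C (V1 \<union> V \<times> {..<N}) M (seq N D)"
      by (rule definable_mono[OF V1(3) _ V1(2)]) simp
    have "finite (V1 \<union> V \<times> {..<N})" using V1(1) V(1) by simp
    then obtain h1 where h1: "h1 ` (V1 \<union> V \<times> {..<N}) \<subseteq> M" "seq N D h1"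
      using elementary_submodel_witness[OF M(1) _ d1, of h0] h0 by blast
    \<comment> \<open>Otherwise \<open>a'\<close> would prolong the sequence.\<close>
    have "\<exists>k<N. \<theta> (\<lambda>i. h1 (i, k)) a'"
    proof (rule ccontr)
      assume no: "\<not> ?thesis"
      let ?h = "\<lambda>(i, k). if k < N then h1 (i, k) else a' i"
      have hk: "(\<lambda>i. ?h (i, k)) = (if k < N then (\<lambda>i. h1 (i, k)) else a')" for k by auto
      have "seq (Suc N) D ?h"
        unfolding seq_def hk
    proof (intro conjI ballI)
      fix k assume "k \<in> {..<Suc N}"
      then show "D (if k < N then \<lambda>i. h1 (i, k) else a')"
        using h1(2) nD(2) unfolding seq_def by (cases "k < N") simp_all
    next
      fix y assume "y \<in> {(k, l). k < Suc N \<and> l < Suc N \<and> k \<noteq> l}"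
      then obtain k l where y: "y = (k, l)" "k < Suc N" "l < Suc N" "k \<noteq> l" by auto
      consider "k < N" "l < N" | "k < N" "l = N" | "k = N" "l < N" using y by linarith
      then show "case y of (k, l) \<Rightarrow> \<not> \<theta> (if k < N then \<lambda>i. h1 (i, k) else a') (if l < N then \<lambda>i. h1 (i, l) else a')"
        unfolding y(1) prod.case
      proof cases
        case 1
        then have "(k, l) \<in> {(k, l). k < N \<and> l < N \<and> k \<noteq> l}" using y(4) by simp
        from bspec[OF conjunct2[OF h1(2)[unfolded seq_def]] this] 1
        show "\<not> \<theta> (if k < N then \<lambda>i. h1 (i, k) else a') (if l < N then \<lambda>i. h1 (i, l) else a')" by simp
      next
        case 2
        then show "\<not> \<theta> (if k < N then \<lambda>i. h1 (i, k) else a') (if l < N then \<lambda>i. h1 (i, l) else a')"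
          using no by simp
      next
        case 3
        then show "\<not> \<theta> (if k < N then \<lambda>i. h1 (i, k) else a') (if l < N then \<lambda>i. h1 (i, l) else a')"
          using no sym[of a'] by simp
      qed
    qed
      then show False using m N by blast
    qed
    then obtain k where k: "k < N" "\<theta> (\<lambda>i. h1 (i, k)) a'" by blast
    have "\<theta> (\<lambda>i. h1 (i, k)) a' = \<theta> (\<lambda>i. f (h1 (i, k))) (\<lambda>i. f (a' i))"
      using definable_fix[OF fA def, of "case_sum (\<lambda>i. h1 (i, k)) a'"] by simp
    also have "\<dots> = \<theta> (\<lambda>i. h1 (i, k)) (compose ?I f a')"
    proof (rule loc)
      fix i assume i: "i \<in> V"
      then have "h1 (i, k) \<in> M" using h1(1) k(1) by blast
      then show "f (h1 (i, k)) = h1 (i, k) \<and> f (a' i) = compose ?I f a' i"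
        using i V(2) fM by (auto simp: compose_apply)
    qed
    finally show ?thesis using k(2) \<theta>\<psi> by blast
  qed
  then have "(a', compose ?I f a') \<in> E'"
    unfolding e'.E_iff using e'.rep compose_in_tuples by blast
  then show ?thesis using e'.hyp_image_fixes_iff[OF fA] by simp
qed

lemma (in hyper) bounded_fixed:
  assumes e': "hyper C e' E' \<P>' a'" and bd: "bounded_over C e' e" and f: "f \<in> Autf_L C e"
  shows "hyp_image f e' = e'"
  using f
proof (induction rule: Autf_induct)
  case id
  then show ?case by (rule hyper.hyp_image_id[OF e'])
next
  case (gen f)
  then show ?case by (rule bounded_fixed_by_model_fixing[OF e' bd])
next
  case (comp f g)
  then show ?case by (simp add: hyp_image_comp[symmetric])
qed

section \<open>Lascar tuples\<close>

context hyper begin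

text \<open>
  \<open>f\<close> agrees on \<open>B\<close> with a Lascar strong automorphism iff \<open>f(b)\<close> has the Lascar strong type over
  \<open>e\<close> of the tuple \<open>b\<close> enumerating \<open>B\<close>.
\<close>

definition strong_on :: "'a set \<Rightarrow> ('a \<Rightarrow> 'a) \<Rightarrow> bool" where
  "strong_on B f \<longleftrightarrow> (\<exists>k\<in>Autf_L C e. \<forall>x\<in>B. k x = f x)"

lemma lascar_equiv_iff:
  "lascar_equiv C e J b (compose J f b) \<longleftrightarrow> strong_on (b ` J) f"
proof -
  have "compose J k b = compose J f b \<longleftrightarrow> (\<forall>x\<in>b ` J. k x = f x)" for k
  proof
    assume eq: "compose J k b = compose J f b"
    show "\<forall>x\<in>b ` J. k x = f x"
    proof
      fix x assume "x \<in> b ` J"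
      then obtain j where "j \<in> J" "x = b j" by blast
      then show "k x = f x" using fun_cong[OF eq, of j] by (simp add: compose_apply)
    qed
  qed (auto intro!: compose_cong)
  then show ?thesis by (simp add: lascar_equiv_def strong_on_def)
qed

lemma strong_on_mono: "strong_on B f \<Longrightarrow> B' \<subseteq> B \<Longrightarrow> strong_on B' f"
  unfolding strong_on_def by blast

text \<open>
  The relation \<open>\<equiv>\<^sub>L\<close> need not be type-definable, so an \<open>f\<close> may be strong on all finite subsets
  of \<open>B\<close> without being strong on \<open>B\<close>.  For small \<open>B\<close>, the following condition is determined by the finite
  subsets of \<open>B\<close>, and \<open>f\<close> is strong on \<open>B\<close> iff it holds for one of the types \<open>p\<close> in a set that depends
  on \<open>f\<close> alone.
\<close>

definition type_fixing :: "'a set \<Rightarrow> (('a \<Rightarrow> 'a) \<Rightarrow> bool) set \<Rightarrow> 'a set \<Rightarrow> bool" where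
  "type_fixing M p B \<longleftrightarrow> (\<exists>g\<in>Aut_over C e. dtype C M M g = p \<and> (\<forall>x\<in>B. g x = x))"

lemma type_fixing_mono: "type_fixing M p B \<Longrightarrow> B' \<subseteq> B \<Longrightarrow> type_fixing M p B'"
  unfolding type_fixing_def by blast

lemma same_dtype_Autf:
  assumes M: "elementary_submodel C M" "small C M" "in_dcl C e M"
    and fg: "f \<in> Aut C" "g \<in> Aut C" and eq: "dtype C M M f = dtype C M M g"
  obtains u v where "u \<in> Autf_L C e" "v \<in> Autf_L C e" "f = (\<lambda>x. u (g (v x)))"
proof -
  obtain u v where uv: "u \<in> Aut C" "\<And>m. m \<in> M \<Longrightarrow> u m = m" "v \<in> Aut C" "\<And>m. m \<in> M \<Longrightarrow> v m = m"
    "f = (\<lambda>x. u (g (v x)))"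
    using same_dtype_conj[OF M(2) fg eq] by blast
  show ?thesis
    by (rule that[OF _ _ uv(5)]) (rule fixes_model_Autf, rule fixes_modelI[OF _ M], use uv in auto)+
qed

text \<open>
  If \<open>k\<close> agrees with \<open>f\<close> on \<open>B\<close> then \<open>k\<inverse>f\<close> fixes \<open>B\<close>.  Conversely, an automorphism \<open>g\<close> fixing
  \<open>B\<close> with the same type as \<open>k\<inverse>f\<close> is \<open>u k\<inverse> f v\<close> for Lascar strong \<open>u\<close>, \<open>v\<close>, and since these form
  a normal subgroup, \<open>v\<close> can be moved past \<open>f\<close>.
\<close>

lemma strong_on_iff_type_fixing:
  assumes M: "elementary_submodel C M" "small C M" "in_dcl C e M" and f: "f \<in> Aut_over C e"
  shows "strong_on B f \<longleftrightarrow>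
    (\<exists>k\<in>Autf_L C e. type_fixing M (dtype C M M (\<lambda>x. inv_into UNIV k (f x))) B)"
proof
  assume "strong_on B f"
  then obtain k where k: "k \<in> Autf_L C e" "\<forall>x\<in>B. k x = f x" unfolding strong_on_def by blast
  have kA: "k \<in> Aut C" by (rule Aut_over_Aut[OF Autf_Aut_over[OF k(1)]])
  have "inv_into UNIV k (f x) = x" if "x \<in> B" for x
    using bspec[OF k(2) that] Aut_inv_simps(2)[OF kA, of x] by simp
  moreover have "(\<lambda>x. inv_into UNIV k (f x)) \<in> Aut_over C e"
    by (rule Aut_over_comp[OF Autf_Aut_over[OF Autf_inv[OF k(1)]] f])
  ultimately have "type_fixing M (dtype C M M (\<lambda>x. inv_into UNIV k (f x))) B"
    unfolding type_fixing_def by (intro bexI[of _ "\<lambda>x. inv_into UNIV k (f x)"]) simp_all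
  then show "\<exists>k\<in>Autf_L C e. type_fixing M (dtype C M M (\<lambda>x. inv_into UNIV k (f x))) B"
    using k(1) by (intro bexI[of _ k])
next
  assume "\<exists>k\<in>Autf_L C e. type_fixing M (dtype C M M (\<lambda>x. inv_into UNIV k (f x))) B"
  then obtain k g where k: "k \<in> Autf_L C e" and g: "g \<in> Aut_over C e"
    "dtype C M M g = dtype C M M (\<lambda>x. inv_into UNIV k (f x))" "\<forall>x\<in>B. g x = x"
    unfolding type_fixing_def by (elim bexE conjE)
  have kA: "k \<in> Aut C" by (rule Aut_over_Aut[OF Autf_Aut_over[OF k]])
  have fA: "f \<in> Aut C" by (rule Aut_over_Aut[OF f])
  obtain u v where u: "u \<in> Autf_L C e" and v: "v \<in> Autf_L C e"
    and eq: "g = (\<lambda>x. u (inv_into UNIV k (f (v x))))"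
    using same_dtype_Autf[OF M Aut_over_Aut[OF g(1)] Aut_comp[OF Aut_inv[OF kA] fA] g(2)] by blast
  have uA: "u \<in> Aut C" by (rule Aut_over_Aut[OF Autf_Aut_over[OF u]])
  let ?w = "\<lambda>x. f (v (inv_into UNIV f x))"
  have w: "?w \<in> Autf_L C e" by (rule Autf_conj[OF v f])
  have wA: "?w \<in> Aut C" by (rule Aut_over_Aut[OF Autf_Aut_over[OF w]])
  let ?k = "\<lambda>x. inv_into UNIV ?w (k (inv_into UNIV u x))"
  have "?k \<in> Autf_L C e" by (rule Autf_comp[OF Autf_inv[OF w] Autf_comp[OF k Autf_inv[OF u]]])
  moreover have "?k x = f x" if "x \<in> B" for x
  proof -
    have "u (inv_into UNIV k (f (v x))) = x" using bspec[OF g(3) that] by (simp add: eq)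
    then have "inv_into UNIV u x = inv_into UNIV k (f (v x))"
      using Aut_inv_simps(2)[OF uA] by metis
    then have "k (inv_into UNIV u x) = f (v x)" by (simp add: Aut_inv_simps(1)[OF kA])
    also have "\<dots> = ?w (f x)" by (simp add: Aut_inv_simps(2)[OF fA])
    finally show ?thesis using Aut_inv_simps(2)[OF wA, of "f x"] by simp
  qed
  ultimately show "strong_on B f" unfolding strong_on_def by (intro bexI[of _ ?k]) simp_all
qed

text \<open>Compactness, for the type of \<open>g(M)\<close> over \<open>M\<close> and over \<open>B\<close>.\<close>

lemma type_fixing_finite_character:
  assumes M: "elementary_submodel C M" "small C M" "in_dcl C e M"
    and f: "f \<in> Aut_over C e" and B: "small C B"
    and fin: "\<And>B0. finite B0 \<Longrightarrow> B0 \<subseteq> B \<Longrightarrow> type_fixing M (dtype C M M f) B0"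
  shows "type_fixing M (dtype C M M f) B"
proof -
  let ?P1 = "dtype C M M f" and ?P2 = "dtype C M B (\<lambda>x. x)"
  have "\<exists>h. \<forall>P\<in>?P1 \<union> ?P2. P h"
  proof (rule saturation[OF M(2)])
    show "small C (M \<union> B)" by (rule small_Un[OF M(2) B])
    fix P assume "P \<in> ?P1 \<union> ?P2"
    then have "definable C M M P \<or> definable C M B P" unfolding dtype_def by blast
    then show "definable C M (M \<union> B) P" by (auto intro: definable_mono)
  next
    fix \<Q> assume Q: "finite \<Q>" "\<Q> \<subseteq> ?P1 \<union> ?P2"
    have "\<exists>A0. finite A0 \<and> A0 \<subseteq> B \<and> definable C M A0 P" if "P \<in> \<Q> \<inter> ?P2" for P
    proof -
      have "definable C M B P" using that by (simp add: dtype_def)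
      then obtain V0 A0 where "V0 \<subseteq> M" "finite A0" "A0 \<subseteq> B" "definable C V0 A0 P"
        by (rule definable_finite_support)
      then show ?thesis using definable_mono[of C V0 A0 P M A0] by auto
    qed
    then have "\<forall>P\<in>\<Q> \<inter> ?P2. \<exists>A0. finite A0 \<and> A0 \<subseteq> B \<and> definable C M A0 P" by (intro ballI)
    from bchoice[OF this] obtain A0 where A0: "\<forall>P\<in>\<Q> \<inter> ?P2. finite (A0 P) \<and> A0 P \<subseteq> B \<and> definable C M (A0 P) P"
      by (elim exE)
    let ?B0 = "\<Union>(A0 ` (\<Q> \<inter> ?P2))"
    have "finite ?B0" using Q(1) A0 by simp
    moreover have "?B0 \<subseteq> B" using A0 by blast
    ultimately have "type_fixing M (dtype C M M f) ?B0" by (rule fin)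
    then obtain g where g: "g \<in> Aut_over C e" "dtype C M M g = dtype C M M f" "\<forall>x\<in>?B0. g x = x"
      unfolding type_fixing_def by (elim bexE conjE)
    have "P g" if "P \<in> \<Q>" for P
    proof (cases "P \<in> ?P1")
      case True
      then have "P \<in> dtype C M M g" by (simp only: g(2))
      then show ?thesis by (simp add: dtype_def)
    next
      case False
      then have P: "P \<in> \<Q> \<inter> ?P2" using subsetD[OF Q(2) that] that by simp
      have "P (\<lambda>x. g x) = P (\<lambda>x. x)"
      proof (rule definable_fix[OF Aut_over_Aut[OF g(1)]])
        show "definable C M (A0 P) P" using bspec[OF A0 P] by simp
        show "g x = x" if "x \<in> A0 P" for x using g(3) P that by blast
      qed
      then show ?thesis using P by (simp add: dtype_def)
    qed
    then have "\<forall>P\<in>\<Q>. P g" by (intro ballI)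
    then show "\<exists>h. \<forall>P\<in>\<Q>. P h" by (rule exI[of "\<lambda>h. \<forall>P\<in>\<Q>. P h"])
  qed
  then obtain h where h: "\<forall>P\<in>?P1 \<union> ?P2. P h" by (elim exE)
  have h1: "P h" if "definable C M M P" "P f" for P
    by (rule bspec[OF h]) (use that in \<open>simp add: dtype_def\<close>)
  have h2: "P h" if "definable C M B P" "P (\<lambda>x. x)" for P
    by (rule bspec[OF h]) (use that in \<open>simp add: dtype_def\<close>)
  have "P (\<lambda>x. x) = P h" if "definable C M B P" for P
    using h2[OF that] h2[OF definable_Not[OF that]] by blast
  then obtain g where g: "g \<in> Aut C" "\<And>x. x \<in> B \<Longrightarrow> g x = x" "\<And>m. m \<in> M \<Longrightarrow> g m = h m"
    using homogeneity[OF M(2) B, of "\<lambda>x. x" h] by blast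
  have "P g = P f" if "definable C M M P" for P
  proof -
    have "P g = P h" by (rule definable_cong[OF that]) (rule g(3))
    then show ?thesis using h1[OF that] h1[OF definable_Not[OF that]] by blast
  qed
  then have eq: "dtype C M M g = dtype C M M f" unfolding dtype_def by blast
  obtain u v where uv: "u \<in> Autf_L C e" "v \<in> Autf_L C e" "g = (\<lambda>x. u (f (v x)))"
    using same_dtype_Autf[OF M g(1) Aut_over_Aut[OF f] eq] by blast
  have "g \<in> Aut_over C e"
    unfolding uv(3) by (rule Aut_over_comp[OF Autf_Aut_over[OF uv(1)] Aut_over_comp[OF f Autf_Aut_over[OF uv(2)]]])
  then show ?thesis
    unfolding type_fixing_def using eq g(2) by (intro bexI[of _ g]) simp_all
qed

text \<open>
  There are few types over \<open>M\<close>, and each that fails for some small subset of \<open>U\<close> already fails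
  for a finite one; \<open>W\<close> collects one such finite set for each type.  Taking instead one small
  counterexample for each coset of \<open>Autf\<^sub>L(C, e)\<close> would not do, since the union of few small
  sets need not be small when the degree is singular.
\<close>

lemma small_test_set:
  obtains W where "W \<subseteq> U" "small C W"
    "\<And>f B. f \<in> Aut_over C e \<Longrightarrow> strong_on W f \<Longrightarrow> B \<subseteq> U \<Longrightarrow> small C B \<Longrightarrow> strong_on B f"
proof -
  obtain M where M: "elementary_submodel C M" "small C M" "in_dcl C e M" by (rule model_exists)
  let ?T = "dtype C M M ` Aut_over C e"
  define bad where "bad p B0 \<longleftrightarrow> finite B0 \<and> B0 \<subseteq> U \<and> \<not> type_fixing M p B0" for p B0
  define F where "F p = (if \<exists>B0. bad p B0 then SOME B0. bad p B0 else {})" for p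
  have F1: "finite (F p) \<and> F p \<subseteq> U" for p
  proof (cases "\<exists>B0. bad p B0")
    case True
    then have "bad p (F p)" unfolding F_def by (simp add: someI_ex)
    then show ?thesis by (simp add: bad_def)
  qed (simp add: F_def)
  have F2: "\<not> type_fixing M p (F p)" if "bad p B0" for p B0
  proof -
    have "\<exists>B0. bad p B0" using that by blast
    then have "bad p (F p)" unfolding F_def by (simp add: someI_ex)
    then show ?thesis by (simp add: bad_def)
  qed
  let ?W = "\<Union>p\<in>?T. F p"
  show ?thesis
  proof (rule that[of ?W])
    show "?W \<subseteq> U" using F1 by blast
    show "small C ?W" by (rule small_UN_finite[OF small_dtypes[OF M(2) M(2)]]) (use F1 in blast)
    fix f B assume f: "f \<in> Aut_over C e" and W: "strong_on ?W f" and B: "B \<subseteq> U" "small C B"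
    obtain k where k: "k \<in> Autf_L C e" "type_fixing M (dtype C M M (\<lambda>x. inv_into UNIV k (f x))) ?W"
      using W unfolding strong_on_iff_type_fixing[OF M f] by (elim bexE)
    let ?g = "\<lambda>x. inv_into UNIV k (f x)"
    let ?p = "dtype C M M ?g"
    have g: "?g \<in> Aut_over C e"
      by (rule Aut_over_comp[OF Autf_Aut_over[OF Autf_inv[OF k(1)]] f])
    have "?p \<in> ?T" using g by (rule imageI)
    then have sub: "F ?p \<subseteq> ?W" by (rule UN_upper)
    have "type_fixing M ?p (F ?p)" using type_fixing_mono[OF k(2) sub] .
    then have no: "\<not> bad ?p B0" for B0 using F2[of ?p B0] by blast
    have "type_fixing M ?p B0" if "finite B0" "B0 \<subseteq> B" for B0
      using no[of B0] that(1) order_trans[OF that(2) B(1)] unfolding bad_def by simp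
    then have "type_fixing M ?p B" by (rule type_fixing_finite_character[OF M g B(2)])
    then show "strong_on B f" unfolding strong_on_iff_type_fixing[OF M f] by (rule bexI[OF _ k(1)])
  qed
qed

end

section \<open>The relativized Galois group\<close>

lemma in_dcl_mono: "in_dcl C e A \<Longrightarrow> A \<subseteq> B \<Longrightarrow> in_dcl C e B"
  unfolding in_dcl_def by blast

locale relativized = hyper C e E \<P> a
  for C :: "('f, 'r, 'a, 'k) big_structure" and e :: "('i, 'a) hyp" and E \<P> a +
  fixes X :: "'x set" and \<Sigma> :: "('f, 'r, 'x + nat, 'a) fm set"
  assumes small_X: "small C X" and inv_type: "invariant_type C e X \<Sigma>"
    and dcl: "\<exists>l c. realization_tuple C X \<Sigma> l c \<and> in_dcl C e (c ` seq_index C l X)"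
begin

abbreviation S where "S \<equiv> sols C X \<Sigma>"
abbreviation J where "J l \<equiv> seq_index C l X"
abbreviation G where "G \<equiv> Aut_over C e"
abbreviation res where "res \<equiv> restrict_aut C X \<Sigma>"
abbreviation gal where "gal \<equiv> Gal_proj C e X \<Sigma>"

definition U :: "'a set" where "U = (\<Union>s\<in>S. s ` X)"

text \<open>
  The kernel of the projection to the Galois group.  Quantifying over small sets \<open>B\<close> of elements of
  realizations instead of tuples of realizations gets rid of the index sets.
\<close>

definition Ker :: "('a \<Rightarrow> 'a) set" where
  "Ker = {f \<in> G. \<forall>B\<subseteq>U. small C B \<longrightarrow> strong_on B f}"

lemma sols_tuples: "s \<in> S \<Longrightarrow> s \<in> tuples X"
  by (simp add: sols_def)

lemma sols_closed: "f \<in> G \<Longrightarrow> s \<in> S \<Longrightarrow> compose X f s \<in> S"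
  using inv_type sols_tuples unfolding invariant_type_def by blast

lemma U_closed: "f \<in> G \<Longrightarrow> x \<in> U \<Longrightarrow> f x \<in> U"
proof -
  assume f: "f \<in> G" and "x \<in> U"
  then obtain s i where s: "s \<in> S" "i \<in> X" "x = s i" unfolding U_def by blast
  then have "compose X f s i = f x" by (simp add: compose_apply)
  then show ?thesis using sols_closed[OF f s(1)] s(2) unfolding U_def by (metis UN_I imageI)
qed

lemma small_J: "l \<in> Field (degree C) \<Longrightarrow> small C (J l)"
  unfolding seq_index_def by (rule small_Times[OF small_ord_below small_X])

lemma realization_tupleD:
  assumes "realization_tuple C X \<Sigma> l b"
  shows "b \<in> tuples (J l)" "small C (J l)" "b ` J l \<subseteq> U" "i \<in> ord_below C l \<Longrightarrow> row X b i \<in> S"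
proof -
  show "b \<in> tuples (J l)" "small C (J l)" using assms small_J by (auto simp: realization_tuple_def)
  show r: "row X b i \<in> S" if "i \<in> ord_below C l" for i
    using assms that by (simp add: realization_tuple_def)
  show "b ` J l \<subseteq> U"
  proof
    fix x assume "x \<in> b ` J l"
    then obtain i y where iy: "i \<in> ord_below C l" "y \<in> X" "x = b (i, y)" by (auto simp: seq_index_def)
    then have "x = row X b i y" by (simp add: row_def)
    then show "x \<in> U" using r[OF iy(1)] iy(2) unfolding U_def by blast
  qed
qed

lemma realization_cover:
  assumes "B \<subseteq> U" "small C B"
  obtains l b where "realization_tuple C X \<Sigma> l b" "B \<subseteq> b ` J l"
proof -
  have "\<forall>x\<in>B. \<exists>s. s \<in> S \<and> x \<in> s ` X" using assms(1) unfolding U_def by blast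
  from bchoice[OF this] obtain r where r: "\<forall>x\<in>B. r x \<in> S \<and> x \<in> r x ` X" by (elim exE)
  obtain l \<rho> where l: "l \<in> Field (degree C)" "bij_betw \<rho> (ord_below C l) (r ` B)"
    by (rule small_enumeration[OF small_image[OF assms(2), of r]])
  define b where "b = (\<lambda>(i, x)\<in>J l. \<rho> i x)"
  have \<rho>: "\<rho> i \<in> r ` B" if "i \<in> ord_below C l" for i using l(2) that by (auto simp: bij_betw_def)
  have \<rho>S: "\<rho> i \<in> S" if i: "i \<in> ord_below C l" for i
  proof -
    obtain x where "x \<in> B" "\<rho> i = r x" using \<rho>[OF i] by (elim imageE)
    then show ?thesis using bspec[OF r, of x] by simp
  qed
  have "row X b i = \<rho> i" if "i \<in> ord_below C l" for i
  proof (rule tuples_eqI)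
    show "row X b i \<in> tuples X" by (simp add: row_def tuples_def)
    show "\<rho> i \<in> tuples X" by (rule sols_tuples[OF \<rho>S[OF that]])
  qed (use that in \<open>simp add: row_def b_def seq_index_def\<close>)
  moreover have "b \<in> tuples (J l)" by (simp add: b_def tuples_def)
  moreover note \<rho>S
  ultimately have "realization_tuple C X \<Sigma> l b" using l(1) by (simp add: realization_tuple_def)
  moreover have "B \<subseteq> b ` J l"
  proof
    fix x assume x: "x \<in> B"
    have "x \<in> r x ` X" using bspec[OF r x] by simp
    then obtain y where y: "y \<in> X" "x = r x y" by (elim imageE)
    have "r x \<in> \<rho> ` ord_below C l" using x l(2) by (simp add: bij_betw_def)
    then obtain i where i: "i \<in> ord_below C l" "r x = \<rho> i" by (elim imageE)
    have "b (i, y) = x" using i y by (simp add: b_def seq_index_def)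
    moreover have "(i, y) \<in> J l" using i(1) y(1) by (simp add: seq_index_def)
    ultimately show "x \<in> b ` J l" by (metis imageI)
  qed
  ultimately show ?thesis by (rule that)
qed

lemma KerI: "f \<in> G \<Longrightarrow> (\<And>B. B \<subseteq> U \<Longrightarrow> small C B \<Longrightarrow> \<exists>k\<in>Autf_L C e. \<forall>x\<in>B. k x = f x) \<Longrightarrow> f \<in> Ker"
  unfolding Ker_def strong_on_def by simp

lemma KerD: "f \<in> Ker \<Longrightarrow> B \<subseteq> U \<Longrightarrow> small C B \<Longrightarrow> \<exists>k\<in>Autf_L C e. \<forall>x\<in>B. k x = f x"
  unfolding Ker_def strong_on_def by simp

lemma Ker_G: "f \<in> Ker \<Longrightarrow> f \<in> G"
  by (simp add: Ker_def)

lemma Autf_Ker: "f \<in> Autf_L C e \<Longrightarrow> f \<in> Ker"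
  by (rule KerI) (auto simp: Autf_Aut_over)

lemma Ker_comp:
  assumes f: "f \<in> Ker" and g: "g \<in> Ker" shows "(\<lambda>x. f (g x)) \<in> Ker"
proof (rule KerI)
  show "(\<lambda>x. f (g x)) \<in> G" by (rule Aut_over_comp[OF Ker_G[OF f] Ker_G[OF g]])
  fix B assume B: "B \<subseteq> U" "small C B"
  obtain k where k: "k \<in> Autf_L C e" "\<forall>x\<in>B. k x = g x" using KerD[OF g B] by blast
  have "g ` B \<subseteq> U" using B(1) U_closed[OF Ker_G[OF g]] by blast
  then obtain k' where k': "k' \<in> Autf_L C e" "\<forall>x\<in>g ` B. k' x = f x"
    using KerD[OF f _ small_image[OF B(2)]] by blast
  show "\<exists>k\<in>Autf_L C e. \<forall>x\<in>B. k x = f (g x)"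
    by (rule bexI[OF _ Autf_comp[OF k'(1) k(1)]]) (use k(2) k'(2) in simp)
qed

lemma Ker_inv: assumes f: "f \<in> Ker" shows "inv_into UNIV f \<in> Ker"
proof (rule KerI)
  note fG = Ker_G[OF f] and fA = Aut_over_Aut[OF Ker_G[OF f]]
  show "inv_into UNIV f \<in> G" by (rule Aut_over_inv[OF fG])
  fix B assume B: "B \<subseteq> U" "small C B"
  have "inv_into UNIV f ` B \<subseteq> U" using B(1) U_closed[OF Aut_over_inv[OF fG]] by blast
  then obtain k where k: "k \<in> Autf_L C e" "\<forall>x\<in>inv_into UNIV f ` B. k x = f x"
    using KerD[OF f _ small_image[OF B(2)]] by blast
  have kA: "k \<in> Aut C" by (rule Aut_over_Aut[OF Autf_Aut_over[OF k(1)]])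
  have "inv_into UNIV k x = inv_into UNIV f x" if "x \<in> B" for x
  proof -
    have "k (inv_into UNIV f x) = x" using k(2) that by (simp add: Aut_inv_simps[OF fA])
    then show ?thesis using Aut_inv_simps(2)[OF kA] by metis
  qed
  then show "\<exists>k\<in>Autf_L C e. \<forall>x\<in>B. k x = inv_into UNIV f x"
    using Autf_inv[OF k(1)] by (intro bexI[of _ "inv_into UNIV k"]) simp_all
qed

lemma Ker_conj: assumes f: "f \<in> Ker" and g: "g \<in> G" shows "(\<lambda>x. g (f (inv_into UNIV g x))) \<in> Ker"
proof (rule KerI)
  show "(\<lambda>x. g (f (inv_into UNIV g x))) \<in> G"
    by (rule Aut_over_comp[OF g Aut_over_comp[OF Ker_G[OF f] Aut_over_inv[OF g]]])
  fix B assume B: "B \<subseteq> U" "small C B"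
  have "inv_into UNIV g ` B \<subseteq> U" using B(1) U_closed[OF Aut_over_inv[OF g]] by blast
  then obtain k where k: "k \<in> Autf_L C e" "\<forall>x\<in>inv_into UNIV g ` B. k x = f x"
    using KerD[OF f _ small_image[OF B(2)]] by blast
  show "\<exists>k\<in>Autf_L C e. \<forall>x\<in>B. k x = g (f (inv_into UNIV g x))"
    by (rule bexI[OF _ Autf_conj[OF k(1) g]]) (use k(2) in simp)
qed

lemma restrict_aut_apply: "s \<in> S \<Longrightarrow> res f s = compose X f s"
  by (simp add: restrict_aut_def)

lemma map_rows_restrict:
  assumes b: "realization_tuple C X \<Sigma> l b"
  shows "map_rows C X l (res f) b = compose (J l) f b"
proof
  fix y
  show "map_rows C X l (res f) b y = compose (J l) f b y"
  proof (cases "y \<in> J l")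
    case True
    then obtain i x where y: "y = (i, x)" "i \<in> ord_below C l" "x \<in> X" by (auto simp: seq_index_def)
    have "res f (row X b i) x = f (b (i, x))"
      using y(3) unfolding restrict_aut_apply[OF realization_tupleD(4)[OF b y(2)]]
      by (simp add: compose_apply row_def)
    then show ?thesis using True y(1) by (simp add: map_rows_def compose_apply)
  next
    case False
    then show ?thesis by (simp add: map_rows_def compose_def)
  qed
qed

lemma restrict_aut_cong:
  assumes "res f = res g" "x \<in> U" shows "f x = g x"
proof -
  obtain s i where s: "s \<in> S" "i \<in> X" "x = s i" using assms(2) unfolding U_def by blast
  have "compose X f s i = compose X g s i"
    using fun_cong[OF assms(1), of s] s(1) by (simp add: restrict_aut_apply)
  then show ?thesis using s by (simp add: compose_apply)
qed

lemma restrict_aut_eqI: "(\<And>x. x \<in> U \<Longrightarrow> f x = g x) \<Longrightarrow> res f = res g"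
  unfolding restrict_aut_def U_def by (intro restrict_ext compose_cong) blast

lemma Autf_L_type_iff: assumes f: "f \<in> G" shows "res f \<in> Autf_L_type C e X \<Sigma> \<longleftrightarrow> f \<in> Ker"
proof
  assume *: "res f \<in> Autf_L_type C e X \<Sigma>"
  have "strong_on B f" if B: "B \<subseteq> U" "small C B" for B
  proof -
    obtain l b where b: "realization_tuple C X \<Sigma> l b" "B \<subseteq> b ` J l" by (rule realization_cover[OF B])
    have "lascar_equiv C e (J l) b (map_rows C X l (res f) b)"
      using * b(1) unfolding Autf_L_type_def by blast
    then have "strong_on (b ` J l) f" by (simp add: map_rows_restrict[OF b(1)] lascar_equiv_iff)
    then show ?thesis using b(2) by (rule strong_on_mono)
  qed
  then show "f \<in> Ker" using f unfolding Ker_def by simp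
next
  assume *: "f \<in> Ker"
  have "lascar_equiv C e (J l) b (map_rows C X l (res f) b)"
    if b: "realization_tuple C X \<Sigma> l b" for l b
    unfolding map_rows_restrict[OF b] lascar_equiv_iff
    using * realization_tupleD(3)[OF b] small_image[OF realization_tupleD(2)[OF b], of b] unfolding Ker_def by simp
  then show "res f \<in> Autf_L_type C e X \<Sigma>"
    using f unfolding Autf_L_type_def Aut_type_def by simp
qed

lemma Autf_L_type_eq: "Autf_L_type C e X \<Sigma> = res ` Ker"
proof
  show "Autf_L_type C e X \<Sigma> \<subseteq> res ` Ker"
  proof
    fix \<sigma> assume \<sigma>: "\<sigma> \<in> Autf_L_type C e X \<Sigma>"
    then obtain f where f: "f \<in> G" "\<sigma> = res f" unfolding Autf_L_type_def Aut_type_def by blast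
    then show "\<sigma> \<in> res ` Ker" using Autf_L_type_iff[OF f(1)] \<sigma> by blast
  qed
  show "res ` Ker \<subseteq> Autf_L_type C e X \<Sigma>" using Autf_L_type_iff[OF Ker_G] by blast
qed

text \<open>The tuples from which the topology of the Galois group may be defined.\<close>

definition good_tuple :: "'k \<Rightarrow> ('k \<times> 'x \<Rightarrow> 'a) \<Rightarrow> bool" where
  "good_tuple l b \<longleftrightarrow> lascar_tuple C e X \<Sigma> l b \<and> in_dcl C e (b ` J l)"

lemma lascar_tuple_iff:
  "lascar_tuple C e X \<Sigma> l b \<longleftrightarrow>
    realization_tuple C X \<Sigma> l b \<and> (\<forall>f\<in>G. strong_on (b ` J l) f \<longrightarrow> f \<in> Ker)"
proof (cases "realization_tuple C X \<Sigma> l b")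
  case b: True
  have iff: "lascar_equiv C e (J l) b (map_rows C X l (res f) b) \<longleftrightarrow> strong_on (b ` J l) f" for f
    unfolding map_rows_restrict[OF b] by (rule lascar_equiv_iff)
  have sub: "Autf_L_type C e X \<Sigma> \<subseteq> {\<sigma> \<in> Aut_type C e X \<Sigma>. lascar_equiv C e (J l) b (map_rows C X l \<sigma> b)}"
    using b unfolding Autf_L_type_def by blast
  have "lascar_tuple C e X \<Sigma> l b \<longleftrightarrow>
      {\<sigma> \<in> Aut_type C e X \<Sigma>. lascar_equiv C e (J l) b (map_rows C X l \<sigma> b)} \<subseteq> Autf_L_type C e X \<Sigma>"
    using b sub unfolding lascar_tuple_def by blast
  also have "\<dots> \<longleftrightarrow> (\<forall>f\<in>G. lascar_equiv C e (J l) b (map_rows C X l (res f) b) \<longrightarrow> res f \<in> Autf_L_type C e X \<Sigma>)"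
    unfolding Aut_type_def by blast
  also have "\<dots> \<longleftrightarrow> (\<forall>f\<in>G. strong_on (b ` J l) f \<longrightarrow> f \<in> Ker)"
    by (simp add: iff Autf_L_type_iff)
  finally show ?thesis using b by simp
qed (simp add: lascar_tuple_def)

lemma good_tuple_exists: "\<exists>l b. good_tuple l b"
proof -
  obtain W where W: "W \<subseteq> U" "small C W"
    "\<And>f B. f \<in> G \<Longrightarrow> strong_on W f \<Longrightarrow> B \<subseteq> U \<Longrightarrow> small C B \<Longrightarrow> strong_on B f"
    using small_test_set[of U] by blast
  obtain lc c where c: "realization_tuple C X \<Sigma> lc c" "in_dcl C e (c ` J lc)" using dcl by blast
  have "W \<union> c ` J lc \<subseteq> U" "small C (W \<union> c ` J lc)"
    using W(1,2) realization_tupleD(3)[OF c(1)] small_image[OF realization_tupleD(2)[OF c(1)], of c]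
    by (auto intro: small_Un)
  then obtain l b where b: "realization_tuple C X \<Sigma> l b" "W \<union> c ` J lc \<subseteq> b ` J l"
    by (rule realization_cover)
  have "f \<in> Ker" if "f \<in> G" "strong_on (b ` J l) f" for f
    using W(3)[OF that(1) strong_on_mono[OF that(2)]] b(2) that(1) unfolding Ker_def by simp
  then have "good_tuple l b"
    unfolding good_tuple_def lascar_tuple_iff using b in_dcl_mono[OF c(2)] by simp
  then show ?thesis by blast
qed

lemma good_tupleD:
  assumes "good_tuple l b"
  shows "realization_tuple C X \<Sigma> l b"
    and "v \<in> Aut C \<Longrightarrow> (\<And>j. j \<in> J l \<Longrightarrow> v (b j) = b j) \<Longrightarrow> v \<in> Ker"
proof -
  show "realization_tuple C X \<Sigma> l b" using assms by (simp add: good_tuple_def lascar_tuple_def)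
  assume v: "v \<in> Aut C" "\<And>j. j \<in> J l \<Longrightarrow> v (b j) = b j"
  then have "\<forall>x\<in>b ` J l. v x = x" by blast
  then have "v \<in> G" using v(1) assms unfolding good_tuple_def in_dcl_def Aut_over_def by blast
  moreover have "strong_on (b ` J l) v"
    unfolding strong_on_def by (rule bexI[OF _ Autf_id]) (use v(2) in auto)
  ultimately show "v \<in> Ker" using assms unfolding good_tuple_def lascar_tuple_iff by blast
qed

lemma restrict_aut_Bij: assumes f: "f \<in> G" shows "res f \<in> Bij S"
proof -
  note fA = Aut_over_Aut[OF f]
  let ?g = "inv_into UNIV f"
  have "bij_betw (res f) S S"
  proof (rule bij_betw_byWitness[of _ "compose X ?g"])
    show "\<forall>s\<in>S. compose X ?g (res f s) = s" "\<forall>s\<in>S. res f (compose X ?g s) = s"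
      by (auto simp: restrict_aut_apply sols_closed[OF Aut_over_inv[OF f]] compose_compose
          Aut_inv_simps[OF fA] compose_id sols_tuples)
    show "res f ` S \<subseteq> S" by (auto simp: restrict_aut_apply sols_closed[OF f])
    show "compose X ?g ` S \<subseteq> S" by (auto simp: sols_closed[OF Aut_over_inv[OF f]])
  qed
  then show ?thesis by (simp add: Bij_def restrict_aut_def)
qed

lemma restrict_aut_mult:
  assumes f: "f \<in> G" and g: "g \<in> G"
  shows "res f \<otimes>\<^bsub>Aut_type_group C e X \<Sigma>\<^esub> res g = res (\<lambda>x. f (g x))"
proof -
  have "compose S (res f) (res g) = res (\<lambda>x. f (g x))"
    unfolding compose_def[of S] restrict_aut_def[of C X \<Sigma> "\<lambda>x. f (g x)"]
    by (rule restrict_ext) (simp add: restrict_aut_apply sols_closed[OF g] compose_compose)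
  then show ?thesis
    by (simp add: Aut_type_group_def BijGroup_def restrict_aut_Bij[OF f] restrict_aut_Bij[OF g])
qed

lemma Gal_proj_eq: assumes f: "f \<in> G" shows "gal f = (\<lambda>k. res (\<lambda>x. k (f x))) ` Ker"
proof -
  have "res k \<otimes>\<^bsub>Aut_type_group C e X \<Sigma>\<^esub> res f = res (\<lambda>x. k (f x))"
    if "k \<in> Ker" for k
    by (rule restrict_aut_mult[OF Ker_G[OF that] f])
  then show ?thesis
    unfolding Gal_proj_def Gal_class_def r_coset_def Autf_L_type_eq by auto
qed

lemma Gal_proj_eq_iff:
  assumes f: "f \<in> G" and g: "g \<in> G"
  shows "gal f = gal g \<longleftrightarrow> (\<lambda>x. f (inv_into UNIV g x)) \<in> Ker"
proof
  note gA = Aut_over_Aut[OF g] and fA = Aut_over_Aut[OF f]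
  let ?h = "\<lambda>x. f (inv_into UNIV g x)"
  have hG: "?h \<in> G" by (rule Aut_over_comp[OF f Aut_over_inv[OF g]])
  {
    assume eq: "gal f = gal g"
    have "res (\<lambda>x. f x) \<in> gal f"
      unfolding Gal_proj_eq[OF f] by (rule image_eqI[OF _ Autf_Ker[OF Autf_id]]) simp
    then obtain k where k: "k \<in> Ker" "res f = res (\<lambda>x. k (g x))"
      unfolding eq Gal_proj_eq[OF g] by blast
    have "?h x = k x" if "x \<in> U" for x
      using restrict_aut_cong[OF k(2) U_closed[OF Aut_over_inv[OF g] that]]
      by (simp add: Aut_inv_simps[OF gA])
    then have "res ?h = res k" by (rule restrict_aut_eqI)
    then have "res ?h \<in> Autf_L_type C e X \<Sigma>" using k(1) unfolding Autf_L_type_eq by simp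
    then show "?h \<in> Ker" using Autf_L_type_iff[OF hG] by simp
  }
  assume h: "?h \<in> Ker"
  have fh: "f = (\<lambda>x. ?h (g x))" by (simp add: Aut_inv_simps[OF gA])
  have gh: "g = (\<lambda>x. inv_into UNIV ?h (f x))"
  proof
    fix x
    have "?h (g x) = f x" by (simp add: Aut_inv_simps[OF gA])
    then show "g x = inv_into UNIV ?h (f x)" using Aut_inv_simps(2)[OF Aut_over_Aut[OF hG], of "g x"] by simp
  qed
  show "gal f = gal g"
    unfolding Gal_proj_eq[OF f] Gal_proj_eq[OF g]
  proof
    show "(\<lambda>k. res (\<lambda>x. k (f x))) ` Ker \<subseteq> (\<lambda>k. res (\<lambda>x. k (g x))) ` Ker"
    proof (rule image_subsetI)
      fix k assume k: "k \<in> Ker"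
      have "res (\<lambda>x. k (f x)) = res (\<lambda>x. k (?h (g x)))"
        by (simp add: Aut_inv_simps[OF gA])
      then show "res (\<lambda>x. k (f x)) \<in> (\<lambda>k. res (\<lambda>x. k (g x))) ` Ker"
        using Ker_comp[OF k h] by (rule image_eqI[where f = "\<lambda>k. res (\<lambda>x. k (g x))"])
    qed
    show "(\<lambda>k. res (\<lambda>x. k (g x))) ` Ker \<subseteq> (\<lambda>k. res (\<lambda>x. k (f x))) ` Ker"
    proof (rule image_subsetI)
      fix k assume k: "k \<in> Ker"
      have "res (\<lambda>x. k (g x)) = res (\<lambda>x. k (inv_into UNIV ?h (f x)))"
        by (rule restrict_aut_eqI) (use fun_cong[OF gh] in simp)
      then show "res (\<lambda>x. k (g x)) \<in> (\<lambda>k. res (\<lambda>x. k (f x))) ` Ker"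
        using Ker_comp[OF k Ker_inv[OF h]]
        by (rule image_eqI[where f = "\<lambda>k. res (\<lambda>x. k (f x))"])
    qed
  qed
qed

lemma carrier_Gal_L: "carrier (Gal_L C e X \<Sigma>) = gal ` G"
  unfolding Gal_L_def FactGroup_def RCOSETS_def Gal_proj_def[abs_def] Gal_class_def
  by (auto simp: Aut_type_group_def Aut_type_def)

lemma saturated_subgroup_iff:
  assumes H: "subgroup H (Aut_group C e)"
  shows "H = {f \<in> G. gal f \<in> gal ` H} \<longleftrightarrow> Ker \<subseteq> H"
proof -
  have HG: "H \<subseteq> G" using subgroup.subset[OF H] by (simp add: Aut_group_simps)
  have id: "(\<lambda>x. x) \<in> H" using subgroup.one_closed[OF H] by (simp add: Aut_group_simps)
  have comp: "(\<lambda>x. f (g x)) \<in> H" if "f \<in> H" "g \<in> H" for f g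
    using subgroup.m_closed[OF H that] that HG by (simp add: Aut_group_simps subset_iff)
  show ?thesis
  proof
    assume eq: "H = {f \<in> G. gal f \<in> gal ` H}"
    show "Ker \<subseteq> H"
    proof
      fix k assume k: "k \<in> Ker"
      have "inv_into UNIV (\<lambda>x. x) = (\<lambda>x :: 'a. x)" using Aut_inv_simps(1)[OF Aut_id[of C]] by simp
      then have "gal k = gal (\<lambda>x. x)"
        using Gal_proj_eq_iff[OF Ker_G[OF k] Aut_over_id] k by simp
      then have "gal k \<in> gal ` H" using id by (rule image_eqI)
      then have "k \<in> {f \<in> G. gal f \<in> gal ` H}" using Ker_G[OF k] by simp
      then show "k \<in> H" by (simp only: eq[symmetric])
    qed
  next
    assume Ker: "Ker \<subseteq> H"
    have "f \<in> H" if f: "f \<in> G" "gal f \<in> gal ` H" for f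
    proof -
      obtain h where h: "h \<in> H" "gal f = gal h" using f(2) by blast
      have hG: "h \<in> G" using h(1) HG by blast
      have "(\<lambda>x. f (inv_into UNIV h x)) \<in> H" using h(2) Gal_proj_eq_iff[OF f(1) hG] Ker by blast
      from comp[OF this h(1)] show ?thesis by (simp add: Aut_inv_simps[OF Aut_over_Aut[OF hG]])
    qed
    then show "H = {f \<in> G. gal f \<in> gal ` H}" using HG by blast
  qed
qed

end

section \<open>The topology of the Galois group\<close>

text \<open>
  Types are closed under conjunction, so that the generating sets of the topology are a base.
\<close>

lemma openin_logic_topology:
  assumes conj: "\<And>p \<phi> \<psi>. p \<in> TS \<Longrightarrow> Conj \<phi> \<psi> \<in> p \<longleftrightarrow> \<phi> \<in> p \<and> \<psi> \<in> p"
    and top: "\<And>p. p \<in> TS \<Longrightarrow> \<tau> \<in> p"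
  shows "openin (logic_topology TS) W \<longleftrightarrow> W \<subseteq> TS \<and> (\<forall>p\<in>W. \<exists>\<phi>\<in>p. {q \<in> TS. \<phi> \<in> q} \<subseteq> W)"
proof
  assume "openin (logic_topology TS) W"
  then have "generate_topology_on (range (\<lambda>\<phi>. {p \<in> TS. \<phi> \<in> p})) W"
    unfolding logic_topology_def openin_topology_generated_by_iff .
  then show "W \<subseteq> TS \<and> (\<forall>p\<in>W. \<exists>\<phi>\<in>p. {q \<in> TS. \<phi> \<in> q} \<subseteq> W)"
  proof induction
    case (Int A B)
    have "\<exists>\<phi>\<in>p. {q \<in> TS. \<phi> \<in> q} \<subseteq> A \<inter> B" if "p \<in> A \<inter> B" for p
    proof -
      have pA: "p \<in> A" and pB: "p \<in> B" using that by auto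
      obtain \<phi> where \<phi>: "\<phi> \<in> p" "{q \<in> TS. \<phi> \<in> q} \<subseteq> A"
        using bspec[OF conjunct2[OF Int.IH(1)] pA] by (elim bexE)
      obtain \<psi> where \<psi>: "\<psi> \<in> p" "{q \<in> TS. \<psi> \<in> q} \<subseteq> B"
        using bspec[OF conjunct2[OF Int.IH(2)] pB] by (elim bexE)
      have "p \<in> TS" using Int.IH(1) pA by blast
      then have "Conj \<phi> \<psi> \<in> p" using conj \<phi>(1) \<psi>(1) by simp
      moreover have "{q \<in> TS. Conj \<phi> \<psi> \<in> q} \<subseteq> A \<inter> B"
      proof
        fix q assume "q \<in> {q \<in> TS. Conj \<phi> \<psi> \<in> q}"
        then have "q \<in> TS" "\<phi> \<in> q" "\<psi> \<in> q" using conj[of q \<phi> \<psi>] by auto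
        then show "q \<in> A \<inter> B" using \<phi>(2) \<psi>(2) by blast
      qed
      ultimately show ?thesis by (rule bexI[rotated])
    qed
    then show ?case using Int.IH(1) by (intro conjI ballI) auto
  next
    case (UN K)
    have "\<exists>\<phi>\<in>p. {q \<in> TS. \<phi> \<in> q} \<subseteq> \<Union>K" if k: "k \<in> K" "p \<in> k" for p k
    proof -
      obtain \<phi> where \<phi>: "\<phi> \<in> p" "{q \<in> TS. \<phi> \<in> q} \<subseteq> k"
        using bspec[OF conjunct2[OF UN.IH[OF k(1)]] k(2)] by (elim bexE)
      have "{q \<in> TS. \<phi> \<in> q} \<subseteq> \<Union>K" using Union_upper[OF k(1)] by (rule order_trans[OF \<phi>(2)])
      with \<phi>(1) show ?thesis by (rule bexI[rotated])
    qed
    then have "\<forall>p\<in>\<Union>K. \<exists>\<phi>\<in>p. {q \<in> TS. \<phi> \<in> q} \<subseteq> \<Union>K" by (intro ballI) (elim UnionE)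
    moreover have "\<Union>K \<subseteq> TS" by (rule Union_least) (rule conjunct1[OF UN.IH])
    ultimately show ?case by (rule conjI[rotated])
  next
    case (Basis s)
    then obtain \<phi> where s: "s = {p \<in> TS. \<phi> \<in> p}" by (elim imageE)
    show ?case unfolding s by (intro conjI ballI Collect_restrict bexI[of _ \<phi>] order_refl) simp
  qed simp
next
  assume W: "W \<subseteq> TS \<and> (\<forall>p\<in>W. \<exists>\<phi>\<in>p. {q \<in> TS. \<phi> \<in> q} \<subseteq> W)"
  have "openin (logic_topology TS) {p \<in> TS. \<phi> \<in> p}" for \<phi>
    unfolding logic_topology_def by (rule topology_generated_by_Basis) simp
  then have "openin (logic_topology TS) (\<Union>{{p \<in> TS. \<phi> \<in> p} | \<phi>. {p \<in> TS. \<phi> \<in> p} \<subseteq> W})"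
    by (intro openin_Union) auto
  moreover have "\<Union>{{p \<in> TS. \<phi> \<in> p} | \<phi>. {p \<in> TS. \<phi> \<in> p} \<subseteq> W} = W"
  proof (intro subset_antisym subsetI)
    fix p assume p: "p \<in> W"
    obtain \<phi> where \<phi>: "\<phi> \<in> p" "{q \<in> TS. \<phi> \<in> q} \<subseteq> W"
      using bspec[OF conjunct2[OF W] p] by (elim bexE)
    have "p \<in> TS" using W p by blast
    then show "p \<in> \<Union>{{p \<in> TS. \<phi> \<in> p} | \<phi>. {p \<in> TS. \<phi> \<in> p} \<subseteq> W}"
      using \<phi> by (intro UnionI[of "{q \<in> TS. \<phi> \<in> q}"]) auto
  next
    fix p assume "p \<in> \<Union>{{p \<in> TS. \<phi> \<in> p} | \<phi>. {p \<in> TS. \<phi> \<in> p} \<subseteq> W}"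
    then show "p \<in> W" by auto
  qed
  ultimately show "openin (logic_topology TS) W" by simp
qed

lemma topspace_quotient_topology:
  assumes "f ` topspace P \<subseteq> Q" shows "topspace (quotient_topology P f Q) = Q"
proof -
  have "{p \<in> topspace P. f p \<in> Q} = topspace P" using assms by blast
  then have "openin (quotient_topology P f Q) Q" by (simp add: openin_quotient_topology)
  then have "Q \<subseteq> topspace (quotient_topology P f Q)" by (rule openin_subset)
  moreover have "topspace (quotient_topology P f Q) \<subseteq> Q"
    using openin_topspace[of "quotient_topology P f Q"] unfolding openin_quotient_topology by blast
  ultimately show ?thesis by blast
qed

context relativized begin

text \<open>
  \<open>tp(f(b)/b)\<close> lies in the closure of \<open>{tp(h(b)/b) | h \<in> H}\<close> in the space of all types over \<open>b\<close>.
\<close>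

abbreviation in_closure :: "'k \<Rightarrow> ('k \<times> 'x \<Rightarrow> 'a) \<Rightarrow> ('a \<Rightarrow> 'a) set \<Rightarrow> ('a \<Rightarrow> 'a) \<Rightarrow> bool" where
  "in_closure l b H f \<equiv> \<forall>P. definable C (J l) (b ` J l) P \<longrightarrow> P (compose (J l) f b) \<longrightarrow>
    (\<exists>h\<in>H. P (compose (J l) h b))"

lemma Gal_topology_good_tuple:
  obtains l b where "good_tuple l b"
    "Gal_topology C e X \<Sigma> = quotient_topology (type_space C e X \<Sigma> l b) (type_to_Gal C e X \<Sigma> l b)
      (carrier (Gal_L C e X \<Sigma>))"
proof -
  let ?P = "\<lambda>(l, b). lascar_tuple C e X \<Sigma> l b \<and> in_dcl C e (b ` J l)"
  define z where "z = (SOME z. ?P z)"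
  obtain l b where z: "z = (l, b)" by (cases z)
  obtain l0 b0 where "good_tuple l0 b0" using good_tuple_exists by blast
  then have "?P (l0, b0)" by (simp add: good_tuple_def)
  then have "?P z" unfolding z_def by (rule someI)
  then have "good_tuple l b" unfolding z by (simp add: good_tuple_def)
  moreover have "Gal_topology C e X \<Sigma> = (case z of (l, b) \<Rightarrow>
      quotient_topology (type_space C e X \<Sigma> l b) (type_to_Gal C e X \<Sigma> l b) (carrier (Gal_L C e X \<Sigma>)))"
    unfolding Gal_topology_def Let_def z_def ..
  ultimately show ?thesis using that unfolding z by simp
qed

text \<open>
  If \<open>f(b)\<close> and \<open>g(b)\<close> have the same type over \<open>b\<close>, then \<open>g = u f v\<close> where \<open>u\<close> and \<open>v\<close> fix \<open>b\<close>,
  and automorphisms fixing \<open>b\<close> are in the kernel.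
\<close>

lemma good_tuple_tp_eq:
  assumes b: "good_tuple l b" and f: "f \<in> G" and g: "g \<in> G"
    and eq: "tp C (J l) (compose (J l) f b) (b ` J l) = tp C (J l) (compose (J l) g b) (b ` J l)"
  shows "gal f = gal g"
proof -
  note r = realization_tupleD[OF good_tupleD(1)[OF b]] and fA = Aut_over_Aut[OF f]
  have "P (compose (J l) f b) = P (compose (J l) g b)" if "definable C (J l) (b ` J l) P" for P
    using eq that unfolding tp_eq_iff by blast
  then obtain u where u: "u \<in> Aut C" "\<And>x. x \<in> b ` J l \<Longrightarrow> u x = x"
    "\<And>j. j \<in> J l \<Longrightarrow> u (compose (J l) f b j) = compose (J l) g b j"
    using homogeneity[OF r(2) small_image[OF r(2)], of b "compose (J l) f b" "compose (J l) g b"] by blast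
  let ?v = "\<lambda>x. inv_into UNIV f (inv_into UNIV u (g x))"
  have uK: "u \<in> Ker" by (rule good_tupleD(2)[OF b u(1)]) (use u(2) in blast)
  have "?v \<in> Aut C" by (rule Aut_comp[OF Aut_inv[OF fA] Aut_comp[OF Aut_inv[OF u(1)] Aut_over_Aut[OF g]]])
  moreover have "?v (b j) = b j" if "j \<in> J l" for j
  proof -
    have "g (b j) = u (f (b j))" using u(3)[OF that] that by (simp add: compose_apply)
    then show ?thesis by (simp add: Aut_inv_simps[OF u(1)] Aut_inv_simps[OF fA])
  qed
  ultimately have vK: "?v \<in> Ker" by (rule good_tupleD(2)[OF b])
  have "(\<lambda>x. u (f (?v (inv_into UNIV f x)))) \<in> Ker" by (rule Ker_comp[OF uK Ker_conj[OF vK f]])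
  then have "(\<lambda>x. g (inv_into UNIV f x)) \<in> Ker" by (simp add: Aut_inv_simps[OF u(1)] Aut_inv_simps[OF fA])
  then show ?thesis using Gal_proj_eq_iff[OF g f] by simp
qed

text \<open>
  The complement of the image of \<open>H\<close> pulls back to the set of types of the tuples \<open>f(b)\<close> with
  \<open>f \<notin> H\<close>, because a type determines the coset of \<open>f\<close>, and \<open>H\<close> is a union of cosets.
\<close>

lemma closedin_Gal_iff:
  assumes b: "good_tuple l b" and H: "subgroup H (Aut_group C e)" and Ker: "Ker \<subseteq> H"
  shows "closedin (quotient_topology (type_space C e X \<Sigma> l b) (type_to_Gal C e X \<Sigma> l b)
      (carrier (Gal_L C e X \<Sigma>))) (gal ` H) \<longleftrightarrow>
    (\<forall>f\<in>G. in_closure l b H f \<longrightarrow> f \<in> H)"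
    (is "closedin ?Q _ \<longleftrightarrow> ?closed")
proof -
  define t where "t f = tp C (J l) (compose (J l) f b) (b ` J l)" for f
  let ?\<nu> = "type_to_Gal C e X \<Sigma> l b" and ?TS = "t ` G"
  have HG: "H \<subseteq> G" using subgroup.subset[OF H] by (simp add: Aut_group_simps)
  have tp: "tp_image C X l b (res f) = t f" for f
    unfolding tp_image_def map_rows_restrict[OF good_tupleD(1)[OF b]] t_def ..
  have \<pi>: "gal f = gal g" if "f \<in> G" "g \<in> G" "t f = t g" for f g
    using good_tuple_tp_eq[OF b that(1,2)] that(3) by (simp add: t_def)
  have \<pi>H: "gal f \<in> gal ` H \<longleftrightarrow> f \<in> H" if "f \<in> G" for f
    using saturated_subgroup_iff[OF H] Ker that by blast
  have \<nu>: "?\<nu> (t f) = gal f" if f: "f \<in> G" for f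
    unfolding type_to_Gal_def
  proof (rule the_equality)
    show "\<exists>\<sigma>\<in>Aut_type C e X \<Sigma>. t f = tp_image C X l b \<sigma> \<and> gal f = Gal_class C e X \<Sigma> \<sigma>"
      using f by (intro bexI[of _ "res f"]) (simp_all add: tp Gal_proj_def Aut_type_def)
    fix g assume "\<exists>\<sigma>\<in>Aut_type C e X \<Sigma>. t f = tp_image C X l b \<sigma> \<and> g = Gal_class C e X \<Sigma> \<sigma>"
    then obtain f' where "f' \<in> G" "t f = t f'" "g = gal f'"
      unfolding Aut_type_def by (auto simp: tp Gal_proj_def)
    then show "g = gal f" using \<pi>[OF f] by simp
  qed
  have space: "type_space C e X \<Sigma> l b = logic_topology ?TS"
    unfolding type_space_def Aut_type_def image_image tp ..
  let ?\<tau> = "Exists (Inr 0) (Eq (Var (Inr 0)) (Var (Inr 0)))"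
  have conj: "Conj \<phi> \<psi> \<in> p \<longleftrightarrow> \<phi> \<in> p \<and> \<psi> \<in> p" if "p \<in> ?TS" for p \<phi> \<psi>
    using that by (auto simp: t_def tp_def formulas_def holds_in_def)
  have top: "?\<tau> \<in> p" if "p \<in> ?TS" for p
    using that by (auto simp: t_def tp_def formulas_def holds_in_def)
  have op: "openin (logic_topology ?TS) W \<longleftrightarrow> W \<subseteq> ?TS \<and> (\<forall>p\<in>W. \<exists>\<phi>\<in>p. {q \<in> ?TS. \<phi> \<in> q} \<subseteq> W)" for W
    using conj top by (rule openin_logic_topology)
  have "openin (logic_topology ?TS) ?TS"
    unfolding op
  proof (intro conjI ballI order_refl)
    fix p assume "p \<in> ?TS"
    from top[OF this] show "\<exists>\<phi>\<in>p. {q \<in> ?TS. \<phi> \<in> q} \<subseteq> ?TS" by (rule bexI[rotated]) (rule Collect_restrict)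
  qed
  moreover have "topspace (logic_topology ?TS) \<subseteq> ?TS"
    using openin_topspace[of "logic_topology ?TS"] unfolding op by (rule conjunct1)
  ultimately have ts: "topspace (logic_topology ?TS) = ?TS"
    by (intro subset_antisym openin_subset)
  have Car: "topspace ?Q = gal ` G"
    unfolding carrier_Gal_L space by (rule topspace_quotient_topology) (auto simp: ts \<nu>)
  have pre: "{p \<in> ?TS. ?\<nu> p \<in> gal ` G - gal ` H} = t ` (G - H)"
  proof (intro subset_antisym subsetI)
    fix p assume "p \<in> {p \<in> ?TS. ?\<nu> p \<in> gal ` G - gal ` H}"
    then obtain f where f: "f \<in> G" "p = t f" "gal f \<notin> gal ` H" using \<nu> by auto
    then show "p \<in> t ` (G - H)" using \<pi>H[OF f(1)] by simp
  next
    fix p assume "p \<in> t ` (G - H)"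
    then obtain f where f: "f \<in> G" "f \<notin> H" "p = t f" by blast
    then show "p \<in> {p \<in> ?TS. ?\<nu> p \<in> gal ` G - gal ` H}" using \<nu>[OF f(1)] \<pi>H[OF f(1)] by simp
  qed
  have tH: "t f \<in> t ` (G - H) \<longleftrightarrow> f \<notin> H" if f: "f \<in> G" for f
  proof
    assume "t f \<in> t ` (G - H)"
    then obtain g where g: "g \<in> G" "g \<notin> H" "t f = t g" by blast
    then show "f \<notin> H" using \<pi>[OF f g(1,3)] \<pi>H[OF f] \<pi>H[OF g(1)] by simp
  qed (use f in blast)
  have "gal ` H \<subseteq> gal ` G" using HG by blast
  then have "closedin ?Q (gal ` H) \<longleftrightarrow> openin ?Q (gal ` G - gal ` H)"
    unfolding closedin_def Car by simp
  also have "\<dots> \<longleftrightarrow> openin (logic_topology ?TS) (t ` (G - H))"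
    unfolding openin_quotient_topology carrier_Gal_L space ts pre by blast
  also have "\<dots> \<longleftrightarrow> (\<forall>p\<in>t ` (G - H). \<exists>\<phi>\<in>p. {q \<in> ?TS. \<phi> \<in> q} \<subseteq> t ` (G - H))"
    unfolding op by blast
  also have "\<dots> \<longleftrightarrow> (\<forall>f\<in>G - H. \<exists>\<phi>\<in>t f. \<forall>h\<in>H. \<phi> \<notin> t h)"
  proof -
    have "{q \<in> ?TS. \<phi> \<in> q} \<subseteq> t ` (G - H) \<longleftrightarrow> (\<forall>h\<in>H. \<phi> \<notin> t h)" for \<phi>
    proof
      assume *: "{q \<in> ?TS. \<phi> \<in> q} \<subseteq> t ` (G - H)"
      show "\<forall>h\<in>H. \<phi> \<notin> t h"
      proof (intro ballI notI)
        fix h assume h: "h \<in> H" "\<phi> \<in> t h"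
        have hG: "h \<in> G" using h(1) HG by blast
        then have "t h \<in> t ` (G - H)" using * h(2) by blast
        then show False using tH[OF hG] h(1) by simp
      qed
    next
      assume *: "\<forall>h\<in>H. \<phi> \<notin> t h"
      show "{q \<in> ?TS. \<phi> \<in> q} \<subseteq> t ` (G - H)"
      proof
        fix q assume "q \<in> {q \<in> ?TS. \<phi> \<in> q}"
        then obtain g where "g \<in> G" "q = t g" "\<phi> \<in> t g" by blast
        then show "q \<in> t ` (G - H)" using * tH[of g] by blast
      qed
    qed
    then show ?thesis by simp
  qed
  also have "\<dots> \<longleftrightarrow> ?closed"
  proof -
    have "(\<exists>\<phi>\<in>t f. \<forall>h\<in>H. \<phi> \<notin> t h) \<longleftrightarrow>
      \<not> in_closure l b H f" for f
    proof
      assume "\<exists>\<phi>\<in>t f. \<forall>h\<in>H. \<phi> \<notin> t h"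
      then obtain \<phi> where \<phi>: "\<phi> \<in> t f" "\<forall>h\<in>H. \<phi> \<notin> t h" by blast
      then have "\<phi> \<in> formulas C (J l) (b ` J l)" by (simp add: t_def tp_def)
      then have "definable C (J l) (b ` J l) (holds C \<phi>)" "holds C \<phi> (compose (J l) f b)"
        "\<not> (\<exists>h\<in>H. holds C \<phi> (compose (J l) h b))"
        using \<phi> by (auto simp: definable_holds t_def tp_def)
      then show "\<not> in_closure l b H f"
        by blast
    next
      assume "\<not> in_closure l b H f"
      then obtain P where P: "definable C (J l) (b ` J l) P" "P (compose (J l) f b)" "\<not> (\<exists>h\<in>H. P (compose (J l) h b))"
        by blast
      from P(1) obtain \<phi> where "\<phi> \<in> formulas C (J l) (b ` J l)" "P = holds C \<phi>" by (rule definableE)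
      then show "\<exists>\<phi>\<in>t f. \<forall>h\<in>H. \<phi> \<notin> t h" using P(2,3) by (intro bexI[of _ \<phi>]) (auto simp: t_def tp_def)
    qed
    then show ?thesis by blast
  qed
  finally show ?thesis .
qed

section \<open>Stabilizers of bounded hyperimaginaries and closed subgroups\<close>

text \<open>
  On a representative consisting of realizations, \<open>f\<close> agrees with a Lascar strong automorphism.
\<close>

lemma Ker_fixes_bounded:
  assumes e': "hyper C e' E' \<P>' a'" and bd: "bounded_over C e' e"
    and J: "fst e' = J l" and a': "realization_tuple C X \<Sigma> l a'" and f: "f \<in> Ker"
  shows "hyp_image f e' = e'"
proof -
  interpret e': hyper C e' E' \<P>' a' by (rule e')
  obtain k where k: "k \<in> Autf_L C e" "\<forall>x\<in>a' ` J l. k x = f x"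
    using KerD[OF f realization_tupleD(3)[OF a'] small_image[OF realization_tupleD(2)[OF a']]] by blast
  have "compose (fst e') f a' = compose (fst e') k a'" by (rule compose_cong) (use k(2) J in simp)
  then have "hyp_image f e' = hyp_image k e'"
    by (simp add: e'.hyp_image_rep[OF Aut_over_Aut[OF Ker_G[OF f]]]
        e'.hyp_image_rep[OF Aut_over_Aut[OF Autf_Aut_over[OF k(1)]]])
  then show ?thesis using bounded_fixed[OF e' bd k(1)] by simp
qed

text \<open>
  The lemma \<open>closed_orbit\<close> for \<open>e'\<close> gives \<open>f = u\<inverse> g v\<close>, where \<open>g\<close> fixes \<open>e'\<close>, and \<open>u\<close> and \<open>v\<close> fix \<open>b\<close>
  and so are in the kernel.
\<close>

lemma bounded_stabilizer_closed:
  assumes b: "good_tuple l b" and e': "hyper C e' E' \<P>' a'"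
    and Ker: "\<And>k. k \<in> Ker \<Longrightarrow> hyp_image k e' = e'" and f: "f \<in> G"
    and cl: "\<And>P. definable C (J l) (b ` J l) P \<Longrightarrow> P (compose (J l) f b) \<Longrightarrow>
      \<exists>h\<in>G. hyp_image h e' = e' \<and> P (compose (J l) h b)"
  shows "hyp_image f e' = e'"
proof -
  interpret e': hyper C e' E' \<P>' a' by (rule e')
  note r = realization_tupleD[OF good_tupleD(1)[OF b]] and fA = Aut_over_Aut[OF f]
  have "\<exists>h\<in>Aut C. hyp_image h e' = e' \<and> P (\<lambda>j. h (b j))"
    if P: "definable C (J l) (b ` J l) P" "P (compose (J l) f b)" for P
  proof -
    obtain h where h: "h \<in> G" "hyp_image h e' = e'" "P (compose (J l) h b)" using cl[OF P] by blast
    have "P (compose (J l) h b) = P (\<lambda>j. h (b j))" by (rule definable_cong[OF P(1)]) (rule compose_apply)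
    then show ?thesis using h Aut_over_Aut[OF h(1)] by (intro bexI[of _ h]) simp_all
  qed
  then obtain u g where ug: "u \<in> Aut C" "\<And>j. j \<in> J l \<Longrightarrow> u (b j) = b j"
    "g \<in> Aut C" "hyp_image g e' = e'" "\<And>j. j \<in> J l \<Longrightarrow> u (compose (J l) f b j) = g (b j)"
    using e'.closed_orbit[OF r(2), of b "compose (J l) f b"] by blast
  have u: "u \<in> Ker" by (rule good_tupleD(2)[OF b ug(1,2)])
  let ?v = "\<lambda>x. inv_into UNIV g (u (f x))"
  have "?v \<in> Aut C" by (rule Aut_comp[OF Aut_inv[OF ug(3)] Aut_comp[OF ug(1) fA]])
  moreover have "?v (b j) = b j" if "j \<in> J l" for j
  proof -
    have "u (f (b j)) = g (b j)" using ug(5)[OF that] that by (simp add: compose_apply)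
    then show ?thesis by (simp add: Aut_inv_simps[OF ug(3)])
  qed
  ultimately have v: "?v \<in> Ker" by (rule good_tupleD(2)[OF b])
  have "hyp_image f e' = hyp_image (\<lambda>x. inv_into UNIV u (g (?v x))) e'"
    by (simp add: Aut_inv_simps[OF ug(3)] Aut_inv_simps[OF ug(1)])
  also have "\<dots> = hyp_image (inv_into UNIV u) (hyp_image g (hyp_image ?v e'))"
    by (simp only: hyp_image_comp)
  finally show ?thesis by (simp only: Ker[OF v] ug(4) Ker[OF Ker_inv[OF u]])
qed

text \<open>
  Two tuples of the type of \<open>b\<close> are related iff an automorphism carrying \<open>b\<close> to the first one
  carries some \<open>f(b)\<close>, \<open>f \<in> H\<close>, to the second; all other tuples are related to themselves only.
  A pair of different tuples that satisfies every formula true of this relation is related: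
  the formulas say that its first entry has the type of \<open>b\<close> and, after an automorphism, that its
  second entry is in the closure of the orbit of \<open>b\<close> under \<open>H\<close>.
\<close>

definition conj_rel :: "'k \<Rightarrow> ('k \<times> 'x \<Rightarrow> 'a) \<Rightarrow> ('a \<Rightarrow> 'a) set \<Rightarrow> ('k \<times> 'x \<Rightarrow> 'a) rel" where
  "conj_rel l b H = Id_on (tuples (J l)) \<union>
    {(compose (J l) g b, compose (J l) (\<lambda>x. g (f x)) b) | g f. g \<in> Aut C \<and> f \<in> H}"

lemma closed_subgroup_is_stabilizer:
  assumes b: "good_tuple l b" and H: "subgroup H (Aut_group C e)" and Ker: "Ker \<subseteq> H"
    and cl: "\<And>f. f \<in> G \<Longrightarrow> in_closure l b H f \<Longrightarrow> f \<in> H"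
  obtains e' where "hyperimaginary C e'" "fst e' = J l" "bounded_over C e' e" "b \<in> snd e'"
    "H = {f \<in> G. hyp_image f e' = e'}"
proof -
  note rb = good_tupleD(1)[OF b] and r = realization_tupleD[OF good_tupleD(1)[OF b]]
  have HG: "H \<subseteq> G" using subgroup.subset[OF H] by (simp add: Aut_group_simps)
  have HA: "f \<in> Aut C" if "f \<in> H" for f using that HG Aut_over_Aut by blast
  have id: "(\<lambda>x. x) \<in> H" using subgroup.one_closed[OF H] by (simp add: Aut_group_simps)
  have comp: "(\<lambda>x. f (g x)) \<in> H" if "f \<in> H" "g \<in> H" for f g
    using subgroup.m_closed[OF H that] that HG by (simp add: Aut_group_simps subset_iff)
  have inv: "inv_into UNIV f \<in> H" if "f \<in> H" for f
    using subgroup.m_inv_closed[OF H that] Aut_group_inv[of f] that HG by (simp add: subset_iff)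
  have fixb: "v \<in> H" if "v \<in> Aut C" "compose (J l) v b = b" for v
  proof -
    have "v (b j) = b j" if "j \<in> J l" for j
      using fun_cong[OF \<open>compose (J l) v b = b\<close>, of j] that by (simp add: compose_apply)
    then show ?thesis using good_tupleD(2)[OF b that(1)] Ker by blast
  qed
  let ?R = "conj_rel l b H"
  have RI: "(compose (J l) g b, compose (J l) (\<lambda>x. g (f x)) b) \<in> ?R" if "g \<in> Aut C" "f \<in> H" for g f
    using that unfolding conj_rel_def by blast
  have RE: "x = y \<and> x \<in> tuples (J l) \<or> (\<exists>g f. g \<in> Aut C \<and> f \<in> H \<and> x = compose (J l) g b \<and> y = compose (J l) (\<lambda>x. g (f x)) b)"
    if "(x, y) \<in> ?R" for x y using that unfolding conj_rel_def by blast
  have Rsub: "?R \<subseteq> tuples (J l) \<times> tuples (J l)"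
    unfolding conj_rel_def using compose_in_tuples by blast
  have step: "(\<lambda>x. inv_into UNIV g (g' x)) \<in> H"
    if "g \<in> Aut C" "g' \<in> Aut C" "compose (J l) g b = compose (J l) g' b" for g g'
  proof (rule fixb)
    show "(\<lambda>x. inv_into UNIV g (g' x)) \<in> Aut C" by (rule Aut_comp[OF Aut_inv[OF that(1)] that(2)])
    have "compose (J l) (\<lambda>x. inv_into UNIV g (g' x)) b = compose (J l) (inv_into UNIV g) (compose (J l) g' b)"
      by (simp add: compose_compose)
    also have "\<dots> = compose (J l) (\<lambda>x. inv_into UNIV g (g x)) b" unfolding that(3)[symmetric] by (simp add: compose_compose)
    also have "\<dots> = b" by (simp add: Aut_inv_simps[OF that(1)] compose_id[OF r(1)])
    finally show "compose (J l) (\<lambda>x. inv_into UNIV g (g' x)) b = b" .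
  qed
  have eqv: "equiv (tuples (J l)) ?R"
  proof (rule equivI)
    show "?R \<subseteq> tuples (J l) \<times> tuples (J l)" by (rule Rsub)
    show "refl_on (tuples (J l)) ?R" unfolding refl_on_def conj_rel_def by blast
    show "sym ?R"
    proof (rule symI)
      fix x y assume xy: "(x, y) \<in> ?R"
      from RE[OF xy] show "(y, x) \<in> ?R"
      proof (elim disjE exE conjE)
        assume "x = y" then show ?thesis using xy by simp
      next
        fix g f assume g: "g \<in> Aut C" "f \<in> H" "x = compose (J l) g b" "y = compose (J l) (\<lambda>x. g (f x)) b"
        have "(compose (J l) (\<lambda>x. g (f x)) b, compose (J l) (\<lambda>x. g (f (inv_into UNIV f x))) b) \<in> ?R"
          by (rule RI[OF Aut_comp[OF g(1) HA[OF g(2)]] inv[OF g(2)]])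
        then show ?thesis by (simp add: g(3,4) Aut_inv_simps[OF HA[OF g(2)]])
      qed
    qed
    show "trans ?R"
    proof (rule transI)
      fix x y z assume xy: "(x, y) \<in> ?R" and yz: "(y, z) \<in> ?R"
      show "(x, z) \<in> ?R"
      proof (cases "x = y \<or> y = z")
        case True
        then show ?thesis using xy yz by auto
      next
        case False
        then obtain g f g' f' where g: "g \<in> Aut C" "f \<in> H" "x = compose (J l) g b" "y = compose (J l) (\<lambda>x. g (f x)) b"
          and g': "g' \<in> Aut C" "f' \<in> H" "y = compose (J l) g' b" "z = compose (J l) (\<lambda>x. g' (f' x)) b"
          using RE[OF xy] RE[OF yz] by blast
        let ?gf = "\<lambda>x. g (f x)"
        have gf: "?gf \<in> Aut C" by (rule Aut_comp[OF g(1) HA[OF g(2)]])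
        have "(\<lambda>x. inv_into UNIV ?gf (g' x)) \<in> H" by (rule step[OF gf g'(1)]) (simp only: g(4)[symmetric] g'(3)[symmetric])
        from comp[OF g(2) comp[OF this g'(2)]]
        have *: "(\<lambda>x. f (inv_into UNIV ?gf (g' (f' x)))) \<in> H" .
        have "g (f (inv_into UNIV ?gf y)) = y" for y using Aut_inv_simps(1)[OF gf] .
        then show ?thesis using RI[OF g(1) *] by (simp add: g(3) g'(4))
      qed
    qed
  qed
  let ?J2 = "J l <+> J l"
  let ?\<Phi> = "{\<phi> \<in> formulas C ?J2 {}. \<forall>(x, y)\<in>?R. holds C \<phi> (case_sum x y)}"
  have "(x, y) \<in> ?R" if x: "x \<in> tuples (J l)" and y: "y \<in> tuples (J l)"
    and \<Phi>: "\<forall>\<phi>\<in>?\<Phi>. holds C \<phi> (case_sum x y)" for x y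
  proof (cases "x = y")
    case True
    then show ?thesis using x unfolding conj_rel_def by blast
  next
    case False
    then obtain j where j: "j \<in> J l" "x j \<noteq> y j" using tuples_eqI[OF x y] by blast
    \<comment> \<open>A formula holding at all pairs \<open>(g(b), g(f(b)))\<close> need not hold on the diagonal, but
      \<open>x\<^sub>j \<noteq> y\<^sub>j \<longrightarrow> Q\<close> holds there as well.\<close>
    have def: "Q (case_sum x y)" if Q: "definable C ?J2 {} Q"
      and R: "\<And>g f. g \<in> Aut C \<Longrightarrow> f \<in> H \<Longrightarrow> Q (\<lambda>v. g (case_sum b (\<lambda>i. f (b i)) v))" for Q
    proof -
      let ?N = "\<lambda>h. \<not> h (Inl j) = h (Inr j) \<longrightarrow> Q h"
      have N: "definable C ?J2 {} ?N"
        by (intro definable_imp definable_Not definable_eq Q) (use j(1) in auto)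
      then obtain \<phi> where \<phi>: "\<phi> \<in> formulas C ?J2 {}" "?N = holds C \<phi>" by (rule definableE)
      have NR: "?N (case_sum x' y')" if "(x', y') \<in> ?R" for x' y'
        using RE[OF that]
      proof (elim disjE exE conjE)
        fix g f assume g: "g \<in> Aut C" "f \<in> H" "x' = compose (J l) g b" "y' = compose (J l) (\<lambda>x. g (f x)) b"
        have "Q (case_sum x' y') = Q (\<lambda>v. g (case_sum b (\<lambda>i. f (b i)) v))"
          by (rule definable_cong[OF Q]) (auto simp: g(3,4) compose_apply)
        then show ?thesis using R[OF g(1,2)] by simp
      qed simp
      have "holds C \<phi> (case_sum x' y')" if "(x', y') \<in> ?R" for x' y'
        using NR[OF that] fun_cong[OF \<phi>(2), of "case_sum x' y'"] by simp
      then have "\<phi> \<in> ?\<Phi>" using \<phi>(1) by blast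
      then have "holds C \<phi> (case_sum x y)" using \<Phi> by blast
      then have "?N (case_sum x y)" using fun_cong[OF \<phi>(2), of "case_sum x y"] by simp
      then show ?thesis using j(2) by simp
    qed
    have "P b = P x" if P: "definable C (J l) {} P" for P
    proof -
      have 1: "P x" if P: "definable C (J l) {} P" and "P b" for P
      proof -
        have "definable C ?J2 {} (\<lambda>h. P (\<lambda>i. h (Inl i)))" by (rule definable_rename[OF P]) auto
        moreover have "P (\<lambda>i. g (case_sum b (\<lambda>i. f (b i)) (Inl i)))" if "g \<in> Aut C" for g f
          using definable_fix[OF that P, of b] \<open>P b\<close> by simp
        ultimately have "(\<lambda>h. P (\<lambda>i. h (Inl i))) (case_sum x y)" by (rule def)
        then show ?thesis by simp
      qed
      show ?thesis using 1[OF P] 1[OF definable_Not[OF P]] by blast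
    qed
    then obtain g where g: "g \<in> Aut C" "\<And>i. i \<in> J l \<Longrightarrow> g (b i) = x i"
      using homogeneity[OF r(2) small_finite[OF finite.emptyI], of b x] by blast
    let ?gi = "inv_into UNIV g"
    define d where "d = compose (J l) ?gi y"
    have "\<exists>f\<in>H. P (\<lambda>i. f (b i))" if P: "definable C (J l) (b ` J l) P" "P d" for P
    proof (rule ccontr)
      assume no: "\<not> ?thesis"
      obtain Q where Q: "definable C ?J2 {} Q" and PQ: "\<forall>h. P h = Q (case_sum b h)"
        by (rule definable_abstract_params[OF P(1)]) blast
      have nQ: "\<not> Q (case_sum x y)"
      proof (rule def[of "\<lambda>h. \<not> Q h"])
        show "definable C ?J2 {} (\<lambda>h. \<not> Q h)" by (rule definable_Not[OF Q(1)])
        show "\<not> Q (\<lambda>v. g (case_sum b (\<lambda>i. f (b i)) v))" if "g \<in> Aut C" "f \<in> H" for g f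
          using definable_fix[OF that(1) Q(1), of "case_sum b (\<lambda>i. f (b i))"] no that(2) spec[OF PQ, of "\<lambda>i. f (b i)"] by simp
      qed
      have "Q (case_sum x y) = Q (\<lambda>v. g (case_sum b d v))"
        by (rule definable_cong[OF Q(1)]) (auto simp: g(2) d_def compose_apply Aut_inv_simps[OF g(1)])
      also have "\<dots> = P d" using definable_fix[OF g(1) Q(1), of "case_sum b d"] spec[OF PQ, of d] by simp
      finally show False using nQ P(2) by simp
    qed
    note near = this
    \<comment> \<open>So \<open>d\<close> is a limit of tuples \<open>h(b)\<close> with \<open>h \<in> H\<close>; \<open>closed_orbit\<close> for \<open>e\<close> makes it \<open>f(b)\<close> for
      some \<open>f\<close> fixing \<open>e\<close>, to which the hypothesis that \<open>H\<close> is closed applies.\<close>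
    have "\<exists>f\<in>Aut C. hyp_image f e = e \<and> P (\<lambda>i. f (b i))"
      if P: "definable C (J l) (b ` J l) P" "P d" for P
      using near[OF P] HG unfolding Aut_over_def by blast
    then obtain u g1 where ug: "u \<in> Aut C" "\<And>i. i \<in> J l \<Longrightarrow> u (b i) = b i"
      "g1 \<in> Aut C" "hyp_image g1 e = e" "\<And>i. i \<in> J l \<Longrightarrow> u (d i) = g1 (b i)"
      using closed_orbit[OF r(2), of b d] by blast
    have uG: "u \<in> G" using good_tupleD(2)[OF b ug(1,2)] by (rule Ker_G)
    let ?f = "\<lambda>x. inv_into UNIV u (g1 x)"
    have fG: "?f \<in> G" by (rule Aut_over_comp[OF Aut_over_inv[OF uG]]) (use ug(3,4) in \<open>simp add: Aut_over_def\<close>)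
    have fd: "?f (b i) = d i" if "i \<in> J l" for i
      using ug(5)[OF that, symmetric] by (simp add: Aut_inv_simps[OF ug(1)])
    have dt: "d \<in> tuples (J l)" unfolding d_def by (rule compose_in_tuples)
    have f_d: "compose (J l) ?f b = d"
      by (rule tuples_eqI[OF compose_in_tuples dt]) (simp add: compose_apply fd)
    have "?f \<in> H"
    proof (rule cl[OF fG], intro allI impI)
      fix P assume P: "definable C (J l) (b ` J l) P" "P (compose (J l) ?f b)"
      then obtain h where h: "h \<in> H" "P (\<lambda>i. h (b i))" using near unfolding f_d by blast
      have "P (compose (J l) h b) = P (\<lambda>i. h (b i))" by (rule definable_cong[OF P(1)]) (rule compose_apply)
      then show "\<exists>h\<in>H. P (compose (J l) h b)" using h by blast
    qed
    from RI[OF g(1) this] have "(compose (J l) g b, compose (J l) (\<lambda>x. g (?f x)) b) \<in> ?R" .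
    moreover have "compose (J l) g b = x"
      by (rule tuples_eqI[OF compose_in_tuples x]) (simp add: compose_apply g(2))
    moreover have "compose (J l) (\<lambda>x. g (?f x)) b = y"
    proof (rule tuples_eqI[OF compose_in_tuples y])
      fix i assume i: "i \<in> J l"
      have "g (?f (b i)) = g (d i)" using fd[OF i] by simp
      then show "compose (J l) (\<lambda>x. g (?f x)) b i = y i"
        using i by (simp add: compose_apply d_def Aut_inv_simps[OF g(1)])
    qed
    ultimately show ?thesis by simp
  qed
  note closedR = this
  have "?R = {(x, y). x \<in> tuples (J l) \<and> y \<in> tuples (J l) \<and> (\<forall>\<phi>\<in>?\<Phi>. holds C \<phi> (case_sum x y))}"
  proof (intro subset_antisym subsetI)
    fix z assume z: "z \<in> ?R"
    obtain x y where xy: "z = (x, y)" by (cases z)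
    have "\<forall>\<phi>\<in>?\<Phi>. holds C \<phi> (case_sum x y)" using z unfolding xy by blast
    then show "z \<in> {(x, y). x \<in> tuples (J l) \<and> y \<in> tuples (J l) \<and> (\<forall>\<phi>\<in>?\<Phi>. holds C \<phi> (case_sum x y))}"
      using z Rsub unfolding xy by blast
  next
    fix z assume "z \<in> {(x, y). x \<in> tuples (J l) \<and> y \<in> tuples (J l) \<and> (\<forall>\<phi>\<in>?\<Phi>. holds C \<phi> (case_sum x y))}"
    then obtain x y where "z = (x, y)" "x \<in> tuples (J l)" "y \<in> tuples (J l)" "\<forall>\<phi>\<in>?\<Phi>. holds C \<phi> (case_sum x y)"
      by (cases z) simp
    then show "z \<in> ?R" using closedR by simp
  qed
  moreover have "?\<Phi> \<subseteq> formulas C ?J2 {}" by (rule Collect_restrict)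
  ultimately have td: "type_definable_equiv C (J l) ?R"
    unfolding type_definable_equiv_def using eqv by (intro conjI exI[of _ ?\<Phi>])
  let ?e' = "(J l, ?R `` {b})"
  have hyp: "hyperimaginary C ?e'"
    unfolding hyperimaginary_def using r(2) td quotientI[OF r(1), of ?R] by (intro conjI exI[of _ ?R]) simp_all
  have bb: "b \<in> snd ?e'" using equiv_class_self[OF eqv r(1)] by simp
  obtain E' \<P>' where e': "hyper C ?e' E' \<P>' b" by (rule hyperE[OF hyp bb])
  interpret e': hyper C ?e' E' \<P>' b by (rule e')
  have "hyp_image f ?e' = ?e' \<longleftrightarrow> f \<in> H" if f: "f \<in> G" for f
  proof -
    note fA = Aut_over_Aut[OF f]
    have "E' `` {b} = ?R `` {b}" using e'.rep(2) by simp
    then have "(b, y) \<in> E' \<longleftrightarrow> (b, y) \<in> ?R" for y by blast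
    then have "hyp_image f ?e' = ?e' \<longleftrightarrow> (b, compose (J l) f b) \<in> ?R"
      using e'.hyp_image_fixes_iff[OF fA] by simp
    also have "\<dots> \<longleftrightarrow> f \<in> H"
    proof
      assume "f \<in> H"
      from RI[OF Aut_id this] show "(b, compose (J l) f b) \<in> ?R" by (simp add: compose_id[OF r(1)])
    next
      assume "(b, compose (J l) f b) \<in> ?R"
      from RE[OF this] show "f \<in> H"
      proof (elim disjE exE conjE)
        assume "b = compose (J l) f b"
        then show "f \<in> H" using fixb[OF fA] by simp
      next
        fix g h assume g: "g \<in> Aut C" "h \<in> H" "b = compose (J l) g b" "compose (J l) f b = compose (J l) (\<lambda>x. g (h x)) b"
        have "g \<in> H" using fixb[OF g(1)] g(3) by simp
        from comp[OF this g(2)] have gh: "(\<lambda>x. g (h x)) \<in> H" .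
        have "(\<lambda>x. inv_into UNIV (\<lambda>x. g (h x)) (f x)) \<in> H" by (rule step[OF HA[OF gh] fA g(4)[symmetric]])
        from comp[OF gh this] show "f \<in> H" using Aut_inv_simps(1)[OF HA[OF gh]] by simp
      qed
    qed
    finally show ?thesis .
  qed
  then have Heq: "H = {f \<in> G. hyp_image f ?e' = ?e'}" using HG by blast
  have "bounded_over C ?e' e"
  proof (rule bounded_if_Autf_fixed)
    fix f assume "f \<in> Autf_L C e"
    then have "f \<in> H" using Autf_Ker Ker by blast
    then show "hyp_image f ?e' = ?e'" using Heq by blast
  qed
  from that[OF hyp _ this bb Heq] show ?thesis by simp
qed

end

theorem proposition2p7:
  fixes C :: "('f, 'r, 'a, 'k) big_structure"
    and T :: "('f, 'r, unit + nat, 'a) fm set"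
    and e :: "('i, 'a) hyp"
    and X :: "'x set" and \<Sigma> :: "('f, 'r, 'x + nat, 'a) fm set"
    and H :: "('a \<Rightarrow> 'a) set"
  assumes "complete_theory C T" and "monster_model C T"
    and "hyperimaginary C e"
    and "partial_type C X \<Sigma>" and "invariant_type C e X \<Sigma>"
    and "\<exists>l c. realization_tuple C X \<Sigma> l c \<and> in_dcl C e (c ` seq_index C l X)"
    and "subgroup H (Aut_group C e)"
  shows "(closedin (Gal_topology C e X \<Sigma>) (Gal_proj C e X \<Sigma> ` H) \<and>
          H = {f \<in> Aut_over C e. Gal_proj C e X \<Sigma> f \<in> Gal_proj C e X \<Sigma> ` H})
     \<longleftrightarrow>
         (\<exists>(l :: 'k) (e' :: ('k \<times> 'x, 'a) hyp).
            hyperimaginary C e' \<and> fst e' = seq_index C l X \<and> bounded_over C e' e \<and>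
            (\<exists>a \<in> snd e'. realization_tuple C X \<Sigma> l a) \<and>
            H = {f \<in> Aut_over C e. hyp_image f e' = e'})"
proof -
  interpret m: monster C
    using assms(2) by unfold_locales (simp_all add: monster_model_def)
  obtain a where "a \<in> snd e" using m.hyperimaginary_ne[OF assms(3)] by blast
  from m.hyperE[OF assms(3) this] obtain E \<P> where "hyper C e E \<P> a" .
  then interpret hyper C e E \<P> a .
  interpret relativized C e E \<P> a X \<Sigma>
    by unfold_locales (use assms(4,5,6) in \<open>simp_all add: partial_type_def\<close>)
  obtain l b where b: "good_tuple l b" and top: "Gal_topology C e X \<Sigma> =
      quotient_topology (type_space C e X \<Sigma> l b) (type_to_Gal C e X \<Sigma> l b) (carrier (Gal_L C e X \<Sigma>))"
    by (rule Gal_topology_good_tuple)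
  note H = assms(7)
  show ?thesis
  proof
    assume *: "closedin (Gal_topology C e X \<Sigma>) (Gal_proj C e X \<Sigma> ` H) \<and>
      H = {f \<in> Aut_over C e. Gal_proj C e X \<Sigma> f \<in> Gal_proj C e X \<Sigma> ` H}"
    then have Ker: "Ker \<subseteq> H" using saturated_subgroup_iff[OF H] by blast
    have cl: "\<forall>f\<in>G. in_closure l b H f \<longrightarrow> f \<in> H"
      using * closedin_Gal_iff[OF b H Ker] unfolding top by blast
    obtain e' where "hyperimaginary C e'" "fst e' = J l" "bounded_over C e' e" "b \<in> snd e'"
      "H = {f \<in> G. hyp_image f e' = e'}"
      using closed_subgroup_is_stabilizer[OF b H Ker] cl by blast
    then show "\<exists>(l :: 'k) (e' :: ('k \<times> 'x, 'a) hyp).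
            hyperimaginary C e' \<and> fst e' = seq_index C l X \<and> bounded_over C e' e \<and>
            (\<exists>a \<in> snd e'. realization_tuple C X \<Sigma> l a) \<and>
            H = {f \<in> Aut_over C e. hyp_image f e' = e'}"
      using good_tupleD(1)[OF b] by blast
  next
    assume "\<exists>(l :: 'k) (e' :: ('k \<times> 'x, 'a) hyp).
            hyperimaginary C e' \<and> fst e' = seq_index C l X \<and> bounded_over C e' e \<and>
            (\<exists>a \<in> snd e'. realization_tuple C X \<Sigma> l a) \<and>
            H = {f \<in> Aut_over C e. hyp_image f e' = e'}"
    then obtain l' and e' :: "('k \<times> 'x, 'a) hyp" and a' where e': "hyperimaginary C e'" "fst e' = J l'"
      "bounded_over C e' e" "a' \<in> snd e'" "realization_tuple C X \<Sigma> l' a'"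
      "H = {f \<in> G. hyp_image f e' = e'}" by blast
    from m.hyperE[OF e'(1,4)] obtain E' \<P>' where h': "hyper C e' E' \<P>' a'" .
    have Kfix: "hyp_image k e' = e'" if "k \<in> Ker" for k
      by (rule Ker_fixes_bounded[OF h' e'(3,2,5) that])
    have Ker: "Ker \<subseteq> H" using Kfix Ker_G unfolding e'(6) by blast
    have "f \<in> H" if f: "f \<in> G" and cl: "in_closure l b H f" for f
    proof -
      have "hyp_image f e' = e'"
      proof (rule bounded_stabilizer_closed[OF b h' Kfix f])
        fix P assume "definable C (J l) (b ` J l) P" "P (compose (J l) f b)"
        then show "\<exists>h\<in>G. hyp_image h e' = e' \<and> P (compose (J l) h b)"
          using cl unfolding e'(6) by blast
      qed
      then show ?thesis using f unfolding e'(6) by simp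
    qed
    then have "closedin (Gal_topology C e X \<Sigma>) (Gal_proj C e X \<Sigma> ` H)"
      unfolding top closedin_Gal_iff[OF b H Ker] by blast
    then show "closedin (Gal_topology C e X \<Sigma>) (Gal_proj C e X \<Sigma> ` H) \<and>
      H = {f \<in> Aut_over C e. Gal_proj C e X \<Sigma> f \<in> Gal_proj C e X \<Sigma> ` H}"
      using saturated_subgroup_iff[OF H] Ker by blast
  qed
qed

end
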